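(* Let $Q$ be the quiver of type $\tilde A_{n,1}$ ($n\ge1$). Then the set of integers $l\ge0$ such that $Q$ admits a maximal green sequence of length $l$ is exactly the integer interval $\{n+1,n+2,\dots,\frac{n(n+3)}{2}\}$.
   Context: $Q$ has vertices $0,1,\dots,n$, arrows $k-1\to k$ for $1\le k\le n$, and one additional arrow $0\to n$. For a cluster quiver $Q$ (finite, connected, no loops or oriented 2-cycles), the framed quiver $\hat Q$ is obtained by adding, for each vertex $i$, a new frozen vertex $c(i)$ and an arrow $i\to c(i)$. Mutation $\mu_k$ at a non-frozen vertex $k$: (1) for every pair of arrows $i\to k\to j$ add an arrow $i\to j$; (2) reverse every arrow incident to $k$; (3) remove a maximal collection of oriented 2-cycles and all arrows between frozen vertices. In a quiver obtained from $\hat Q$ by iterated mutations at non-frozen vertices, a non-frozen vertex $i$ is green if there is no arrow from a frozen vertex to $i$. A green sequence is a sequence $(i_1,\dots,i_l)$ of vertices of $Q$ such that $i_1$ is green in $\hat Q$ and $i_k$ is green in $\mu_{i_{k-1}}\cdots\mu_{i_1}\hat Q$ for $2\le k\le l$; its length is $l$; it is maximal if $\mu_{i_l}\cdots\mu_{i_1}\hat Q$ has no green vertex. *)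

theory Defs
  imports Main
begin

text \<open>A quiver on a vertex type 'v is encoded by its arrow multiplicities:
  q i j = number of arrows from i to j.  In framed quivers the vertices are
  Inl i (the non-frozen vertex i) and Inr i (the frozen vertex c(i)).\<close>

type_synonym 'v quiver = "'v \<Rightarrow> 'v \<Rightarrow> nat"

definition atilde :: "nat \<Rightarrow> nat quiver" where
  "atilde n i j =
     (if 1 \<le> j \<and> j \<le> n \<and> i = j - 1 then 1 else 0) + (if i = 0 \<and> j = n then 1 else 0)"

definition framed :: "nat \<Rightarrow> nat quiver \<Rightarrow> (nat + nat) quiver" where
  "framed n q x y =
     (case (x, y) of
        (Inl i, Inl j) \<Rightarrow> (if i \<le> n \<and> j \<le> n then q i j else 0)
      | (Inl i, Inr j) \<Rightarrow> (if i = j \<and> i \<le> n then 1 else 0)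
      | _ \<Rightarrow> 0)"

definition frozen :: "(nat + nat) \<Rightarrow> bool" where
  "frozen x = (case x of Inl _ \<Rightarrow> False | Inr _ \<Rightarrow> True)"

text \<open>Mutation at k: (1) for each pair of arrows i -> k -> j add an arrow i -> j;
  (2) reverse all arrows incident to k; (3) remove a maximal collection of oriented
  2-cycles and all arrows between frozen vertices.\<close>
definition mut_step1 :: "'v \<Rightarrow> 'v quiver \<Rightarrow> 'v quiver" where
  "mut_step1 k q i j = q i j + q i k * q k j"

definition mut_step2 :: "'v \<Rightarrow> 'v quiver \<Rightarrow> 'v quiver" where
  "mut_step2 k q i j = (if i = k \<or> j = k then q j i else q i j)"

definition mut_step3 :: "('v \<Rightarrow> bool) \<Rightarrow> 'v quiver \<Rightarrow> 'v quiver" where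
  "mut_step3 fr q i j = (if fr i \<and> fr j then 0 else q i j - q j i)"

definition mutate :: "nat \<Rightarrow> (nat + nat) quiver \<Rightarrow> (nat + nat) quiver" where
  "mutate k q = mut_step3 frozen (mut_step2 (Inl k) (mut_step1 (Inl k) q))"

definition green :: "(nat + nat) quiver \<Rightarrow> nat \<Rightarrow> bool" where
  "green q i = (\<forall>j. q (Inr j) (Inl i) = 0)"

fun mutate_seq :: "(nat + nat) quiver \<Rightarrow> nat list \<Rightarrow> (nat + nat) quiver" where
  "mutate_seq q [] = q"
| "mutate_seq q (k # ks) = mutate_seq (mutate k q) ks"

fun green_seq :: "nat \<Rightarrow> (nat + nat) quiver \<Rightarrow> nat list \<Rightarrow> bool" where
  "green_seq n q [] = True"
| "green_seq n q (k # ks) = (k \<le> n \<and> green q k \<and> green_seq n (mutate k q) ks)"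

definition maximal_green_seq :: "nat \<Rightarrow> (nat + nat) quiver \<Rightarrow> nat list \<Rightarrow> bool" where
  "maximal_green_seq n q ks =
     (green_seq n q ks \<and> (\<forall>i\<le>n. \<not> green (mutate_seq q ks) i))"

end

theory Submission
  imports Defs
begin

text \<open>
  A green mutation at \<open>k\<close> replaces the c-vector \<open>c\<^sub>k \<ge> 0\<close> by \<open>- c\<^sub>k\<close> and adds non-negative multiples of it
  to other c-vectors, while the exchange matrix is the Gram matrix of the c-vectors for one fixed skew
  form.  Hence a vertex that is never mutated stays green, which gives the lower bound \<open>n + 1\<close>.

  For the upper bound put \<open>N = n + 1\<close> and write each c-vector as an interval \<open>[a, b)\<close> of integers
  modulo \<open>N\<close> (negative if \<open>b < a\<close>), drawn as an edge \<open>a \<rightarrow> b\<close> of a periodic graph on the integers.  This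
  graph behaves like a binary search tree, with the roles of parents and children exchanged at the
  multiples of \<open>N\<close>, and a green mutation is a tree rotation, turning \<open>a \<rightarrow> b\<close> with \<open>a < b\<close> into \<open>b \<rightarrow> a\<close>.
  Paths leading to the left persist under rotations and paths leading to the right are never created,
  so no interval is used twice.  Initially there is a path from \<open>0\<close> to \<open>N\<close>, finally there is none; it
  is lost when an edge \<open>0 \<rightarrow> v\<close> with \<open>0 < v < N\<close> is rotated.  No interval used until then contains
  \<open>v\<close> and no later one contains \<open>v - 1\<close>, modulo \<open>N\<close>.  So they translate to distinct pairs
  \<open>v \<le> a < b \<le> v + N\<close> other than \<open>(v, v + N)\<close>, of which there are \<open>n (n + 3) / 2\<close>.

  All lengths in between occur: a green linear path of \<open>m\<close> vertices can be shortened by one vertex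
  either in one step at its source or in \<open>m\<close> steps from its sink to its source.
\<close>


text \<open>Initially edge \<open>i\<close> runs from \<open>i\<close> to \<open>i + 1\<close>. At
  the nodes \<open>1, ..., n\<close> the arrow goes from the edge on the left to the edge on the
  right, but at \<open>0\<close>, taken modulo \<open>N\<close>, the extra arrow from
  \<open>0\<close> to \<open>n\<close> goes from right to left. This single reversal is why parents
  and children trade roles at the multiples of \<open>N\<close>, and why the all-ones vector does
  not pair to zero with everything. The graph has to be unrolled over the integers because modulo
  \<open>N\<close> it may contain cycles, and residues do not show how often an interval winds
  round. The main work is that the picture is stable: search order, absence of cycles and the
  reading of arrows from cyclic slot orders survive a rotation only together. For the count, no cut
  of the circle is known in advance; the rotation that destroys the path from \<open>0\<close> to
  \<open>N\<close> supplies the cut \<open>v\<close>. There are \<open>(n + 1) * (n + 2) / 2\<close>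
  pairs \<open>v \<le> a < b \<le> v + N\<close>, and the full turn is the one excluded.\<close>

section \<open>c-vector dynamics\<close>

text \<open>On unit vectors this is the number of arrows from \<open>i\<close> to \<open>j\<close>
  minus the number from \<open>j\<close> to \<open>i\<close>: the sum runs over the arrows of the
  linear path, the last term is the extra arrow from \<open>0\<close> to \<open>n\<close>.\<close>

definition om :: "nat \<Rightarrow> (nat \<Rightarrow> int) \<Rightarrow> (nat \<Rightarrow> int) \<Rightarrow> int" where
  "om n u v = (\<Sum>k<n. u k * v (Suc k) - v k * u (Suc k)) + (u 0 * v n - v 0 * u n)"

lemma om_swap: "om n v u = - om n u v"
  by (simp add: om_def sum_negf[symmetric] sum_subtractf algebra_simps)

lemma om_self [simp]: "om n u u = 0"
  by (simp add: om_def algebra_simps)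

lemma om_add_left: "om n (\<lambda>j. u j + v j) w = om n u w + om n v w"
  by (simp add: om_def sum.distrib sum_subtractf algebra_simps)

lemma om_scale_left: "om n (\<lambda>j. a * u j) w = a * om n u w"
  by (simp add: om_def sum_distrib_left right_diff_distrib distrib_left algebra_simps)

lemma om_uminus_left: "om n (\<lambda>j. - u j) w = - om n u w"
  using om_scale_left[of n "-1" u w] by simp

lemma om_diff_left: "om n (\<lambda>j. u j - v j) w = om n u w - om n v w"
  using om_add_left[of n u "\<lambda>j. - v j" w] om_uminus_left[of n v w] by simp

lemma om_add_right: "om n w (\<lambda>j. u j + v j) = om n w u + om n w v"
  using om_add_left[of n u v w] by (simp add: om_swap[of n w])

lemma om_scale_right: "om n w (\<lambda>j. a * u j) = a * om n w u"
  using om_scale_left[of n a u w] by (simp add: om_swap[of n w])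

lemma om_uminus_right: "om n w (\<lambda>j. - u j) = - om n w u"
  using om_uminus_left[of n u w] by (simp add: om_swap[of n w])

lemma om_diff_right: "om n w (\<lambda>j. u j - v j) = om n w u - om n w v"
  using om_diff_left[of n u v w] by (simp add: om_swap[of n w])

lemma om_sum_left: "finite A \<Longrightarrow> om n (\<lambda>j. \<Sum>a\<in>A. u a j) w = (\<Sum>a\<in>A. om n (u a) w)"
proof (induction A rule: finite_induct)
  case empty
  then show ?case by (simp add: om_def)
next
  case (insert a A)
  then show ?case using om_add_left[of n "u a" "\<lambda>j. \<Sum>a\<in>A. u a j" w] by simp
qed

lemma om_sum_right: "finite A \<Longrightarrow> om n w (\<lambda>j. \<Sum>a\<in>A. u a j) = (\<Sum>a\<in>A. om n w (u a))"
  using om_sum_left[of A n u w] by (simp add: om_swap[of n w] sum_negf)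

lemmas om_linear = om_add_left om_scale_left om_uminus_left om_diff_left
  om_add_right om_scale_right om_uminus_right om_diff_right

lemma om_cong: 
  assumes "\<And>j. j \<le> n \<Longrightarrow> u j = u' j" "\<And>j. j \<le> n \<Longrightarrow> v j = v' j" 
  shows "om n u v = om n u' v'"
  using assms unfolding om_def by (auto intro!: arg_cong2[of _ _ _ _ "(+)"] sum.cong)

definition unit_vec :: "nat \<Rightarrow> nat \<Rightarrow> int" where
  [simp]: "unit_vec i j = of_bool (i = j)"

lemma int_atilde: "j \<le> n \<Longrightarrow> int (atilde n i j) = of_bool (j = Suc i) + of_bool (i = 0 \<and> j = n)"
  by (cases j) (auto simp: atilde_def)

lemma om_unit_vec:
  assumes "n \<ge> 1" "i \<le> n" "j \<le> n"
  shows "om n (unit_vec i) (unit_vec j) = of_bool (j = Suc i) + of_bool (i = 0 \<and> j = n)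
      - of_bool (i = Suc j) - of_bool (j = 0 \<and> i = n)"
proof -
  have "(\<Sum>k<n. of_bool (i = k) * of_bool (j = Suc k)) = (of_bool (j = Suc i) :: int)"
    if "j \<le> n" for i j
  proof -
    have "(\<Sum>k<n. of_bool (i = k) * of_bool (j = Suc k)) = (\<Sum>k<n. if k = i then of_bool (j = Suc i) else (0::int))"
      by (intro sum.cong) auto
    then show ?thesis using that by (auto simp: sum.delta)
  qed
  then show ?thesis
    using assms unfolding om_def sum_subtractf unit_vec_def by (simp only: of_bool_conj)
qed

lemma om_unit_vec_atilde:
  assumes "n \<ge> 1" "i \<le> n" "j \<le> n"
  shows "om n (unit_vec i) (unit_vec j) = int (atilde n i j) - int (atilde n j i)"
  using assms by (simp only: om_unit_vec int_atilde)

lemma om_unit_vec_nat: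
  assumes "n \<ge> 1" "i \<le> n" "j \<le> n"
  shows "nat (om n (unit_vec i) (unit_vec j)) = atilde n i j"
proof -
  have "atilde n i j = 0 \<or> atilde n j i = 0" using assms by (auto simp: atilde_def)
  then show ?thesis using om_unit_vec_atilde[OF assms] by auto
qed

text \<open>The mutation rule of c-vectors at a green vertex \<open>k\<close>: the factor
  \<open>max 0 (om n (c i) (c k))\<close> is the number of arrows from \<open>i\<close> to
  \<open>k\<close>, and these are the relevant ones because \<open>c k\<close> is
  non-negative.\<close>

definition cmut :: "nat \<Rightarrow> nat \<Rightarrow> (nat \<Rightarrow> nat \<Rightarrow> int) \<Rightarrow> nat \<Rightarrow> nat \<Rightarrow> int" where
  "cmut n k c i = (if i = k then (\<lambda>j. - c k j) else (\<lambda>j. c i j + max 0 (om n (c i) (c k)) * c k j))"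

definition nonneg :: "nat \<Rightarrow> (nat \<Rightarrow> int) \<Rightarrow> bool" where
  "nonneg n v \<longleftrightarrow> (\<forall>j\<le>n. 0 \<le> v j)"

text \<open>Encoding of a framed quiver by its c-vectors: on the non-frozen part the signed arrow
  numbers stay the values of one fixed skew form on the c-vectors.\<close>

definition encodes :: "nat \<Rightarrow> (nat \<Rightarrow> nat \<Rightarrow> int) \<Rightarrow> (nat + nat) quiver \<Rightarrow> bool" where
  "encodes n c q \<longleftrightarrow>
     (\<forall>i\<le>n. \<forall>j\<le>n. q (Inl i) (Inl j) = nat (om n (c i) (c j))) \<and>
     (\<forall>i\<le>n. \<forall>j. q (Inl i) (Inr j) = (if j \<le> n then nat (c i j) else 0)) \<and>
     (\<forall>i\<le>n. \<forall>j. q (Inr j) (Inl i) = (if j \<le> n then nat (- c i j) else 0))"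

lemma encodes_initial: "n \<ge> 1 \<Longrightarrow> encodes n unit_vec (framed n (atilde n))"
  by (auto simp: encodes_def framed_def om_unit_vec_nat)

lemma green_iff_nonneg: "encodes n c q \<Longrightarrow> i \<le> n \<Longrightarrow> green q i \<longleftrightarrow> nonneg n (c i)"
  by (auto simp: encodes_def green_def nonneg_def)

text \<open>Here \<open>a\<close>, \<open>b\<close>, \<open>c\<close> are the signed numbers of
  arrows from \<open>i\<close> to \<open>j\<close>, from \<open>i\<close> to \<open>k\<close> and
  from \<open>k\<close> to \<open>j\<close>. The left side is what mutation leaves after cancelling
  2-cycles, the right side what bilinearity gives for the mutated c-vectors. Paths through
  \<open>k\<close> in the two directions never coexist.\<close>

lemma pos_part_exchange:
  fixes a b c :: int
  shows "nat a + nat b * nat c - (nat (- a) + nat (- c) * nat (- b))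
    = nat (a + max 0 b * c + max 0 (- c) * b)"
proof -
  have diff: "p - q = nat v" if "int p - int q = v" for p q :: nat and v using that by linarith
  have "int (nat a + nat b * nat c) - int (nat (- a) + nat (- c) * nat (- b))
     = max 0 a + max 0 b * max 0 c - (max 0 (- a) + max 0 (- c) * max 0 (- b))"
    by simp
  also have "\<dots> = a + max 0 b * c + max 0 (- c) * b"
    by (auto simp: max_def)
  finally show ?thesis by (rule diff)
qed

lemma encodes_mutate:
  assumes "encodes n c q" "k \<le> n" "nonneg n (c k)"
  shows "encodes n (cmut n k c) (mutate k q)"
proof -
  have A: "\<And>i j. i \<le> n \<Longrightarrow> j \<le> n \<Longrightarrow> q (Inl i) (Inl j) = nat (om n (c i) (c j))"
    and B: "\<And>i j. i \<le> n \<Longrightarrow> q (Inl i) (Inr j) = (if j \<le> n then nat (c i j) else 0)"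
    and C: "\<And>i j. i \<le> n \<Longrightarrow> q (Inr j) (Inl i) = (if j \<le> n then nat (- c i j) else 0)"
    using assms(1) by (auto simp: encodes_def)
  note m = mutate_def mut_step3_def mut_step2_def mut_step1_def frozen_def
  have ck: "0 \<le> c k j" if "j \<le> n" for j using assms(3) that by (simp add: nonneg_def)
  have kk: "q (Inl k) (Inl k) = 0" using A assms(2) by simp
  have "mutate k q (Inl i) (Inl j) = nat (om n (cmut n k c i) (cmut n k c j))" if "i \<le> n" "j \<le> n" for i j
  proof (cases "i = k \<or> j = k")
    case True
    have sw: "om n (c j) (c k) = - om n (c k) (c j)" "om n (c i) (c k) = - om n (c k) (c i)"
      by (rule om_swap)+
    have "mutate k q (Inl i) (Inl j) = q (Inl j) (Inl i) - q (Inl i) (Inl j)"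
      using True kk by (auto simp: m)
    also have "\<dots> = nat (- om n (c i) (c j))"
      using A that by (simp add: om_swap[of n "c j" "c i"])
    also have "- om n (c i) (c j) = om n (cmut n k c i) (cmut n k c j)"
      using True by (elim disjE) (auto simp: cmut_def om_linear sw)
    finally show ?thesis .
  next
    case False
    let ?a = "om n (c i) (c j)" and ?b = "om n (c i) (c k)" and ?c = "om n (c k) (c j)"
    have sw: "om n (c j) (c i) = - ?a" "om n (c k) (c i) = - ?b" "om n (c j) (c k) = - ?c"
      by (rule om_swap)+
    have om: "om n (cmut n k c i) (cmut n k c j) = ?a + max 0 ?b * ?c + max 0 (- ?c) * ?b"
      using False by (simp add: cmut_def om_linear sw)
    have "mutate k q (Inl i) (Inl j) = nat ?a + nat ?b * nat ?c - (nat (- ?a) + nat (- ?c) * nat (- ?b))"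
      using False A that assms(2) by (simp add: m sw)
    then show ?thesis using om pos_part_exchange[of ?a ?b ?c] by simp
  qed
  moreover have "mutate k q (Inl i) (Inr j) = (if j \<le> n then nat (cmut n k c i j) else 0)"
    and "mutate k q (Inr j) (Inl i) = (if j \<le> n then nat (- cmut n k c i j) else 0)" if "i \<le> n" for i j
  proof -
    let ?b = "om n (c i) (c k)"
    have sw: "om n (c k) (c i) = - ?b" by (rule om_swap)
    have mult: "nat ?b * nat (c k j) = nat (max 0 ?b * c k j)" if "j \<le> n"
      using ck[OF that] by (auto simp: max_def nat_mult_distrib)
    have diff: "nat x + nat w - nat (- x) = nat (x + w)" "nat (- x) - (nat x + nat w) = nat (- x - w)"
      if "0 \<le> w" for x w :: int using that by auto
    have nn: "0 \<le> max 0 ?b * c k j" if "j \<le> n" using ck[OF that] by simp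
    show "mutate k q (Inl i) (Inr j) = (if j \<le> n then nat (cmut n k c i j) else 0)"
      using A B C that assms(2) kk ck[of j] mult nn diff by (auto simp: m cmut_def sw)
    show "mutate k q (Inr j) (Inl i) = (if j \<le> n then nat (- cmut n k c i j) else 0)"
      using A B C that assms(2) kk ck[of j] mult nn diff by (auto simp: m cmut_def sw)
  qed
  ultimately show ?thesis unfolding encodes_def by blast
qed

fun cmut_seq :: "nat \<Rightarrow> (nat \<Rightarrow> nat \<Rightarrow> int) \<Rightarrow> nat list \<Rightarrow> nat \<Rightarrow> nat \<Rightarrow> int" where
  "cmut_seq n c [] = c"
| "cmut_seq n c (k # ks) = cmut_seq n (cmut n k c) ks"

fun cgreen_seq :: "nat \<Rightarrow> (nat \<Rightarrow> nat \<Rightarrow> int) \<Rightarrow> nat list \<Rightarrow> bool" where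
  "cgreen_seq n c [] \<longleftrightarrow> True"
| "cgreen_seq n c (k # ks) \<longleftrightarrow> k \<le> n \<and> nonneg n (c k) \<and> cgreen_seq n (cmut n k c) ks"

definition max_green :: "nat \<Rightarrow> (nat \<Rightarrow> nat \<Rightarrow> int) \<Rightarrow> nat list \<Rightarrow> bool" where
  "max_green n c ks \<longleftrightarrow> cgreen_seq n c ks \<and> (\<forall>i\<le>n. \<not> nonneg n (cmut_seq n c ks i))"

lemma max_green_Nil: "max_green n c [] \<longleftrightarrow> (\<forall>i\<le>n. \<not> nonneg n (c i))"
  by (simp add: max_green_def)

lemma max_green_Cons: "max_green n c (k # ks) \<longleftrightarrow> k \<le> n \<and> nonneg n (c k) \<and> max_green n (cmut n k c) ks"
  by (auto simp: max_green_def)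

lemma maximal_green_seq_iff: 
  "encodes n c q \<Longrightarrow> maximal_green_seq n q ks \<longleftrightarrow> max_green n c ks"
proof (induction ks arbitrary: c q)
  case Nil
  then show ?case using green_iff_nonneg by (auto simp: maximal_green_seq_def max_green_def)
next
  case (Cons k ks)
  have "maximal_green_seq n q (k # ks) \<longleftrightarrow> k \<le> n \<and> green q k \<and> maximal_green_seq n (mutate k q) ks"
    by (auto simp: maximal_green_seq_def)
  then show ?case using Cons green_iff_nonneg encodes_mutate max_green_Cons by metis
qed

lemma cmut_mono: 
  assumes "nonneg n (c k)" "i \<noteq> k" "j \<le> n"
  shows "c i j \<le> cmut n k c i j"
  using assms by (simp add: cmut_def nonneg_def)

lemma max_green_all_vertices:
  "max_green n c ks \<Longrightarrow> i \<le> n \<Longrightarrow> nonneg n (c i) \<Longrightarrow> i \<in> set ks"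
proof (induction ks arbitrary: c)
  case Nil
  then show ?case by (simp add: max_green_Nil)
next
  case (Cons k ks)
  then have k: "nonneg n (c k)" "max_green n (cmut n k c) ks" by (auto simp: max_green_Cons)
  show ?case
  proof (cases "i = k")
    case False
    have "nonneg n (cmut n k c i)"
      using cmut_mono[of n c k i, OF k(1) False] Cons.prems(3) unfolding nonneg_def by force
    then show ?thesis using Cons.IH[OF k(2) Cons.prems(2)] by simp
  qed simp
qed

lemma max_green_length_ge:
  assumes "max_green n unit_vec ks"
  shows "n + 1 \<le> length ks"
proof -
  have "{..n} \<subseteq> set ks" using max_green_all_vertices[OF assms] by (auto simp: nonneg_def)
  then have "card {..n} \<le> card (set ks)" by (intro card_mono) auto
  then show ?thesis using card_length[of ks] by simp
qed

definition lengths :: "nat \<Rightarrow> (nat \<Rightarrow> nat \<Rightarrow> int) \<Rightarrow> nat set" where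
  "lengths n c = {l. \<exists>ks. max_green n c ks \<and> length ks = l}"

lemma lengths_step:
  assumes "k \<le> n" "nonneg n (c k)" "l \<in> lengths n (cmut n k c)"
  shows "Suc l \<in> lengths n c"
proof -
  obtain ks where "max_green n (cmut n k c) ks" "length ks = l" using assms(3) by (auto simp: lengths_def)
  then have "max_green n c (k # ks)" "length (k # ks) = Suc l" using assms by (auto simp: max_green_Cons)
  then show ?thesis unfolding lengths_def by blast
qed

lemma lengths_eq: 
  assumes "n \<ge> 1"
  shows "{l. \<exists>ks. maximal_green_seq n (framed n (atilde n)) ks \<and> length ks = l} = lengths n unit_vec"
  using maximal_green_seq_iff[OF encodes_initial[OF assms]] by (simp add: lengths_def)

section \<open>Sequences of intermediate lengths\<close>

lemma cmut_self: "cmut n k c k = (\<lambda>p. - c k p)"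
  by (simp add: cmut_def)

lemma cmut_other: "i \<noteq> k \<Longrightarrow> cmut n k c i = (\<lambda>p. c i p + max 0 (om n (c i) (c k)) * c k p)"
  by (simp add: cmut_def)

lemma cmut_fixed: "i \<noteq> k \<Longrightarrow> om n (c i) (c k) \<le> 0 \<Longrightarrow> cmut n k c i = c i"
  by (simp add: cmut_def max_def)

lemma cmut_coord: "i \<noteq> k \<Longrightarrow> c k p = 0 \<Longrightarrow> cmut n k c i p = c i p"
  by (simp add: cmut_def)

section \<open>Sweeps along a linear path\<close>

text \<open>The vectors behave like the simple roots of a linearly oriented path; each has a coordinate
  of its own.\<close>

definition chain :: "nat \<Rightarrow> (nat \<Rightarrow> nat \<Rightarrow> int) \<Rightarrow> nat \<Rightarrow> bool" where
  "chain n \<beta> m \<longleftrightarrow>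
     (\<forall>i<m. \<forall>k<m. om n (\<beta> i) (\<beta> k) = of_bool (k = Suc i) - of_bool (i = Suc k)) \<and>
     (\<forall>i<m. \<forall>p\<le>n. 0 \<le> \<beta> i p) \<and>
     (\<forall>i<m. \<exists>p\<le>n. 0 < \<beta> i p \<and> (\<forall>k<m. k \<noteq> i \<longrightarrow> \<beta> k p = 0))"

lemma chain_mono: "chain n \<beta> m \<Longrightarrow> m' \<le> m \<Longrightarrow> chain n \<beta> m'"
  unfolding chain_def by (meson order_less_le_trans)

lemma chain_Suc: 
  assumes "chain n \<beta> (Suc m)"
  shows "chain n (\<lambda>i. \<beta> (Suc i)) m"
  unfolding chain_def
proof (intro conjI allI impI)
  fix i k assume "i < m" "k < m"
  then show "om n (\<beta> (Suc i)) (\<beta> (Suc k)) = of_bool (k = Suc i) - of_bool (i = Suc k)"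
    using assms by (simp add: chain_def)
next
  fix i p assume "i < m" "p \<le> n"
  then show "0 \<le> \<beta> (Suc i) p" using assms by (simp add: chain_def)
next
  fix i assume "i < m"
  then obtain p where "p \<le> n" "0 < \<beta> (Suc i) p" "\<forall>k<Suc m. k \<noteq> Suc i \<longrightarrow> \<beta> k p = 0"
    using assms unfolding chain_def by (meson Suc_less_eq)
  then show "\<exists>p\<le>n. 0 < \<beta> (Suc i) p \<and> (\<forall>k<m. k \<noteq> i \<longrightarrow> \<beta> (Suc k) p = 0)" by auto
qed

lemma chain_om: "chain n \<beta> m \<Longrightarrow> i < m \<Longrightarrow> k < m \<Longrightarrow>
    om n (\<beta> i) (\<beta> k) = of_bool (k = Suc i) - of_bool (i = Suc k)"
  by (simp add: chain_def)

definition tail_sum :: "(nat \<Rightarrow> nat \<Rightarrow> int) \<Rightarrow> nat \<Rightarrow> nat \<Rightarrow> nat \<Rightarrow> int" where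
  "tail_sum \<beta> m i p = (\<Sum>j\<in>{i..<m}. \<beta> j p)"

lemma tail_sum_rec: "i < m \<Longrightarrow> tail_sum \<beta> m i = (\<lambda>p. \<beta> i p + tail_sum \<beta> m (Suc i) p)"
  by (auto simp: tail_sum_def sum.atLeast_Suc_lessThan)

lemma tail_sum_last: "0 < m \<Longrightarrow> tail_sum \<beta> m (m - 1) = \<beta> (m - 1)"
  by (cases m) (auto simp: tail_sum_def)

lemma tail_sum_zero: "(\<And>i. i < m \<Longrightarrow> \<beta> i p = 0) \<Longrightarrow> tail_sum \<beta> m i p = 0"
  by (simp add: tail_sum_def)

text \<open>The two neighbours of position \<open>i\<close> contribute \<open>1\<close> and
  \<open>-1\<close> and cancel when both lie in the tail; what remains comes from the ends of the
  tail.\<close>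

lemma chain_om_tail_sum:
  assumes "chain n \<beta> m" "i < m" "j \<le> m"
  shows "om n (\<beta> i) (tail_sum \<beta> m j) = of_bool (j \<le> Suc i \<and> Suc i < m) - of_bool (j < i)"
proof -
  have "om n (\<beta> i) (tail_sum \<beta> m j) = (\<Sum>k\<in>{j..<m}. om n (\<beta> i) (\<beta> k))"
    unfolding tail_sum_def by (rule om_sum_right) simp
  also have "\<dots> = (\<Sum>k\<in>{j..<m}. of_bool (k = Suc i) - of_bool (i = Suc k))"
    using chain_om[OF assms(1,2)] by (intro sum.cong) auto
  also have "\<dots> = (\<Sum>k\<in>{j..<m}. if k = Suc i then 1 else 0) - (\<Sum>k\<in>{j..<m}. if k = i - 1 then of_bool (0 < i) else 0)"
    unfolding sum_subtractf[symmetric] by (intro sum.cong) auto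
  also have "\<dots> = of_bool (j \<le> Suc i \<and> Suc i < m) - of_bool (j < i)"
    using assms(2) by (auto simp: sum.delta)
  finally show ?thesis .
qed

lemma chain_tail_sum_nonneg: "chain n \<beta> m \<Longrightarrow> nonneg n (tail_sum \<beta> m i)"
  by (auto simp: chain_def nonneg_def tail_sum_def intro!: sum_nonneg)

lemma chain_tail_sum_0_pos:
  assumes "chain n \<beta> m" "0 < m"
  obtains p where "p \<le> n" "0 < tail_sum \<beta> m 0 p" "0 < \<beta> (m - 1) p" "\<And>i. i < m - 1 \<Longrightarrow> \<beta> i p = 0"
proof -
  obtain p where p: "p \<le> n" "0 < \<beta> (m - 1) p" "\<And>k. k < m \<Longrightarrow> k \<noteq> m - 1 \<Longrightarrow> \<beta> k p = 0"
    using assms unfolding chain_def by (metis diff_less zero_less_one)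
  have "tail_sum \<beta> m 0 p = (\<Sum>j\<in>{0..<m}. if j = m - 1 then \<beta> (m - 1) p else 0)"
    unfolding tail_sum_def using p(3) by (intro sum.cong) auto
  then have "tail_sum \<beta> m 0 p = \<beta> (m - 1) p" using assms(2) by (simp add: sum.delta)
  then show ?thesis using that p by simp
qed

text \<open>The state after mutating along the path from its sink up to position \<open>t\<close>.\<close>

definition swept :: "nat \<Rightarrow> (nat \<Rightarrow> nat \<Rightarrow> int) \<Rightarrow> (nat \<Rightarrow> nat) \<Rightarrow> (nat \<Rightarrow> nat \<Rightarrow> int) \<Rightarrow> nat \<Rightarrow> nat
    \<Rightarrow> (nat \<Rightarrow> nat \<Rightarrow> int) \<Rightarrow> bool" where
  "swept n c g \<beta> m t c' \<longleftrightarrow>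
     (\<forall>i<m. c' (g i) = (if Suc i < t then \<beta> i else if Suc i = t then tail_sum \<beta> m i
                        else if i = t then (\<lambda>p. - tail_sum \<beta> m t p) else \<beta> (i - 1))) \<and>
     (\<forall>r. r \<notin> g ` {..<m} \<longrightarrow>
        (\<forall>p. (\<forall>i<m. \<beta> i p = 0) \<longrightarrow> c' r p = c r p) \<and>
        ((\<forall>i\<in>{1..<m}. om n (c r) (tail_sum \<beta> m i) \<le> 0) \<longrightarrow>
           c' r = (if t = 0 then (\<lambda>p. c r p + max 0 (om n (c r) (tail_sum \<beta> m 0)) * tail_sum \<beta> m 0 p)
                   else c r)))"

lemma swept_initial:
  assumes "\<And>i. i < m \<Longrightarrow> c (g i) = \<beta> i" "0 < m"
  shows "swept n c g \<beta> m m c"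
proof -
  have "\<beta> i = tail_sum \<beta> m i" if "i < m" "\<not> Suc i < m" for i
    using tail_sum_last[of m \<beta>] that assms(2) by (metis Suc_lessI diff_Suc_1)
  then show ?thesis using assms unfolding swept_def by auto
qed

text \<open>Position \<open>t\<close> carries the sum of the labels from \<open>t\<close> on.
  Mutating there passes it to the predecessor, which becomes the next such sum, and turns the vertex
  mutated just before, minus the sum from \<open>t + 1\<close> on, into \<open>\<beta> t\<close>;
  the other path labels pair to zero with it. A full sweep thus shifts the labels by one position
  and leaves minus the total at position \<open>0\<close>. A vertex off the path without arrows to
  the proper tails changes only in the last step.\<close>

lemma swept_step:
  assumes ch: "chain n \<beta> m" and inj: "inj_on g {..<m}" and sw: "swept n c g \<beta> m (Suc t) c'" and t: "t < m"
  shows "swept n c g \<beta> m t (cmut n (g t) c')"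
proof -
  have gt: "c' (g t) = tail_sum \<beta> m t" using sw t by (simp add: swept_def)
  have "cmut n (g t) c' (g i) = (if Suc i < t then \<beta> i else if Suc i = t then tail_sum \<beta> m i
                        else if i = t then (\<lambda>p. - tail_sum \<beta> m t p) else \<beta> (i - 1))" if i: "i < m" for i
  proof -
    have ne: "g i \<noteq> g t" if "i \<noteq> t" using inj_onD[OF inj] i t that by auto
    consider "Suc i < t" | "Suc i = t" | "i = t" | "i = Suc t" | "Suc t < i" by linarith
    then show ?thesis
    proof cases
      case 1
      then have "c' (g i) = \<beta> i" using sw i by (simp add: swept_def)
      moreover have "om n (\<beta> i) (tail_sum \<beta> m t) = 0" using chain_om_tail_sum[OF ch i, of t] t 1 by simp
      ultimately show ?thesis using 1 ne gt by (simp add: cmut_other)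
    next
      case 2
      then have "c' (g i) = \<beta> i" using sw i by (simp add: swept_def)
      moreover have "om n (\<beta> i) (tail_sum \<beta> m t) = 1" using chain_om_tail_sum[OF ch i, of t] t 2 by simp
      ultimately show ?thesis using 2 ne gt i tail_sum_rec[OF i, of \<beta>] by (simp add: cmut_other)
    next
      case 3
      then show ?thesis using gt by (simp add: cmut_self)
    next
      case 4
      have ts: "tail_sum \<beta> m t = (\<lambda>p. \<beta> t p + tail_sum \<beta> m (Suc t) p)" using t by (rule tail_sum_rec)
      have "c' (g i) = (\<lambda>p. - tail_sum \<beta> m (Suc t) p)" using sw i 4 by (simp add: swept_def)
      moreover have "om n (\<lambda>p. - tail_sum \<beta> m (Suc t) p) (tail_sum \<beta> m t) = 1"
        using chain_om_tail_sum[OF ch t, of "Suc t"] i 4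
        by (simp add: ts om_linear om_swap[of n "tail_sum \<beta> m (Suc t)"])
      ultimately show ?thesis using 4 ne gt by (simp add: cmut_other ts)
    next
      case 5
      then have "c' (g i) = \<beta> (i - 1)" using sw i by (simp add: swept_def)
      moreover have "om n (\<beta> (i - 1)) (tail_sum \<beta> m t) = 0"
        using chain_om_tail_sum[OF ch, of "i - 1" t] t i 5 by simp
      ultimately show ?thesis using 5 ne gt by (simp add: cmut_other)
    qed
  qed
  moreover have "(\<forall>p. (\<forall>i<m. \<beta> i p = 0) \<longrightarrow> cmut n (g t) c' r p = c r p) \<and>
        ((\<forall>i\<in>{1..<m}. om n (c r) (tail_sum \<beta> m i) \<le> 0) \<longrightarrow>
           cmut n (g t) c' r = (if t = 0 then (\<lambda>p. c r p + max 0 (om n (c r) (tail_sum \<beta> m 0)) * tail_sum \<beta> m 0 p)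
                   else c r))" if r: "r \<notin> g ` {..<m}" for r
  proof -
    have ne: "r \<noteq> g t" using r t by auto
    have 1: "c' r p = c r p" if "\<forall>i<m. \<beta> i p = 0" for p using sw r that by (simp add: swept_def)
    have 2: "c' r = c r" if "\<forall>i\<in>{1..<m}. om n (c r) (tail_sum \<beta> m i) \<le> 0" 
      using sw r that by (simp add: swept_def)
    have "cmut n (g t) c' r p = c r p" if "\<forall>i<m. \<beta> i p = 0" for p
      using 1[OF that] ne gt tail_sum_zero[of m \<beta> p t] that by (simp add: cmut_coord)
    moreover have "cmut n (g t) c' r = (if t = 0 then (\<lambda>p. c r p + max 0 (om n (c r) (tail_sum \<beta> m 0)) * tail_sum \<beta> m 0 p)
                   else c r)" if h: "\<forall>i\<in>{1..<m}. om n (c r) (tail_sum \<beta> m i) \<le> 0"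
    proof (cases "t = 0")
      case True
      then show ?thesis using 2[OF h] ne gt by (simp add: cmut_other)
    next
      case False
      then have "om n (c r) (tail_sum \<beta> m t) \<le> 0" using h t by simp
      then show ?thesis using 2[OF h] ne gt False by (simp add: cmut_fixed)
    qed
    ultimately show ?thesis by blast
  qed
  ultimately show ?thesis unfolding swept_def by blast
qed

lemma lengths_sweep:
  assumes ch: "chain n \<beta> m" and inj: "inj_on g {..<m}" and g: "\<And>i. i < m \<Longrightarrow> g i \<le> n"
    and final: "\<And>c'. swept n c g \<beta> m 0 c' \<Longrightarrow> l \<in> lengths n c'"
    and sw: "swept n c g \<beta> m t c'" and t: "t \<le> m"
  shows "t + l \<in> lengths n c'"
  using sw t
proof (induction t arbitrary: c')
  case 0
  then show ?case using final by simp
next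
  case (Suc t)
  have "swept n c g \<beta> m t (cmut n (g t) c')" using swept_step[OF ch inj Suc.prems(1)] Suc.prems(2) by simp
  then have "t + l \<in> lengths n (cmut n (g t) c')" using Suc.IH Suc.prems(2) by simp
  moreover have "c' (g t) = tail_sum \<beta> m t" using Suc.prems by (simp add: swept_def)
  ultimately show ?case 
    using lengths_step[of "g t" n c' "t + l"] g Suc.prems(2) chain_tail_sum_nonneg[OF ch] by simp
qed

text \<open>A green linear path, while each other vertex stays red as the labels of the path miss one of
  its negative coordinates.\<close>

definition path_stage :: "nat \<Rightarrow> (nat \<Rightarrow> nat \<Rightarrow> int) \<Rightarrow> (nat \<Rightarrow> nat) \<Rightarrow> (nat \<Rightarrow> nat \<Rightarrow> int) \<Rightarrow> nat \<Rightarrow> bool" where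
  "path_stage n c g \<beta> m \<longleftrightarrow> chain n \<beta> m \<and> inj_on g {..<m} \<and> (\<forall>i<m. g i \<le> n \<and> c (g i) = \<beta> i) \<and>
     (\<forall>r\<le>n. r \<notin> g ` {..<m} \<longrightarrow> (\<exists>p\<le>n. c r p < 0 \<and> (\<forall>i<m. \<beta> i p = 0)))"

lemma image_Suc: "g ` {..<Suc m} = insert (g 0) ((\<lambda>i. g (Suc i)) ` {..<m})"
  by (simp add: lessThan_Suc_eq_insert_0 image_image)

lemma lengths_path:
  "path_stage n c g \<beta> m \<Longrightarrow> m \<le> l \<Longrightarrow> l \<le> m * (m + 1) div 2 \<Longrightarrow> l \<in> lengths n c"
proof (induction m arbitrary: c g \<beta> l)
  case 0
  then have "\<exists>p\<le>n. c r p < 0" if "r \<le> n" for r using that by (auto simp: path_stage_def)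
  then have "max_green n c []" by (fastforce simp: max_green_Nil nonneg_def)
  then show ?case using 0 unfolding lengths_def by (auto intro!: exI[of _ "[]"])
next
  case (Suc m)
  have ch: "chain n \<beta> (Suc m)" and inj: "inj_on g {..<Suc m}" and g: "\<And>i. i < Suc m \<Longrightarrow> g i \<le> n"
    and cg: "\<And>i. i < Suc m \<Longrightarrow> c (g i) = \<beta> i"
    and red: "\<And>r. r \<le> n \<Longrightarrow> r \<notin> g ` {..<Suc m} \<Longrightarrow> \<exists>p\<le>n. c r p < 0 \<and> (\<forall>i<Suc m. \<beta> i p = 0)"
    using Suc.prems(1) unfolding path_stage_def by auto
  have inj': "inj_on (\<lambda>i. g (Suc i)) {..<m}" using inj by (auto simp: inj_on_def)
  have tri: "Suc m * (Suc m + 1) div 2 = Suc m + m * (m + 1) div 2" by (simp add: algebra_simps)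
  consider "l = 0" | l' where "l = Suc l'" "m \<le> l'" "l' \<le> m * (m + 1) div 2"
    | l' where "l = Suc m + l'" "m \<le> l'" "l' \<le> m * (m + 1) div 2"
  proof -
    assume a: "\<And>l'. l = Suc l' \<Longrightarrow> m \<le> l' \<Longrightarrow> l' \<le> m * (m + 1) div 2 \<Longrightarrow> thesis"
    assume b: "\<And>l'. l = Suc m + l' \<Longrightarrow> m \<le> l' \<Longrightarrow> l' \<le> m * (m + 1) div 2 \<Longrightarrow> thesis"
    \<comment> \<open>The two ranges leave no gap: taking the source first gives lengths up to
      \<open>1 + m * (m + 1) div 2\<close>, sweeping first gives lengths from
      \<open>2 * m + 1\<close> on.\<close>
    have "m * (m + 1) div 2 \<ge> 2 * m - 1" 
    proof (cases "m < 3")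
      case True
      then have "m = 0 \<or> m = 1 \<or> m = 2" by auto
      then show ?thesis by auto
    next
      case False
      then have "m * 4 \<le> m * (m + 1)" by (intro mult_le_mono2) simp
      then have "m * 4 div 2 \<le> m * (m + 1) div 2" by (rule div_le_mono)
      then show ?thesis by simp
    qed
    then show thesis using a[of "l - 1"] b[of "l - Suc m"] Suc.prems(2,3) tri
      by (cases "l \<le> Suc (m * (m + 1) div 2)") auto
  qed
  then show ?case
  proof cases
    case 1
    then show ?thesis using Suc.prems(2) by simp
  next
    case (2 l')
    let ?c = "cmut n (g 0) c"
    have "path_stage n ?c (\<lambda>i. g (Suc i)) (\<lambda>i. \<beta> (Suc i)) m"
      unfolding path_stage_def
    proof (intro conjI allI impI)
      show "chain n (\<lambda>i. \<beta> (Suc i)) m" using ch by (rule chain_Suc)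
      show "inj_on (\<lambda>i. g (Suc i)) {..<m}" by (rule inj')
      fix i assume i: "i < m"
      show "g (Suc i) \<le> n" using g i by simp
      have "g (Suc i) \<noteq> g 0" using inj i by (auto simp: inj_on_def)
      moreover have "om n (c (g (Suc i))) (c (g 0)) \<le> 0" using chain_om[OF ch, of "Suc i" 0] i cg by simp
      ultimately show "?c (g (Suc i)) = \<beta> (Suc i)" using cg[of "Suc i"] i by (simp add: cmut_fixed)
    next
      fix r assume r: "r \<le> n" "r \<notin> (\<lambda>i. g (Suc i)) ` {..<m}"
      show "\<exists>p\<le>n. ?c r p < 0 \<and> (\<forall>i<m. \<beta> (Suc i) p = 0)"
      proof (cases "r = g 0")
        case True
        obtain p where p: "p \<le> n" "0 < \<beta> 0 p" "\<And>k. k < Suc m \<Longrightarrow> k \<noteq> 0 \<Longrightarrow> \<beta> k p = 0"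
          using ch unfolding chain_def by blast
        then show ?thesis using True cg by (auto simp: cmut_self intro!: exI[of _ p])
      next
        case False
        then obtain p where p: "p \<le> n" "c r p < 0" "\<forall>i<Suc m. \<beta> i p = 0"
          using red[OF r(1)] r(2) by (auto simp: image_Suc)
        then show ?thesis using False cg[of 0] by (auto simp: cmut_coord intro!: exI[of _ p])
      qed
    qed
    then have "l' \<in> lengths n ?c" using Suc.IH 2 by blast
    moreover have "nonneg n (c (g 0))" using ch cg by (simp add: chain_def nonneg_def)
    ultimately show ?thesis using lengths_step[of "g 0" n c l'] g 2 by simp
  next
    case (3 l')
    have "l' \<in> lengths n c'" if sw: "swept n c g \<beta> (Suc m) 0 c'" for c'
    proof -
      have "path_stage n c' (\<lambda>i. g (Suc i)) \<beta> m"
        unfolding path_stage_def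
      proof (intro conjI allI impI)
        show "chain n \<beta> m" using ch by (rule chain_mono) simp
        show "inj_on (\<lambda>i. g (Suc i)) {..<m}" by (rule inj')
        fix i assume i: "i < m"
        show "g (Suc i) \<le> n" using g i by simp
        show "c' (g (Suc i)) = \<beta> i" using sw i by (simp add: swept_def)
      next
        fix r assume r: "r \<le> n" "r \<notin> (\<lambda>i. g (Suc i)) ` {..<m}"
        show "\<exists>p\<le>n. c' r p < 0 \<and> (\<forall>i<m. \<beta> i p = 0)"
        proof (cases "r = g 0")
          case True
          \<comment> \<open>The sweep drops the last label from the path, so its private coordinate
            now shows that \<open>g 0\<close> is red.\<close>
          obtain p where "p \<le> n" "0 < tail_sum \<beta> (Suc m) 0 p" "\<And>i. i < m \<Longrightarrow> \<beta> i p = 0"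
            using chain_tail_sum_0_pos[OF ch] by auto
          moreover have "c' r = (\<lambda>p. - tail_sum \<beta> (Suc m) 0 p)" using sw True by (simp add: swept_def)
          ultimately show ?thesis by auto
        next
          case False
          then have rg: "r \<notin> g ` {..<Suc m}" using r(2) by (simp add: image_Suc)
          then obtain p where p: "p \<le> n" "c r p < 0" "\<forall>i<Suc m. \<beta> i p = 0" using red[OF r(1)] by auto
          then have "c' r p = c r p" using sw rg by (simp add: swept_def)
          then show ?thesis using p by (auto intro!: exI[of _ p])
        qed
      qed
      then show ?thesis using Suc.IH 3 by blast
    qed
    then have "Suc m + l' \<in> lengths n c"
      using lengths_sweep[OF ch inj g _ swept_initial[of "Suc m" c g \<beta> n]] cg by simp
    then show ?thesis using 3 by simp
  qed
qed

section \<open>Paths with a spent label\<close>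

text \<open>A green path whose first label \<open>e + f\<close> still contains the label \<open>e\<close> already spent at the red
  vertex \<open>\<sigma>\<close>.\<close>

definition spent_stage :: "nat \<Rightarrow> (nat \<Rightarrow> nat \<Rightarrow> int) \<Rightarrow> (nat \<Rightarrow> nat) \<Rightarrow> nat \<Rightarrow> (nat \<Rightarrow> nat \<Rightarrow> int)
    \<Rightarrow> (nat \<Rightarrow> int) \<Rightarrow> (nat \<Rightarrow> int) \<Rightarrow> nat \<Rightarrow> bool" where
  "spent_stage n c g \<sigma> \<beta> e f m \<longleftrightarrow>
     chain n \<beta> m \<and> chain n (\<beta>(0 := f)) m \<and> \<beta> 0 = (\<lambda>p. e p + f p) \<and> inj_on g {..<m} \<and>
     (\<forall>i<m. g i \<le> n \<and> c (g i) = \<beta> i) \<and> \<sigma> \<le> n \<and> \<sigma> \<notin> g ` {..<m} \<and> c \<sigma> = (\<lambda>p. - e p) \<and>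
     om n e f = -1 \<and> (\<forall>i\<in>{1..<m}. om n e (\<beta> i) = 0) \<and> nonneg n e \<and> nonneg n f \<and>
     (\<exists>p\<le>n. 0 < e p \<and> f p = 0 \<and> (\<forall>i\<in>{1..<m}. \<beta> i p = 0)) \<and>
     (\<forall>r\<le>n. r \<notin> insert \<sigma> (g ` {..<m}) \<longrightarrow> (\<exists>p\<le>n. c r p < 0 \<and> (\<forall>i<m. \<beta> i p = 0) \<and> e p = 0 \<and> f p = 0))"

text \<open>The red vertex \<open>\<sigma>\<close>, labelled \<open>- e\<close>, has exactly one
  arrow to \<open>g 0\<close>, so it absorbs \<open>e + f\<close> and becomes \<open>f\<close>: it
  replaces \<open>g 0\<close> as the source of an ordinary green path.\<close>

lemma spent_stage_first:
  assumes "spent_stage n c g \<sigma> \<beta> e f m" "0 < m"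
  shows "path_stage n (cmut n (g 0) c) (g(0 := \<sigma>)) (\<beta>(0 := f)) m"
  unfolding path_stage_def
proof (intro conjI allI impI)
  note a = assms(1)[unfolded spent_stage_def]
  show "chain n (\<beta>(0 := f)) m" using a by simp
  have inj: "inj_on g {..<m}" and sg: "\<sigma> \<notin> g ` {..<m}" using a by auto
  have c0: "c (g 0) = (\<lambda>p. e p + f p)" using a assms(2) by simp
  have s0: "\<sigma> \<noteq> g 0" using sg assms(2) by auto
  show "inj_on (g(0 := \<sigma>)) {..<m}" using inj sg by (auto simp: inj_on_def)
  fix i assume i: "i < m"
  show "(g(0 := \<sigma>)) i \<le> n" using a i by simp
  show "cmut n (g 0) c ((g(0 := \<sigma>)) i) = (\<beta>(0 := f)) i"
  proof (cases "i = 0")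
    case True
    have "om n (c \<sigma>) (c (g 0)) = 1" using a c0 by (simp add: om_linear)
    then show ?thesis using True s0 a c0 by (simp add: cmut_other)
  next
    case False
    then have "g i \<noteq> g 0" using inj_onD[OF inj, of i 0] i assms(2) by auto
    moreover have "om n (c (g i)) (c (g 0)) \<le> 0"
      using a chain_om[of n \<beta> m i 0] i assms(2) False by simp
    ultimately show ?thesis using False a i by (simp add: cmut_fixed)
  qed
next
  note a = assms(1)[unfolded spent_stage_def]
  have c0: "c (g 0) = (\<lambda>p. e p + f p)" using a assms(2) by simp
  fix r assume r: "r \<le> n" "r \<notin> (g(0 := \<sigma>)) ` {..<m}"
  have im: "i \<noteq> 0 \<Longrightarrow> i < m \<Longrightarrow> r \<noteq> g i" for i using r(2) by (metis fun_upd_other image_eqI lessThan_iff)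
  have rs: "r \<noteq> \<sigma>" using r(2) assms(2) by (metis fun_upd_same image_eqI lessThan_iff)
  show "\<exists>p\<le>n. cmut n (g 0) c r p < 0 \<and> (\<forall>i<m. (\<beta>(0 := f)) i p = 0)"
  proof (cases "r = g 0")
    case True
    obtain p where "p \<le> n" "0 < e p" "f p = 0" "\<forall>i\<in>{1..<m}. \<beta> i p = 0" using a by blast
    then show ?thesis using True c0 by (auto simp: cmut_self intro!: exI[of _ p])
  next
    case False
    then have "r \<notin> insert \<sigma> (g ` {..<m})" using im rs by (metis image_iff insert_iff lessThan_iff)
    then obtain p where "p \<le> n" "c r p < 0" "\<forall>i<m. \<beta> i p = 0" "e p = 0" "f p = 0" using a r(1) by blast
    then show ?thesis using False c0 by (auto simp: cmut_coord intro!: exI[of _ p])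
  qed
qed

text \<open>In the last step of the sweep \<open>\<sigma>\<close> absorbs the total
  \<open>e + \<mu>\<close> and becomes \<open>\<mu>\<close>; mutating it next turns
  \<open>g 0\<close> from \<open>- (e + \<mu>)\<close> into \<open>- e\<close>. The same
  configuration returns with one path vertex fewer and \<open>g 0\<close> in the place of
  \<open>\<sigma>\<close>, at the cost of one mutation more than the sweep.\<close>

lemma spent_stage_sweep:
  assumes st: "spent_stage n c g \<sigma> \<beta> e f (Suc (Suc m))" and sw: "swept n c g \<beta> (Suc (Suc m)) 0 c'"
  shows "nonneg n (c' \<sigma>)"
    and "spent_stage n (cmut n \<sigma> c') (\<lambda>i. g (Suc i)) (g 0) \<beta> e f (Suc m)"
proof -
  let ?m = "Suc (Suc m)"
  note a = st[unfolded spent_stage_def]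
  have ch: "chain n \<beta> ?m" and inj: "inj_on g {..<?m}" and sg: "\<sigma> \<notin> g ` {..<?m}"
    and b0: "\<beta> 0 = (\<lambda>p. e p + f p)" and ef: "om n e f = -1"
    and eb: "\<And>i. 1 \<le> i \<Longrightarrow> i < ?m \<Longrightarrow> om n e (\<beta> i) = 0"
    and nn: "nonneg n e" "nonneg n f" and cs: "c \<sigma> = (\<lambda>p. - e p)"
    using a by auto
  let ?S = "tail_sum \<beta> ?m"
  have S0: "?S 0 = (\<lambda>p. e p + f p + ?S 1 p)" using tail_sum_rec[of 0 ?m \<beta>] b0 by simp
  have eS: "om n e (?S i) = 0" if "1 \<le> i" for i
  proof -
    have "om n e (?S i) = (\<Sum>k\<in>{i..<?m}. om n e (\<beta> k))" unfolding tail_sum_def by (rule om_sum_right) simp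
    also have "\<dots> = 0" using eb that by (intro sum.neutral) auto
    finally show ?thesis .
  qed
  have eS0: "om n e (?S 0) = -1" using eS[of 1] ef by (simp add: S0 om_linear)
  define \<mu> where "\<mu> = (\<lambda>p. f p + ?S 1 p)"
  have S0': "?S 0 = (\<lambda>p. e p + \<mu> p)" by (simp add: S0 \<mu>_def add.assoc)
  have "c' \<sigma> = (\<lambda>p. c \<sigma> p + max 0 (om n (c \<sigma>) (?S 0)) * ?S 0 p)"
    using sw sg cs eS by (simp add: swept_def om_linear)
  then have csig: "c' \<sigma> = \<mu>" using cs eS0 by (simp add: om_linear S0')
  have "nonneg n \<mu>" using nn(2) chain_tail_sum_nonneg[OF ch, of 1] by (simp add: \<mu>_def nonneg_def)
  then show "nonneg n (c' \<sigma>)" using csig by simp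
  have em: "om n e \<mu> = -1" using eS0 by (simp add: S0' om_linear)
  have mu0: "\<mu> p = 0" if "\<forall>i<?m. \<beta> i p = 0" "f p = 0" for p
    using that tail_sum_zero[of ?m \<beta> p 1] by (simp add: \<mu>_def)
  have ng: "g i \<noteq> \<sigma>" if "i < ?m" for i using sg that by auto
  have ch': "chain n (\<beta>(0 := f)) (Suc m)" using a chain_mono[of n "\<beta>(0 := f)" ?m "Suc m"] by simp
  have zero_last: "e p = 0 \<and> f p = 0" if "\<beta> 0 p = 0" "p \<le> n" for p
    using that nn b0 by (auto simp: nonneg_def add_nonneg_eq_0_iff)
  have c0: "cmut n \<sigma> c' (g 0) = (\<lambda>p. - e p)"
  proof -
    have "c' (g 0) = (\<lambda>p. - ?S 0 p)" using sw by (simp add: swept_def)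
    moreover have "om n (\<lambda>p. - ?S 0 p) \<mu> = 1" using em by (simp add: S0' om_linear)
    ultimately show ?thesis using ng[of 0] csig by (simp add: cmut_other S0')
  qed
  have ci: "cmut n \<sigma> c' (g (Suc i)) = \<beta> i" if i: "i < Suc m" for i
  proof -
    have "c' (g (Suc i)) = \<beta> i" using sw i by (simp add: swept_def)
    moreover have "om n (\<beta> i) \<mu> = 0"
    proof -
      have 1: "om n (\<beta> i) (?S 0) = om n (\<beta> i) e + om n (\<beta> i) \<mu>" by (simp add: S0' om_linear)
      have 2: "om n (\<beta> i) (?S 0) = 1 - of_bool (0 < i)" using chain_om_tail_sum[OF ch, of i 0] i by simp
      have 3: "om n (\<beta> i) e = of_bool (i = 0)" 
        using eb[of i] ef i by (cases "i = 0") (auto simp: b0 om_linear om_swap[of n "\<beta> i" e] om_swap[of n f e])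
      show ?thesis using 1 2 3 by (cases "i = 0") auto
    qed
    ultimately show ?thesis using ng[of "Suc i"] i csig by (simp add: cmut_fixed)
  qed
  show "spent_stage n (cmut n \<sigma> c') (\<lambda>i. g (Suc i)) (g 0) \<beta> e f (Suc m)"
    unfolding spent_stage_def
  proof (intro conjI)
    show "chain n \<beta> (Suc m)" using ch by (rule chain_mono) simp
    show "chain n (\<beta>(0 := f)) (Suc m)" by (rule ch')
    show "\<beta> 0 = (\<lambda>p. e p + f p)" by (rule b0)
    show "inj_on (\<lambda>i. g (Suc i)) {..<Suc m}" using inj by (auto simp: inj_on_def)
    show "\<forall>i<Suc m. g (Suc i) \<le> n \<and> cmut n \<sigma> c' (g (Suc i)) = \<beta> i" using a ci by simp
    show "g 0 \<le> n" using a by simp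
    show "g 0 \<notin> (\<lambda>i. g (Suc i)) ` {..<Suc m}" using inj by (auto simp: inj_on_def)
    show "cmut n \<sigma> c' (g 0) = (\<lambda>p. - e p)" by (rule c0)
    show "om n e f = - 1" by (rule ef)
    show "\<forall>i\<in>{1..<Suc m}. om n e (\<beta> i) = 0" using eb by simp
    show "nonneg n e" "nonneg n f" by (rule nn)+
    obtain p where "p \<le> n" "0 < e p" "f p = 0" "\<forall>i\<in>{1..<?m}. \<beta> i p = 0" using a by blast
    then show "\<exists>p\<le>n. 0 < e p \<and> f p = 0 \<and> (\<forall>i\<in>{1..<Suc m}. \<beta> i p = 0)" by (auto intro!: exI[of _ p])
    show "\<forall>r\<le>n. r \<notin> insert (g 0) ((\<lambda>i. g (Suc i)) ` {..<Suc m}) \<longrightarrow>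
       (\<exists>p\<le>n. cmut n \<sigma> c' r p < 0 \<and> (\<forall>i<Suc m. \<beta> i p = 0) \<and> e p = 0 \<and> f p = 0)"
    proof (intro allI impI)
      fix r assume r: "r \<le> n" "r \<notin> insert (g 0) ((\<lambda>i. g (Suc i)) ` {..<Suc m})"
      then have rg: "r \<notin> g ` {..<?m}" unfolding image_Suc by simp
      show "\<exists>p\<le>n. cmut n \<sigma> c' r p < 0 \<and> (\<forall>i<Suc m. \<beta> i p = 0) \<and> e p = 0 \<and> f p = 0"
      proof (cases "r = \<sigma>")
        case True
        obtain p where p: "p \<le> n" "0 < ?S 0 p" "\<And>i. i < Suc m \<Longrightarrow> \<beta> i p = 0"
          using chain_tail_sum_0_pos[OF ch] by auto
        then have "e p = 0 \<and> f p = 0" using zero_last by simp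
        then show ?thesis using p True csig S0' by (auto simp: cmut_self intro!: exI[of _ p])
      next
        case False
        then obtain p where p: "p \<le> n" "c r p < 0" "\<forall>i<?m. \<beta> i p = 0" "e p = 0" "f p = 0"
          using a r(1) rg by blast
        have "c' r p = c r p" using sw rg p(3) by (simp add: swept_def)
        then have "cmut n \<sigma> c' r p < 0" using False p csig mu0 by (simp add: cmut_coord)
        then show ?thesis using p by (auto intro!: exI[of _ p])
      qed
    qed
  qed
qed

text \<open>Mutating \<open>g 0\<close> first leaves an ordinary path; a sweep followed by
  \<open>\<sigma>\<close> leaves a smaller configuration of the same kind. With \<open>p\<close>
  path vertices the second option costs \<open>p + 1\<close> steps, and
  \<open>p * (p + 3) div 2\<close> is the sum of \<open>2, ..., p + 1\<close>.\<close>

lemma lengths_spent: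
  "spent_stage n c g \<sigma> \<beta> e f (Suc m) \<Longrightarrow> Suc m + 1 \<le> l \<Longrightarrow> l \<le> Suc m * (Suc m + 3) div 2 \<Longrightarrow> l \<in> lengths n c"
proof (induction m arbitrary: c g \<sigma> l)
  case 0
  then have "1 \<in> lengths n (cmut n (g 0) c)" 
    using lengths_path[OF spent_stage_first[OF 0(1)], of 1] by simp
  moreover have "l = 2" using 0 by simp
  moreover have "nonneg n (c (g 0))" "g 0 \<le> n"
    using 0(1) by (auto simp: spent_stage_def nonneg_def)
  ultimately show ?case using lengths_step[of "g 0" n c 1] by (simp add: numeral_2_eq_2)
next
  case (Suc m)
  let ?m = "Suc (Suc m)"
  note a = Suc.prems(1)[unfolded spent_stage_def]
  define A where "A = ?m * (?m + 1) div 2"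
  define B where "B = Suc m * (Suc m + 3) div 2"
  have num: "?m * (?m + 3) div 2 = ?m + 1 + B" by (simp add: B_def algebra_simps)
  \<comment> \<open>No gap between the two options: the first ends at \<open>A + 1\<close>, the
    second begins at \<open>2 * ?m + 1\<close>.\<close>
  have num': "2 * ?m \<le> A + 1"
  proof -
    have "4 * ?m \<le> ?m * (?m + 1) + 2" by (simp add: algebra_simps)
    then show ?thesis unfolding A_def by linarith
  qed
  consider l' where "l = Suc l'" "?m \<le> l'" "l' \<le> A"
    | l' where "l = ?m + Suc l'" "Suc m + 1 \<le> l'" "l' \<le> B"
  proof (cases "l \<le> A + 1")
    case True
    then show ?thesis using that(1)[of "l - 1"] Suc.prems(2) by simp
  next
    case False
    then show ?thesis using that(2)[of "l - ?m - 1"] Suc.prems(3) num num' by simp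
  qed
  then show ?case
  proof cases
    case (1 l')
    then have "l' \<in> lengths n (cmut n (g 0) c)"
      using lengths_path[OF spent_stage_first[OF Suc.prems(1)]] unfolding A_def by simp
    moreover have "nonneg n (c (g 0))" "g 0 \<le> n" using a by (auto simp: nonneg_def)
    ultimately show ?thesis using lengths_step[of "g 0" n c l'] 1 by simp
  next
    case (2 l')
    have "Suc l' \<in> lengths n c'" if sw: "swept n c g \<beta> ?m 0 c'" for c'
    proof -
      note s = spent_stage_sweep[OF Suc.prems(1) sw]
      have "l' \<in> lengths n (cmut n \<sigma> c')" using Suc.IH[OF s(2)] 2 unfolding B_def by simp
      then show ?thesis using lengths_step[of \<sigma> n c' l', OF _ s(1)] a by simp
    qed
    moreover have "chain n \<beta> ?m" "inj_on g {..<?m}" using a by auto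
    moreover have "swept n c g \<beta> ?m ?m c" by (rule swept_initial) (use a in auto)
    ultimately have "?m + Suc l' \<in> lengths n c"
      using lengths_sweep[of n \<beta> ?m g c "Suc l'" ?m c] a by blast
    then show ?thesis using 2 by simp
  qed
qed

section \<open>Opening mutations on the initial quiver\<close>

lemma chain_unit_vec:
  assumes "n \<ge> 1" "a + m \<le> Suc n" "a = 0 \<longrightarrow> m \<le> n"
  shows "chain n (\<lambda>i. unit_vec (a + i)) m"
  unfolding chain_def
proof (intro conjI allI impI)
  fix i k assume "i < m" "k < m"
  \<comment> \<open>The condition for \<open>a = 0\<close> keeps \<open>0\<close> and
    \<open>n\<close> from both occurring, so the extra arrow does not enter.\<close>
  then show "om n (unit_vec (a + i)) (unit_vec (a + k)) = of_bool (k = Suc i) - of_bool (i = Suc k)"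
    using assms by (subst om_unit_vec) auto
next
  fix i assume "i < m"
  then show "\<exists>p\<le>n. 0 < (unit_vec (a + i) p :: int) \<and> (\<forall>k<m. k \<noteq> i \<longrightarrow> (unit_vec (a + k) p :: int) = 0)"
    using assms by (intro exI[of _ "a + i"]) auto
qed auto

text \<open>Vertex \<open>0\<close> is a source, so mutating it changes no other label and leaves
  the ordinary path \<open>1, ..., n\<close>.\<close>

lemma lengths_source_first:
  assumes "n \<ge> 1" "n \<le> l" "l \<le> n * (n + 1) div 2"
  shows "Suc l \<in> lengths n unit_vec"
proof -
  let ?c = "cmut n 0 unit_vec"
  have c: "?c i = unit_vec i" if "0 < i" "i \<le> n" for i
    using that assms(1) by (intro cmut_fixed) (auto simp: om_unit_vec)
  have "path_stage n ?c Suc (\<lambda>i. unit_vec (1 + i)) n"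
    unfolding path_stage_def
  proof (intro conjI allI impI)
    show "chain n (\<lambda>i. unit_vec (1 + i)) n" using assms(1) by (intro chain_unit_vec) auto
    fix i assume "i < n"
    then show "Suc i \<le> n" "?c (Suc i) = unit_vec (1 + i)" using c by auto
  next
    fix r assume "r \<le> n" "r \<notin> Suc ` {..<n}"
    then have "r = 0" by (cases r) auto
    then show "\<exists>p\<le>n. ?c r p < 0 \<and> (\<forall>i<n. unit_vec (1 + i) p = (0::int))"
      by (intro exI[of _ 0]) (simp add: cmut_self)
  qed simp
  then have "l \<in> lengths n ?c" using lengths_path assms by blast
  then show ?thesis by (intro lengths_step) (auto simp: nonneg_def)
qed

text \<open>Sweep the path \<open>0, ..., n - 1\<close>, then mutate \<open>n\<close>. Vertex
  \<open>n\<close> only receives arrows from the path, so after the sweep it still carries its unit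
  vector; the vertex now labelled by the unit vector of \<open>0\<close> absorbs it along the extra
  arrow. This is \<open>spent_stage\<close> with \<open>n - 1\<close> path vertices,
  \<open>e\<close> the unit vector of \<open>n\<close> and \<open>f\<close> that of
  \<open>0\<close>.\<close>

lemma lengths_sweep_first:
  assumes "n \<ge> 2" "n \<le> l" "l \<le> (n - 1) * (n + 2) div 2"
  shows "n + Suc l \<in> lengths n unit_vec"
proof -
  let ?S = "tail_sum unit_vec n"
  have n1: "n \<ge> 1" using assms(1) by simp
  have ch: "chain n unit_vec n" using chain_unit_vec[of n 0 n] n1 by simp
  have nS: "om n (unit_vec n) (?S i) \<le> 0" for i
  proof -
    have "om n (unit_vec n) (?S i) = (\<Sum>k\<in>{i..<n}. om n (unit_vec n) (unit_vec k))"
      unfolding tail_sum_def by (rule om_sum_right) simp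
    also have "\<dots> \<le> 0" using n1 by (intro sum_nonpos) (auto simp: om_unit_vec)
    finally show ?thesis .
  qed
  have "Suc l \<in> lengths n c'" if sw: "swept n unit_vec id unit_vec n 0 c'" for c'
  proof -
    let ?e = "unit_vec n :: nat \<Rightarrow> int" and ?f = "unit_vec 0 :: nat \<Rightarrow> int"
    let ?\<beta> = "\<lambda>i. if i = 0 then (\<lambda>p. ?e p + ?f p) else unit_vec i"
    let ?c = "cmut n n c'"
    have c0: "c' 0 = (\<lambda>p. - ?S 0 p)" and ci: "\<And>i. 0 < i \<Longrightarrow> i < n \<Longrightarrow> c' i = unit_vec (i - 1)"
      using sw assms(1) by (auto simp: swept_def)
    have cn: "c' n = unit_vec n"
    proof -
      have "c' n = (\<lambda>p. unit_vec n p + max 0 (om n (unit_vec n) (?S 0)) * ?S 0 p)"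
        using sw nS by (simp add: swept_def)
      then show ?thesis using nS[of 0] by (simp add: max_absorb1 fun_eq_iff)
    qed
    have "spent_stage n ?c Suc n ?\<beta> ?e ?f (n - 1)"
      unfolding spent_stage_def
    proof (intro conjI)
      have "?\<beta>(0 := ?f) = unit_vec" by auto
      then show "chain n (?\<beta>(0 := ?f)) (n - 1)" using ch chain_mono[of n unit_vec n "n - 1"] by simp
      show "chain n ?\<beta> (n - 1)"
        unfolding chain_def
      proof (intro conjI allI impI)
        fix i k assume ik: "i < n - 1" "k < n - 1"
        have "om n (?\<beta> i) (?\<beta> k) = om n (unit_vec i) (unit_vec k)"
          using ik n1 by (cases "i = 0"; cases "k = 0") (auto simp: om_linear om_unit_vec simp del: unit_vec_def)
        then show "om n (?\<beta> i) (?\<beta> k) = of_bool (k = Suc i) - of_bool (i = Suc k)"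
          using chain_om[OF ch, of i k] ik by simp
      next
        fix i assume "i < n - 1"
        then show "\<exists>p\<le>n. 0 < ?\<beta> i p \<and> (\<forall>k<n - 1. k \<noteq> i \<longrightarrow> ?\<beta> k p = 0)"
          by (intro exI[of _ i]) auto
      qed auto
      show "\<forall>i<n - 1. Suc i \<le> n \<and> ?c (Suc i) = ?\<beta> i"
      proof (intro allI impI conjI)
        fix i assume i: "i < n - 1"
        then show "Suc i \<le> n" by simp
        have "om n (c' (Suc i)) (c' n) = of_bool (i = 0)"
          using i ci[of "Suc i"] cn n1 by (auto simp: om_unit_vec)
        then show "?c (Suc i) = ?\<beta> i" using i ci[of "Suc i"] cn by (auto simp: cmut_other)
      qed
      show "?c n = (\<lambda>p. - ?e p)" using cn by (simp add: cmut_self)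
      show "om n ?e ?f = - 1" using assms(1) by (simp add: om_unit_vec)
      show "\<forall>i\<in>{1..<n - 1}. om n ?e (?\<beta> i) = 0" using n1 by (auto simp: om_unit_vec) linarith
      show "\<exists>p\<le>n. 0 < ?e p \<and> ?f p = 0 \<and> (\<forall>i\<in>{1..<n - 1}. ?\<beta> i p = 0)"
        using assms(1) by (intro exI[of _ n]) auto
      show "\<forall>r\<le>n. r \<notin> insert n (Suc ` {..<n - 1}) \<longrightarrow>
          (\<exists>p\<le>n. ?c r p < 0 \<and> (\<forall>i<n - 1. ?\<beta> i p = 0) \<and> ?e p = 0 \<and> ?f p = 0)"
      proof (intro allI impI)
        fix r assume r: "r \<le> n" "r \<notin> insert n (Suc ` {..<n - 1})"
        then have "r = 0" by (cases r) auto
        \<comment> \<open>\<open>n - 1\<close> is the private coordinate of the label dropped by the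
          sweep; it shows that vertex \<open>0\<close> is red.\<close>
        moreover have "?S 0 (n - 1) = 1"
        proof -
          have "?S 0 (n - 1) = (\<Sum>j\<in>{0..<n}. if j = n - 1 then 1 else 0)"
            unfolding tail_sum_def by (intro sum.cong) auto
          then show ?thesis using assms(1) by simp
        qed
        moreover have "?c 0 (n - 1) = c' 0 (n - 1)" using assms(1) cn by (intro cmut_coord) auto
        ultimately show "\<exists>p\<le>n. ?c r p < 0 \<and> (\<forall>i<n - 1. ?\<beta> i p = 0) \<and> ?e p = 0 \<and> ?f p = 0"
          using assms(1) c0 by (intro exI[of _ "n - 1"]) auto
      qed
    qed (use assms(1) in \<open>auto simp: nonneg_def\<close>)
    moreover have "n - 1 = Suc (n - 2)" using assms(1) by simp
    ultimately have st: "spent_stage n ?c Suc n ?\<beta> ?e ?f (Suc (n - 2))" by simp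
    have "Suc (n - 2) * (Suc (n - 2) + 3) = (n - 1) * (n + 2)" using assms(1) by (cases n) (auto simp: algebra_simps)
    then have "l \<in> lengths n ?c" using lengths_spent[OF st, of l] assms by simp
    then show ?thesis using cn by (intro lengths_step) (auto simp: nonneg_def)
  qed
  moreover have "swept n unit_vec id unit_vec n n unit_vec"
    by (rule swept_initial) (use n1 in auto)
  ultimately show ?thesis
    using lengths_sweep[OF ch, of id unit_vec "Suc l" n unit_vec] by simp
qed

lemma lengths_interval:
  assumes "n \<ge> 1" "n + 1 \<le> l" "l \<le> n * (n + 3) div 2"
  shows "l \<in> lengths n unit_vec"
proof (cases "l \<le> n * (n + 1) div 2 + 1")
  case True
  then show ?thesis using lengths_source_first[of n "l - 1"] assms by simp
next
  case False
  define A where "A = n * (n + 1) div 2"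
  have num: "n * (n + 3) div 2 = n + A" by (simp add: A_def algebra_simps)
  have l: "A + 1 < l" "l \<le> n + A" using False assms(3) num by (simp_all add: A_def)
  have n2: "n \<ge> 2"
  proof (rule ccontr)
    assume "\<not> n \<ge> 2"
    then have "n = 1" using assms(1) by simp
    then show False using l by simp
  qed
  then obtain m where n: "n = Suc (Suc m)" by (metis Suc_le_D numeral_2_eq_2 Suc_le_mono)
  have "4 * n \<le> n * (n + 1) + 2" by (simp add: n algebra_simps)
  \<comment> \<open>Taking the source first covers the lengths up to \<open>A + 1\<close>; sweeping
    first starts at \<open>2 * n + 1\<close>.\<close>
  then have "2 * n \<le> A + 1" unfolding A_def by linarith
  moreover have "(n - 1) * (n + 2) div 2 + 1 = A"
    by (simp add: n A_def algebra_simps)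
  ultimately have "n + Suc (l - n - 1) \<in> lengths n unit_vec"
    using l by (intro lengths_sweep_first[OF n2]) linarith+
  moreover have "n + Suc (l - n - 1) = l" using l \<open>2 * n \<le> A + 1\<close> by linarith
  ultimately show ?thesis by simp
qed

section \<open>Rotations in periodic search graphs\<close>

definition strictly_between :: "int \<Rightarrow> int \<Rightarrow> int \<Rightarrow> bool" where
  "strictly_between a z b \<longleftrightarrow> (a < z \<and> z < b) \<or> (b < z \<and> z < a)"

text \<open>Edges run from parent to child. An ordinary integer has at most one parent and at most
  one child on each side; a multiple of \<open>N\<close> has at most one child and at most one
  parent on each side. The last two assumptions are the search order, stated edge by edge: an edge
  may pass over an ordinary \<open>z\<close> only if \<open>z\<close> lies below its source, and
  over a multiple of \<open>N\<close> only if that lies above its target. The height excludes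
  directed cycles.\<close>

locale walled =
  fixes N :: int and E :: "int \<Rightarrow> int \<Rightarrow> bool" and H :: "int \<Rightarrow> int"
  assumes no_loop: "E a b \<Longrightarrow> \<not> N dvd b - a"
    and height: "E a b \<Longrightarrow> H b < H a"
    and parent_unique: "E a b \<Longrightarrow> E a' b \<Longrightarrow> \<not> N dvd b \<or> (a < b \<longleftrightarrow> a' < b) \<Longrightarrow> a = a'"
    and child_unique: "E a b \<Longrightarrow> E a b' \<Longrightarrow> N dvd a \<or> (a < b \<longleftrightarrow> a < b') \<Longrightarrow> b = b'"
    and wall_below: "E a b \<Longrightarrow> \<not> N dvd z \<Longrightarrow> strictly_between a z b \<Longrightarrow> E\<^sup>*\<^sup>* a z"
    and wall_above: "E a b \<Longrightarrow> N dvd z \<Longrightarrow> strictly_between a z b \<Longrightarrow> E\<^sup>*\<^sup>* z b"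
begin

lemma height_rtranclp: "E\<^sup>*\<^sup>* a b \<Longrightarrow> H b \<le> H a"
  by (induction rule: rtranclp_induct) (use height in force)+

lemma edge_neq: "E a b \<Longrightarrow> a \<noteq> b"
  using no_loop by force

text \<open>An edge crossing back over \<open>q\<close> would put \<open>q\<close> below its own
  source, but everything below \<open>q\<close> has smaller height than \<open>q\<close>.\<close>

lemma descendants_same_side:
  assumes "\<not> N dvd q" "E q r" "E\<^sup>*\<^sup>* r d"
  shows "d \<noteq> q \<and> (q < d \<longleftrightarrow> q < r)"
  using assms(3)
proof (induction rule: rtranclp_induct)
  case base
  then show ?case using edge_neq[OF assms(2)] by auto
next
  case (step c d)
  have Hc: "H c < H q"
    using height[OF assms(2)] height_rtranclp[OF step.hyps(1)] by linarith
  have "d \<noteq> q" using height[OF step.hyps(2)] Hc by auto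
  moreover have "\<not> strictly_between c q d"
    using wall_below[OF step.hyps(2) assms(1)] height_rtranclp Hc by force
  ultimately show ?case using step.IH by (auto simp: strictly_between_def)
qed

lemma ancestors_same_side:
  assumes "N dvd q" "E r q" "E\<^sup>*\<^sup>* a r"
  shows "a \<noteq> q \<and> (a < q \<longleftrightarrow> r < q)"
  using assms(3)
proof (induction rule: converse_rtranclp_induct)
  case base
  then show ?case using edge_neq[OF assms(2)] by auto
next
  case (step a c)
  have Hc: "H q < H c"
    using height[OF assms(2)] height_rtranclp[OF step.hyps(2)] by linarith
  have "a \<noteq> q" using height[OF step.hyps(1)] Hc by auto
  moreover have "\<not> strictly_between a q c"
    using wall_above[OF step.hyps(1) assms(1)] height_rtranclp Hc by force
  ultimately show ?case using step.IH by (auto simp: strictly_between_def)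
qed

end

locale rotation = walled +
  fixes x d :: int
  assumes rot_edge: "N dvd u - x \<Longrightarrow> E u (u + d)" and d_pos: "0 < d"
begin

definition X :: "int \<Rightarrow> bool" where "X u \<longleftrightarrow> N dvd u - x"

text \<open>As in a search tree, the edge from the parent of \<open>u\<close> is redirected to
  \<open>u + d\<close>, and the left child of \<open>u + d\<close> is handed to \<open>u\<close>.
  Multiples of \<open>N\<close> follow the reversed picture: only the right parent of
  \<open>u\<close> is redirected, and the single child of \<open>u + d\<close> is handed
  over.\<close>

definition Up :: "int \<Rightarrow> int \<Rightarrow> bool" where
  "Up a b \<longleftrightarrow> X b \<and> (N dvd b \<longrightarrow> b < a)"

definition Low :: "int \<Rightarrow> int \<Rightarrow> bool" where
  "Low a b \<longleftrightarrow> X (a - d) \<and> (\<not> N dvd a \<longrightarrow> b < a)"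

definition src' :: "int \<Rightarrow> int \<Rightarrow> int" where
  "src' a b = (if Low a b then a - d else a)"

definition tgt' :: "int \<Rightarrow> int \<Rightarrow> int" where
  "tgt' a b = (if Up a b then b + d else b)"

inductive E' :: "int \<Rightarrow> int \<Rightarrow> bool" where
  flipped: "X u \<Longrightarrow> E' (u + d) u"
| moved: "E a b \<Longrightarrow> \<not> (X a \<and> b = a + d) \<Longrightarrow> E' (src' a b) (tgt' a b)"

abbreviation "R \<equiv> E\<^sup>*\<^sup>*"
abbreviation "R' \<equiv> E'\<^sup>*\<^sup>*"

lemma X_edge: "X u \<Longrightarrow> E u (u + d)"
  by (simp add: X_def rot_edge)

lemma not_dvd_d: "\<not> N dvd d"
  using no_loop[OF X_edge[of x]] by (simp add: X_def)

lemma X_diff: "X u \<Longrightarrow> X v \<Longrightarrow> N dvd v - u"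
proof -
  assume "X u" "X v"
  then have "N dvd (v - x) - (u - x)" unfolding X_def by (rule dvd_diff[rotated])
  then show ?thesis by simp
qed

lemma X_not_Y': "X u \<Longrightarrow> \<not> X (u + d)"
  using X_diff[of "u" "u + d"] not_dvd_d by auto

lemma X_dvd: "X u \<Longrightarrow> X v \<Longrightarrow> N dvd u \<longleftrightarrow> N dvd v"
  using X_diff[of u v] by (metis diff_add_cancel dvd_add_right_iff)

lemma X_d_dvd: "X u \<Longrightarrow> X v \<Longrightarrow> N dvd u + d \<longleftrightarrow> N dvd v + d"
  using X_diff[of u v] by (metis add_diff_cancel_right diff_add_cancel dvd_add_right_iff)

lemma moved_R': 
  assumes "E a b" "\<not> (X a \<and> b = a + d)"
  shows "R' (src' a b) b" "R' a (tgt' a b)" "R' a b"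
proof -
  have 1: "E' (src' a b) (tgt' a b)" using assms by (rule moved)
  have 2: "R' a (src' a b)" using flipped[of "a - d"] by (auto simp: src'_def Low_def)
  have 3: "R' (tgt' a b) b" using flipped[of "b"] by (auto simp: tgt'_def Up_def)
  show "R' (src' a b) b" using 1 3 by auto
  show "R' a (tgt' a b)" using 1 2 by auto
  then show "R' a b" using 3 by auto
qed

lemma E'_R: "E' a b \<Longrightarrow> R a b \<or> (X b \<and> a = b + d)"
proof (induction rule: E'.induct)
  case (moved a b)
  have "R (src' a b) a" using X_edge[of "a - d"] by (auto simp: src'_def Low_def)
  moreover have "R b (tgt' a b)" using X_edge[of "b"] by (auto simp: tgt'_def Up_def)
  ultimately show ?case using moved(1) by (meson converse_rtranclp_into_rtranclp rtranclp_trans)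
qed auto

section \<open>Which connections a rotation destroys\<close>

text \<open>The pairs whose connecting path runs through the rotated edge and cannot be rerouted.\<close>

definition Lost :: "int \<Rightarrow> int \<Rightarrow> bool" where
  "Lost a c \<longleftrightarrow> (\<exists>u. X u \<and> R' a u
     \<and> (a = u \<or> (N dvd u \<and> (\<exists>p. E p u \<and> p < u \<and> R a p)))
     \<and> (c = u + d \<or> (\<not> N dvd u + d \<and> (\<exists>r. E (u + d) r \<and> u + d < r \<and> R r c))))"

lemma Lost_step: 
  assumes "Lost a c" "E c b" "\<not> (X c \<and> b = c + d)"
  shows "R' a (tgt' c b) \<or> Lost a b \<and> (X b \<longrightarrow> Lost a (b + d))"
proof -
  obtain u where u: "X u" "R' a u"
    "a = u \<or> (N dvd u \<and> (\<exists>p. E p u \<and> p < u \<and> R a p))"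
    "c = u + d \<or> (\<not> N dvd u + d \<and> (\<exists>r. E (u + d) r \<and> u + d < r \<and> R r c))"
    using assms(1) unfolding Lost_def by blast
  have L: "Lost a e" if "\<not> N dvd u + d" "E (u + d) r" "u + d < r" "R r e" for r e
    using u(1-3) that unfolding Lost_def by blast
  from u(4) show ?thesis
  proof
    assume c: "c = u + d"
    show ?thesis
    proof (cases "Low c b")
      case True
      then have "E' u (tgt' c b)" using moved[OF assms(2,3)] c by (simp add: src'_def)
      then show ?thesis using u(2) by (meson rtranclp.rtrancl_into_rtrancl)
    next
      case False
      then have "\<not> N dvd u + d" "u + d < b" using c u(1) edge_neq[OF assms(2)] by (auto simp: Low_def)
      then show ?thesis using L[of b b] L[of b "b + d"] assms(2) c X_edge[of b] by auto
    qed
  next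
    assume "\<not> N dvd u + d \<and> (\<exists>r. E (u + d) r \<and> u + d < r \<and> R r c)"
    then show ?thesis using L assms(2) X_edge[of b] by (meson rtranclp.rtrancl_into_rtrancl)
  qed
qed

text \<open>Induction along the old path. The second conjunct anticipates a next step over the
  rotated edge from \<open>c\<close> to \<open>c + d\<close>, which the new graph contains only in
  the opposite direction.\<close>

lemma persist: 
  assumes "R a c"
  shows "(R' a c \<or> Lost a c) \<and> (X c \<longrightarrow> R' a (c + d) \<or> Lost a (c + d))"
  using assms
proof (induction rule: rtranclp_induct)
  case base
  have "Lost a (a + d)" if "X a" using that unfolding Lost_def by blast
  then show ?case by auto
next
  case (step c b)
  show ?case
  proof (cases "X c \<and> b = c + d")
    case True
    then show ?thesis using step.IH X_not_Y' by auto
  next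
    case False
    have R'b: "R' (tgt' c b) b" using flipped[of "b"] by (auto simp: tgt'_def Up_def)
    have 1: "R' a (tgt' c b) \<or> Lost a b \<and> (X b \<longrightarrow> Lost a (b + d))"
      using step.IH Lost_step[OF _ step.hyps(2) False] moved_R'(2)[OF step.hyps(2) False]
      by (meson rtranclp_trans)
    have 2: "R' a b \<or> Lost a b" using 1 R'b by (meson rtranclp_trans)
    have "R' a (b + d) \<or> Lost a (b + d)" if "X b"
    proof (cases "Up c b")
      case True
      then show ?thesis using 1 that by (auto simp: tgt'_def)
    next
      case U: False
      then have "N dvd b" "c < b" using that edge_neq[OF step.hyps(2)] by (auto simp: Up_def)
      have "Lost a (b + d)" if "R' a b"
        unfolding Lost_def using \<open>X b\<close> that \<open>N dvd b\<close> \<open>c < b\<close> step.hyps by blast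
      then show ?thesis using 1 U that by (auto simp: tgt'_def)
    qed
    then show ?thesis using 2 by blast
  qed
qed

text \<open>The source of a lost pair is \<open>u\<close>, or lies above a left parent of
  \<open>u\<close> with \<open>u\<close> a multiple of \<open>N\<close>; the target is
  \<open>u + d\<close>, or lies below a right child of it. The same-side lemmas keep both on their
  side, so a lost connection goes right over a whole rotated edge. In particular, left-going paths
  are never lost.\<close>

lemma Lost_bounds: 
  assumes "Lost a c"
  obtains u where "X u" "a \<le> u" "u + d \<le> c"
    "a = u \<or> (N dvd u \<and> (\<exists>p. E p u \<and> p < u \<and> R a p))"
    "c = u + d \<or> (\<not> N dvd u + d \<and> (\<exists>r. E (u + d) r \<and> u + d < r \<and> R r c))"
proof -
  obtain u where u: "X u" 
    "a = u \<or> (N dvd u \<and> (\<exists>p. E p u \<and> p < u \<and> R a p))"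
    "c = u + d \<or> (\<not> N dvd u + d \<and> (\<exists>r. E (u + d) r \<and> u + d < r \<and> R r c))"
    using assms unfolding Lost_def by blast
  moreover have "a \<le> u" using u(2) ancestors_same_side[of u _ a] by force
  moreover have "u + d \<le> c" using u(3) descendants_same_side[of "u+d" _ c] by force
  ultimately show ?thesis using that by blast
qed

lemma R_left_persists: "R a b \<Longrightarrow> b < a \<Longrightarrow> R' a b"
  using persist[of a b] Lost_bounds[of a b] d_pos by (metis add_le_cancel_left leD order_trans zero_less_imp_eq_int less_imp_le add.right_neutral)

lemma below_rotated: 
  assumes "X u" "\<not> N dvd z" "u < z" "z < u + d"
  shows "R' u z"
proof -
  have "R u z" using wall_below[OF X_edge[OF assms(1)] assms(2)] assms by (simp add: strictly_between_def)
  then show ?thesis using persist[of u z] Lost_bounds[of u z] assms by (smt (verit))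
qed

lemma parent_of_rotated:
  assumes "X u" "E p (u + d)" "\<not> N dvd u + d \<or> p < u + d"
  shows "p = u"
  using parent_unique[OF assms(2) X_edge[OF assms(1)]] assms(3) d_pos by auto

lemma child_of_rotated:
  assumes "X u" "E u c" "N dvd u \<or> u < c"
  shows "c = u + d"
  using child_unique[OF assms(2) X_edge[OF assms(1)]] assms(3) d_pos by auto

lemma above_rotated: 
  assumes "X u" "N dvd z" "u < z" "z < u + d"
  shows "R' z u" "R' z (u + d)"
proof -
  have R: "R z (u + d)" using wall_above[OF X_edge[OF assms(1)] assms(2)] assms by (simp add: strictly_between_def)
  then obtain p where p: "R z p" "E p (u + d)" using assms by (metis rtranclp.cases less_irrefl)
  have "p = u"
    using parent_of_rotated[OF assms(1) p(2)] ancestors_same_side[OF _ p(2) p(1)] assms(4) by auto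
  then show "R' z u" using R_left_persists p assms by auto
  show "R' z (u + d)" using R persist[of z "u + d"] Lost_bounds[of z "u + d"] assms by (smt (verit))
qed

text \<open>The old search order provides the path. A loss would need a rotated edge from
  \<open>u\<close> to \<open>u + d\<close> between the new source and \<open>z\<close>; uniqueness
  of children and the same-side lemmas leave no room for one.\<close>

lemma no_loss_below:
  assumes e: "E a b" "\<not> (X a \<and> b = a + d)" and z: "\<not> N dvd z" "strictly_between a z b"
  shows "R' (src' a b) z"
proof -
  let ?a = "src' a b"
  have "R ?a a" using X_edge[of "a - d"] by (auto simp: src'_def Low_def)
  then have R: "R ?a z" using wall_below[OF e(1) z] by auto
  have "\<not> Lost ?a z"
  proof
    assume "Lost ?a z"
    then obtain u where u: "X u" "?a \<le> u" "u + d \<le> z"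
      "?a = u \<or> (N dvd u \<and> (\<exists>p. E p u \<and> p < u \<and> R ?a p))"
      "z = u + d \<or> (\<not> N dvd u + d \<and> (\<exists>r. E (u + d) r \<and> u + d < r \<and> R r z))"
      by (rule Lost_bounds)
    show False
    proof (cases "Low a b")
      case True
      then have a: "a = ?a + d" "X ?a" by (auto simp: src'_def Low_def)
      have "a \<le> z" using a u by linarith
      then have "a < z" "z < b" using z(2) by (auto simp: strictly_between_def)
      then have "N dvd a" using True by (auto simp: Low_def)
      then have "N dvd u + d" using X_d_dvd[OF a(2) u(1)] a(1) by simp
      then show False using u(5) z(1) by auto
    next
      case False
      then have a: "?a = a" by (simp add: src'_def)
      have "a < z" using u(2,3) a d_pos by linarith
      then have ab: "z < b" using z(2) by (auto simp: strictly_between_def)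
      show False
      proof (cases "a = u")
        case True
        then show False using child_of_rotated[OF u(1), of b] e u ab d_pos by auto
      next
        case False
        then obtain p where p: "N dvd u" "E p u" "p < u" "R a p" using u(4) a by auto
        have au: "a < u" using False u(2) a by simp
        have ub: "u < b" using u(3) ab d_pos by linarith
        show False
        proof (cases "a = p")
          case True
          then show False using child_unique[OF e(1), of u] p au ub by auto
        next
          case False
          then obtain c where c: "E a c" "R c p" using p(4) by (metis converse_rtranclpE)
          have "R c u" using c p by auto
          then have "N dvd a \<or> a < c" using descendants_same_side[OF _ c(1)] au by blast
          then have "c = b" using child_unique[OF c(1) e(1)] au ub by auto
          then show False using ancestors_same_side[OF p(1,2), of b] c(2) p(3) ub by auto
        qed
      qed
    qed
  qed
  then show ?thesis using persist[OF R] by blast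
qed

lemma no_loss_above:
  assumes e: "E a b" "\<not> (X a \<and> b = a + d)" and z: "N dvd z" "strictly_between a z b"
  shows "R' z (tgt' a b)"
proof -
  let ?b = "tgt' a b"
  have "R b ?b" using X_edge[of b] by (auto simp: tgt'_def Up_def)
  then have R: "R z ?b" using wall_above[OF e(1) z] by auto
  have "\<not> Lost z ?b"
  proof
    assume "Lost z ?b"
    then obtain u where u: "X u" "z \<le> u" "u + d \<le> ?b"
      "z = u \<or> (N dvd u \<and> (\<exists>p. E p u \<and> p < u \<and> R z p))"
      "?b = u + d \<or> (\<not> N dvd u + d \<and> (\<exists>r. E (u + d) r \<and> u + d < r \<and> R r ?b))"
      by (rule Lost_bounds)
    have parent: "u + d \<le> a" if r: "\<not> N dvd u + d" "E (u + d) r" "u + d < r" "R r b" and az: "\<not> N dvd b \<or> a < b" for r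
    proof -
      have ud: "R (u + d) b" using r by auto
      obtain p where p: "R (u + d) p" "E p b" "p = u + d \<or> R r p"
        using r(2,4) by (metis converse_rtranclp_into_rtranclp rtranclp.cases rtranclp.rtrancl_refl)
      have "u + d < b" using descendants_same_side[OF r(1,2,4)] r(3) by simp
      then have "p = a"
        using parent_unique[OF p(2) e(1)] ancestors_same_side[OF _ p(2) p(1)] az by auto
      then show ?thesis using p(3) descendants_same_side[OF r(1,2), of a] r(3) by force
    qed
    show False
    proof (cases "Up a b")
      case True
      then have b: "?b = b + d" "X b" by (auto simp: tgt'_def Up_def)
      have "z \<le> b" using b u by linarith
      then have ab: "a < z" "z < b" using z(2) by (auto simp: strictly_between_def)
      then have nb: "\<not> N dvd b" using True by (auto simp: Up_def)
      then have "\<not> N dvd u" using X_dvd[OF b(2) u(1)] by simp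
      then have "z = u" using u(4) by blast
      then have "N dvd b" using X_dvd[OF b(2) u(1)] z(1) by simp
      then show False using nb by simp
    next
      case False
      then have b: "?b = b" by (simp add: tgt'_def)
      have "z < b" using u b d_pos by linarith
      then have ab: "a < z" using z(2) by (auto simp: strictly_between_def)
      show False
      proof (cases "b = u + d")
        case True
        then show False using parent_of_rotated[OF u(1), of a] e u ab \<open>z < b\<close> by auto
      next
        case False
        then show False using u(5) b parent ab \<open>z < b\<close> u(2) d_pos by fastforce
      qed
    qed
  qed
  then show ?thesis using persist[OF R] by blast
qed

lemma wall_below': 
  assumes "E' a b" "\<not> N dvd z" "strictly_between a z b" 
  shows "R' a z"
  using assms(1)
proof (cases rule: E'.cases)
  case flipped
  then have "R' b z" using below_rotated[of b z] assms d_pos by (auto simp: strictly_between_def)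
  then show ?thesis using assms(1) by auto
next
  case (moved a0 b0)
  have bb0: "R' a b0" using moved_R'(1) moved by simp
  have a: "a = a0 \<or> Low a0 b0 \<and> X a \<and> a0 = a + d" using moved(1) by (auto simp: src'_def Low_def)
  have b: "b = b0 \<or> Up a0 b0 \<and> X b0 \<and> b = b0 + d" using moved(2) by (auto simp: tgt'_def Up_def)
  \<comment> \<open>A moved edge with ordinary old source \<open>a0\<close> goes left from it, so
    \<open>b0\<close> cannot lie to the right of \<open>z = a0\<close>.\<close>
  have low: "z \<noteq> a0" if "a < z" "z < b0"
    using that moved(1) assms(2) by (auto simp: src'_def Low_def split: if_splits)
  consider "strictly_between a0 z b0" | "a < z" "z < a0" | "z = b0" | "b0 < z" "z < b" | "z = a0" "a < a0" "z < b0"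
    using assms(3) a b d_pos unfolding strictly_between_def by (smt (verit))
  then show ?thesis
  proof cases
    case 1
    then show ?thesis using no_loss_below[OF moved(3,4) assms(2)] moved(1) by simp
  next
    case 2
    then show ?thesis using below_rotated[of a z] a assms(2) by auto
  next
    case 3
    then show ?thesis using bb0 by simp
  next
    case 4
    then have "R' b0 z" using below_rotated[of b0 z] b assms(2) by auto
    then show ?thesis using bb0 by auto
  next
    case 5
    then show ?thesis using low by auto
  qed
qed

lemma wall_above': 
  assumes "E' a b" "N dvd z" "strictly_between a z b" 
  shows "R' z b"
  using assms(1)
proof (cases rule: E'.cases)
  case flipped
  then show ?thesis using above_rotated(1)[of b z] assms d_pos by (auto simp: strictly_between_def)
next
  case (moved a0 b0)
  have bb0: "R' a0 b" using moved_R'(2) moved by simp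
  have a: "a = a0 \<or> Low a0 b0 \<and> X a \<and> a0 = a + d" using moved(1) by (auto simp: src'_def Low_def)
  have b: "b = b0 \<or> Up a0 b0 \<and> X b0 \<and> b = b0 + d" using moved(2) by (auto simp: tgt'_def Up_def)
  have up: "z \<noteq> b0" if "a0 < z" "z < b"
    using that moved(2) assms(2) by (auto simp: tgt'_def Up_def split: if_splits)
  consider "strictly_between a0 z b0" | "a < z" "z < a0" | "z = a0" | "b0 < z" "z < b" | "z = b0" "b0 < b" "a0 < z"
    using assms(3) a b d_pos unfolding strictly_between_def by (smt (verit))
  then show ?thesis
  proof cases
    case 1
    then show ?thesis using no_loss_above[OF moved(3,4) assms(2)] moved(2) by simp
  next
    case 2
    then have "R' z a" using above_rotated(1)[of a z] a assms(2) by auto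
    then show ?thesis using assms(1) by auto
  next
    case 3
    then show ?thesis using bb0 by simp
  next
    case 4
    then show ?thesis using above_rotated(2)[of b0 z] b assms(2) by auto
  next
    case 5
    then show ?thesis using up by auto
  qed
qed


lemma R'_right_R: 
  assumes w: "walled N E' H'" and ab: "R' a b" "a < b"
  shows "R a b"
proof -
  interpret w: walled N E' H' by (rule w)
  \<comment> \<open>Invariant along the path: either it is still an old connection, or it has come
    down a flipped edge to some \<open>u\<close> with \<open>u + d \<le> a\<close> and is at
    \<open>u\<close> or below a left child of \<open>u\<close>. In the second case it is to the left
    of \<open>a\<close>.\<close>
  have "R a b \<or> (\<exists>u. X u \<and> u + d \<le> a \<and> R a (u + d)
      \<and> (b = u \<or> (\<not> N dvd u \<and> (\<exists>l. E' u l \<and> l < u \<and> R' l b))))"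
    using ab(1)
  proof (induction rule: rtranclp_induct)
    case base
    then show ?case by simp
  next
    case (step c b)
    show ?case
    proof (cases "R a c")
      case Rac: True
      show ?thesis
      proof (cases "R c b")
        case True
        then show ?thesis using Rac by auto
      next
        case False
        then have c: "X b" "c = b + d" using E'_R[OF step.hyps(2)] by auto
        show ?thesis
        proof (cases "a = c")
          case True
          then show ?thesis using c by auto
        next
          case False
          then obtain p where p: "R a p" "E p c" using Rac by (metis rtranclp.cases)
          show ?thesis
          proof (cases "p = b")
            case True
            then show ?thesis using p by auto
          next
            case False
            then have "N dvd c" "\<not> p < c" using parent_of_rotated[OF c(1), of p] p(2) c(2) by auto
            then have "c < a" using ancestors_same_side[OF _ p(2,1)] by force
            then show ?thesis using c Rac by auto
          qed
        qed
      qed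
    next
      case False
      then obtain u where u: "X u" "u + d \<le> a" "R a (u + d)"
        "c = u \<or> (\<not> N dvd u \<and> (\<exists>l. E' u l \<and> l < u \<and> R' l c))" using step.IH by blast
      show ?thesis
      proof (cases "c = u")
        case True
        show ?thesis using step.hyps(2)
        proof (cases rule: E'.cases)
          case flipped
          then show ?thesis using True u(1) X_not_Y' by auto
        next
          case (moved a0 b0)
          show ?thesis
          proof (cases "Low a0 b0")
            case L: True
            then have "a0 = u + d" using moved(1) True by (simp add: src'_def)
            then have "R (u + d) b" using moved X_edge[of b0] by (auto simp: tgt'_def Up_def)
            then show ?thesis using u(3) by auto
          next
            case L: False
            then have a0: "a0 = u" using moved(1) True by (simp add: src'_def)
            then have "\<not> N dvd u" "\<not> u < b0" using child_of_rotated[OF u(1), of b0] moved(3,4) u(1) by auto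
            moreover have "\<not> Up a0 b0"
              using X_diff[OF u(1), of b0] no_loop[OF moved(3)] a0 by (auto simp: Up_def)
            ultimately have "b < u" "\<not> N dvd u" 
              using moved(2) edge_neq[OF moved(3)] a0 by (auto simp: tgt'_def)
            then show ?thesis using u(1-3) step.hyps(2) True by blast
          qed
        qed
      next
        case False
        then show ?thesis using u step.hyps(2) by (meson rtranclp.rtrancl_into_rtrancl)
      qed
    qed
  qed
  then show ?thesis
  proof
    assume "\<exists>u. X u \<and> u + d \<le> a \<and> R a (u + d)
      \<and> (b = u \<or> (\<not> N dvd u \<and> (\<exists>l. E' u l \<and> l < u \<and> R' l b)))"
    then obtain u where "u + d \<le> a" "b = u \<or> (\<not> N dvd u \<and> (\<exists>l. E' u l \<and> l < u \<and> R' l b))"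
      by blast
    then have "b < a" using w.descendants_same_side[of u _ b] d_pos by force
    then show ?thesis using ab(2) by simp
  qed
qed

text \<open>A loss needs a rotated edge inside \<open>[a, a + N]\<close> that starts at
  \<open>a\<close> or at some multiple of \<open>N\<close>; the only multiple in
  \<open>[a, a + N)\<close> is \<open>a\<close> itself.\<close>

lemma loss_between_rev:
  assumes "R a b" "\<not> R' a b" "N dvd a" "b = a + N" "0 < N"
  shows "X a" "d < N"
proof -
  have "Lost a b" using persist[OF assms(1)] assms(2) by blast
  then obtain u where u: "X u" "a \<le> u" "u + d \<le> b" "a = u \<or> N dvd u" by (rule Lost_bounds) blast
  then have "N dvd u - a" using assms(3) by auto
  moreover have "u - a < N" using u(3) assms(4) d_pos by linarith
  ultimately have "u = a" using u(2) assms(5) zdvd_not_zless[of "u - a" N] by force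
  then show "X a" using u(1) by simp
  show "d < N" using \<open>u = a\<close> u(3) assms(4) not_dvd_d by (cases "d = N") auto
qed

end

section \<open>Encoding the c-vectors by periodic graphs\<close>

lemma int_div_diff: 
  fixes q N :: int
  assumes "0 < N"
  shows "q div N - (q - 1) div N = of_bool (N dvd q)"
proof (cases "N dvd q")
  case True
  then obtain m where q: "q = N * m" by (rule dvdE)
  have "(N * m - 1) div N = m - 1"
    by (rule int_div_pos_eq[where r = "N - 1"]) (use assms in \<open>auto simp: algebra_simps\<close>)
  then show ?thesis using True q assms by simp
next
  case False
  have "(q - 1) div N = q div N"
  proof (rule int_div_pos_eq[where r = "q mod N - 1"])
    show "q - 1 = N * (q div N) + (q mod N - 1)" by simp
    have "q mod N \<noteq> 0" using False by (simp add: dvd_eq_mod_eq_0)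
    then show "0 \<le> q mod N - 1" using pos_mod_sign[OF assms, of q] by linarith
    show "q mod N - 1 < N" using pos_mod_bound[OF assms, of q] by linarith
  qed
  then show ?thesis using False by simp
qed

text \<open>Summing this over the cyclically ordered slots of all nodes yields the exchange matrix.\<close>

definition cyc3 :: "('a \<Rightarrow> bool) \<Rightarrow> ('a \<Rightarrow> bool) \<Rightarrow> ('a \<Rightarrow> bool) \<Rightarrow> 'a \<Rightarrow> 'a \<Rightarrow> int" where
  "cyc3 A B C i j =
     of_bool (A i) * of_bool (B j) - of_bool (B i) * of_bool (A j) +
     of_bool (B i) * of_bool (C j) - of_bool (C i) * of_bool (B j) +
     of_bool (C i) * of_bool (A j) - of_bool (A i) * of_bool (C j)"

lemma cyc3_rotate: "cyc3 B C A = cyc3 A B C"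
  by (intro ext) (simp add: cyc3_def)

lemma sum_diff_two:
  fixes f g :: "'a \<Rightarrow> int"
  assumes "finite A" "a \<in> A" "b \<in> A" "a \<noteq> b" "\<And>z. z \<in> A \<Longrightarrow> z \<noteq> a \<Longrightarrow> z \<noteq> b \<Longrightarrow> f z = g z"
  shows "sum f A = sum g A + (f a - g a) + (f b - g b)"
proof -
  have A: "A = insert a (insert b (A - {a, b}))" using assms by auto
  have "sum f (A - {a, b}) = sum g (A - {a, b})" using assms(5) by (intro sum.cong) auto
  moreover have "sum h A = h a + h b + sum h (A - {a, b})" for h :: "'a \<Rightarrow> int"
    by (subst A) (use assms in \<open>simp add: sum.insert_remove\<close>)
  ultimately show ?thesis by simp
qed

locale annulus =
  fixes n :: nat and N :: int
  assumes n_pos: "1 \<le> n" and N_eq: "N = int n + 1"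
begin

lemma N_pos: "0 < N" by (simp add: N_eq)

text \<open>\<open>steps j q\<close> counts the integers congruent to \<open>j\<close> below \<open>q\<close>, up to an additive constant.\<close>

definition steps :: "nat \<Rightarrow> int \<Rightarrow> int" where
  "steps j q = (q - 1 - int j) div N"

text \<open>This counts the integers congruent to \<open>j\<close> in \<open>[a, b)\<close>,
  negatively when \<open>b < a\<close>.\<close>

definition cvec :: "int \<Rightarrow> int \<Rightarrow> nat \<Rightarrow> int" where
  "cvec a b j = steps j b - steps j a"

lemma steps_shift: "steps j (q + m * N) = steps j q + m"
proof -
  have "steps j (q + m * N) = ((q - 1 - int j) + m * N) div N" by (simp add: steps_def algebra_simps)
  then show ?thesis using N_pos by (simp add: steps_def)
qed

lemma steps_mono: "q \<le> q' \<Longrightarrow> steps j q \<le> steps j q'"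
  using N_pos by (simp add: steps_def zdiv_mono1)

lemma steps_Suc: "steps j (q + 1) - steps j q = of_bool (N dvd q - int j)"
  using int_div_diff[OF N_pos, of "q - int j"] by (simp add: steps_def algebra_simps)

lemma nonneg_cvec_iff: "nonneg n (cvec a b) \<longleftrightarrow> a \<le> b"
proof
  assume "a \<le> b"
  then show "nonneg n (cvec a b)" using steps_mono by (simp add: nonneg_def cvec_def)
next
  assume nn: "nonneg n (cvec a b)"
  show "a \<le> b"
  proof (rule ccontr)
    assume "\<not> a \<le> b"
    then have 1: "steps j (b + 1) \<le> steps j a" for j by (intro steps_mono) simp
    define j where "j = nat (b mod N)"
    have j: "int j = b mod N" using pos_mod_sign[OF N_pos, of b] by (simp add: j_def)
    then have "j \<le> n" using pos_mod_bound[OF N_pos, of b] by (simp add: N_eq)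
    moreover have "steps j (b + 1) - steps j b = 1" using j by (simp add: steps_Suc)
    ultimately show False using nn 1[of j] by (force simp: nonneg_def cvec_def)
  qed
qed

text \<open>The integers congruent to \<open>n\<close> are those just before the multiples of
  \<open>N\<close>, so counting the two classes over the same interval differs only at its
  ends.\<close>

lemma cvec_defect: "cvec a b n - cvec a b 0 = of_bool (N dvd b) - of_bool (N dvd a)"
proof -
  have "steps n q - steps 0 q = of_bool (N dvd q) - 1" for q
  proof -
    have "q - 1 - int n = q + (-1) * N" by (simp add: N_eq)
    then have "steps n q = (q + (-1) * N) div N" by (simp only: steps_def)
    also have "\<dots> = q div N - 1" using N_pos by (subst div_mult_self1) auto
    finally show ?thesis using int_div_diff[OF N_pos, of q] by (simp add: steps_def)
  qed
  from this[of a] this[of b] show ?thesis by (simp add: cvec_def)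
qed

text \<open>The sum over the linear path telescopes, and the extra arrow contributes the same amount
  once more; in a cyclically oriented quiver the two would cancel. With \<open>cvec_defect\<close>,
  constant vectors detect edges that end at a multiple of \<open>N\<close>.\<close>

lemma om_const: "om n (\<lambda>_. a) v = 2 * a * (v n - v 0)"
proof -
  have "(\<Sum>k<n. a * v (Suc k) - v k * a) = a * (\<Sum>k<n. v (Suc k) - v k)"
    by (simp add: sum_distrib_left algebra_simps)
  then show ?thesis by (simp add: om_def sum_lessThan_telescope algebra_simps)
qed

text \<open>The edge \<open>i\<close> leads from \<open>s i\<close> to \<open>t i\<close>; all its translates by \<open>N\<close> are edges as well.\<close>

definition edge :: "(nat \<Rightarrow> int) \<Rightarrow> (nat \<Rightarrow> int) \<Rightarrow> int \<Rightarrow> int \<Rightarrow> bool" where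
  "edge s t a b \<longleftrightarrow> (\<exists>i\<le>n. \<exists>m. a = s i + m * N \<and> b = t i + m * N)"

text \<open>Slots 0, 1, 2 of a node are its parent, right child and left child; at multiples of \<open>N\<close> they are
  its child, left parent and right parent.  This cyclic order is the direction of the arrows between
  the edges meeting at the node.\<close>

definition slot :: "(nat \<Rightarrow> int) \<Rightarrow> (nat \<Rightarrow> int) \<Rightarrow> int \<Rightarrow> nat \<Rightarrow> nat \<Rightarrow> bool" where
  "slot s t z p i \<longleftrightarrow> (if N dvd z
     then p = 0 \<and> N dvd s i - z \<or> p = 1 \<and> N dvd t i - z \<and> s i < t i \<or> p = 2 \<and> N dvd t i - z \<and> t i < s i
     else p = 0 \<and> N dvd t i - z \<or> p = 1 \<and> N dvd s i - z \<and> s i < t i \<or> p = 2 \<and> N dvd s i - z \<and> t i < s i)"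

abbreviation wedge :: "(nat \<Rightarrow> int) \<Rightarrow> (nat \<Rightarrow> int) \<Rightarrow> int \<Rightarrow> nat \<Rightarrow> nat \<Rightarrow> int" where
  "wedge s t z \<equiv> cyc3 (slot s t z 0) (slot s t z 1) (slot s t z 2)"

text \<open>The invariant preserved by rotations. Potentials are required for all edge weights
  \<open>w\<close>, although a height needs only \<open>w = 1\<close>, because a rotation changes
  the sign of one weight. The Gram matrix is required to be a sum of local contributions at the
  nodes. The last clause supplies the edge that \<open>excl\<close> pairs with a constant
  vector.\<close>

definition admissible :: "(nat \<Rightarrow> int) \<Rightarrow> (nat \<Rightarrow> int) \<Rightarrow> bool" where
  "admissible s t \<longleftrightarrow>
     (\<forall>i\<le>n. \<not> N dvd t i - s i) \<and>
     (\<forall>z p i j. i \<le> n \<longrightarrow> j \<le> n \<longrightarrow> slot s t z p i \<longrightarrow> slot s t z p j \<longrightarrow> i = j) \<and>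
     (\<forall>a b z. edge s t a b \<longrightarrow> strictly_between a z b \<longrightarrow>
        (if N dvd z then (edge s t)\<^sup>*\<^sup>* z b else (edge s t)\<^sup>*\<^sup>* a z)) \<and>
     (\<forall>w :: nat \<Rightarrow> int. \<exists>H. \<forall>i\<le>n. \<forall>m. H (s i + m * N) - H (t i + m * N) = w i) \<and>
     (\<forall>i\<le>n. \<forall>j\<le>n. om n (cvec (s i) (t i)) (cvec (s j) (t j)) = (\<Sum>z\<in>{0..<N}. wedge s t z i j)) \<and>
     (\<exists>i\<le>n. N dvd s i \<or> N dvd t i)"

lemma admissible_noloop: "admissible s t \<Longrightarrow> i \<le> n \<Longrightarrow> \<not> N dvd t i - s i"
  and admissible_slot: "admissible s t \<Longrightarrow> i \<le> n \<Longrightarrow> j \<le> n \<Longrightarrow> slot s t z p i \<Longrightarrow> slot s t z p j \<Longrightarrow> i = j"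
  and admissible_om: "admissible s t \<Longrightarrow> i \<le> n \<Longrightarrow> j \<le> n \<Longrightarrow>
     om n (cvec (s i) (t i)) (cvec (s j) (t j)) = (\<Sum>z\<in>{0..<N}. wedge s t z i j)"
  unfolding admissible_def by blast+

lemma admissible_height: "admissible s t \<Longrightarrow> \<exists>H. \<forall>i\<le>n. \<forall>m. H (s i + m * N) - H (t i + m * N) = w i" for w :: "nat \<Rightarrow> int"
  unfolding admissible_def by blast

lemma dvd_shift_iff: "N dvd a - (b + m * N) \<longleftrightarrow> N dvd a - b"
proof -
  have "a - (b + m * N) = (a - b) + (- m) * N" by simp
  then show ?thesis by (simp only: dvd_add_times_triv_right_iff)
qed

lemma admissible_walled:
  assumes "admissible s t"
  obtains H where "walled N (edge s t) H"
proof -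
  obtain H where H: "\<forall>i\<le>n. \<forall>m. H (s i + m * N) - H (t i + m * N) = (1::int)"
    using admissible_height[OF assms, of "\<lambda>_. 1"] by blast
  have noloop: "\<not> N dvd b - a" if e: "edge s t a b" for a b
  proof -
    obtain i m where "i \<le> n" "a = s i + m * N" "b = t i + m * N" using e by (auto simp: edge_def)
    then show ?thesis using admissible_noloop[OF assms, of i] by simp
  qed
  have "walled N (edge s t) H"
  proof
    fix a b assume e: "edge s t a b"
    show "\<not> N dvd b - a" by (rule noloop[OF e])
    obtain i m where "i \<le> n" "a = s i + m * N" "b = t i + m * N" using e by (auto simp: edge_def)
    moreover from this have "H (s i + m * N) - H (t i + m * N) = 1" using H by blast
    ultimately show "H b < H a" by simp
  next
    fix a a' b assume e: "edge s t a b" "edge s t a' b" and side: "\<not> N dvd b \<or> (a < b \<longleftrightarrow> a' < b)"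
    obtain i m where i: "i \<le> n" "a = s i + m * N" "b = t i + m * N" using e(1) by (auto simp: edge_def)
    obtain j m' where j: "j \<le> n" "a' = s j + m' * N" "b = t j + m' * N" using e(2) by (auto simp: edge_def)
    have ne: "a \<noteq> b" "a' \<noteq> b" using noloop e by force+
    let ?p = "if N dvd b then if a < b then 1 else 2 else 0 :: nat"
    have "slot s t b ?p i" using i ne(1) by (auto simp: slot_def)
    moreover have "slot s t b ?p j" using j ne side by (auto simp: slot_def)
    ultimately have "i = j" using admissible_slot[OF assms i(1) j(1)] by blast
    then show "a = a'" using i j N_pos by simp
  next
    fix a b b' assume e: "edge s t a b" "edge s t a b'" and side: "N dvd a \<or> (a < b \<longleftrightarrow> a < b')"
    obtain i m where i: "i \<le> n" "a = s i + m * N" "b = t i + m * N" using e(1) by (auto simp: edge_def)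
    obtain j m' where j: "j \<le> n" "a = s j + m' * N" "b' = t j + m' * N" using e(2) by (auto simp: edge_def)
    have ne: "a \<noteq> b" "a \<noteq> b'" using noloop e by force+
    let ?p = "if N dvd a then 0 else if a < b then 1 else 2 :: nat"
    have "slot s t a ?p i" using i ne(1) by (auto simp: slot_def)
    moreover have "slot s t a ?p j" using j ne side by (auto simp: slot_def)
    ultimately have "i = j" using admissible_slot[OF assms i(1) j(1)] by blast
    then show "b = b'" using i j N_pos by simp
  qed (use assms in \<open>auto simp: admissible_def\<close>)
  then show ?thesis by (rule that)
qed

end

section \<open>One green mutation as a rotation\<close>

locale annulus_flip = annulus +
  fixes s t :: "nat \<Rightarrow> int" and k :: nat
  assumes admissible: "admissible s t" and k: "k \<le> n" and pos: "s k < t k"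
begin

text \<open>The edges at the two ends of the rotated edge: \<open>up\<close> is carried from its source to its target and
  \<open>low\<close> from its target to its source, while \<open>lft\<close> and \<open>rgt\<close> remain in place.\<close>

definition up :: "nat \<Rightarrow> bool" where
  "up i \<longleftrightarrow> N dvd t i - s k \<and> (N dvd s k \<longrightarrow> t i < s i)"

definition low :: "nat \<Rightarrow> bool" where
  "low i \<longleftrightarrow> N dvd s i - t k \<and> (\<not> N dvd t k \<longrightarrow> t i < s i)"

definition lft :: "nat \<Rightarrow> bool" where
  "lft i \<longleftrightarrow> (if N dvd s k then N dvd t i - s k \<and> s i < t i else N dvd s i - s k \<and> t i < s i)"

definition rgt :: "nat \<Rightarrow> bool" where
  "rgt i \<longleftrightarrow> (if N dvd t k then N dvd t i - t k \<and> t i < s i else N dvd s i - t k \<and> s i < t i)"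

definition s' :: "nat \<Rightarrow> int" where
  "s' i = (if i = k then t k else if low i then s i - (t k - s k) else s i)"

definition t' :: "nat \<Rightarrow> int" where
  "t' i = (if i = k then s k else if up i then t i + (t k - s k) else t i)"

lemma not_dvd_k: "\<not> N dvd t k - s k"
  by (rule admissible_noloop[OF admissible k])

lemma dvd_sym_diff: "N dvd a - b \<longleftrightarrow> N dvd b - a"
  by (simp add: dvd_diff_commute)

lemma dvd_trans_diff: "N dvd a - b \<Longrightarrow> N dvd c - b \<Longrightarrow> N dvd a - c"
  using dvd_diff[of N "a - b" "c - b"] by simp

lemma dvd_cong: "N dvd a - b \<Longrightarrow> N dvd a \<longleftrightarrow> N dvd b"
  by (metis diff_add_cancel dvd_add_right_iff)

lemma dvd_cong_diff: "N dvd a - b \<Longrightarrow> N dvd c - a \<longleftrightarrow> N dvd c - b"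
  by (metis add_diff_eq diff_add_cancel dvd_add_left_iff)

lemma rotation_exists: obtains H where "rotation N (edge s t) H (s k) (t k - s k)"
proof -
  obtain H where "walled N (edge s t) H" by (rule admissible_walled[OF admissible])
  then interpret walled N "edge s t" H .
  have "rotation N (edge s t) H (s k) (t k - s k)"
  proof
    fix u assume "N dvd u - s k"
    then obtain m where "u - s k = N * m" by (rule dvdE)
    then have "u = s k + m * N" "u + (t k - s k) = t k + m * N" by (simp_all add: algebra_simps)
    then show "edge s t u (u + (t k - s k))" using k unfolding edge_def by blast
  qed (use pos in simp)
  then show ?thesis by (rule that)
qed

text \<open>Edges \<open>i\<close> and \<open>k\<close> would close up modulo \<open>N\<close> to a
  cycle with positive winding, so their c-vectors would add up to a positive constant. Such a
  constant pairs non-trivially with an edge \<open>j\<close> at a multiple of \<open>N\<close>. But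
  at each common node \<open>i\<close> and \<open>k\<close> sit in slots \<open>0\<close> and
  \<open>1\<close>, so their wedges with \<open>j\<close> cancel.\<close>

lemma excl:
  assumes i: "i \<le> n" and c: "N dvd t i - s k" "N dvd s i - t k" and lt: "s i < t i"
    and nk: "\<not> N dvd s k" "\<not> N dvd t k"
  shows False
proof -
  obtain m where m: "t i = s k + m * N" using c(1) by (metis diff_add_cancel dvdE mult.commute add.commute)
  obtain m' where m': "s i = t k + m' * N" using c(2) by (metis diff_add_cancel dvdE mult.commute add.commute)
  have "0 < (m - m') * N" using m m' lt pos by (simp add: algebra_simps)
  then have M: "0 < m - m'" using N_pos zero_less_mult_pos2 by blast
  have ci: "cvec (s i) (t i) j + cvec (s k) (t k) j = m - m'" for j
    by (simp add: cvec_def m m' steps_shift)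
  have ik: "i \<noteq> k" using c(1) not_dvd_k by auto
  obtain j where j: "j \<le> n" "N dvd s j \<or> N dvd t j" using admissible unfolding admissible_def by blast
  have ti: "\<not> N dvd t i" "\<not> N dvd s i" using dvd_cong[OF c(1)] dvd_cong[OF c(2)] nk by auto
  have jik: "j \<noteq> i" "j \<noteq> k" using j ti nk by auto
  have "om n (cvec (s i) (t i)) (cvec (s j) (t j)) + om n (cvec (s k) (t k)) (cvec (s j) (t j)) 
      = om n (\<lambda>_. m - m') (cvec (s j) (t j))"
    using om_add_left[of n "cvec (s i) (t i)" "cvec (s k) (t k)" "cvec (s j) (t j)"] by (simp add: ci)
  also have "\<dots> = 2 * (m - m') * (of_bool (N dvd t j) - of_bool (N dvd s j))"
    by (simp only: om_const cvec_defect)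
  also have "\<dots> \<noteq> 0" using j M admissible_noloop[OF admissible j(1)] by (auto simp: dvd_diff)
  finally have "(\<Sum>z\<in>{0..<N}. wedge s t z i j + wedge s t z k j) \<noteq> 0"
    using admissible_om[OF admissible] i j(1) k by (simp add: sum.distrib)
  moreover have "wedge s t z i j + wedge s t z k j = 0" for z
  proof -
    have u: "\<not> slot s t z p j" if "slot s t z p i \<or> slot s t z p k" for p
      using admissible_slot[OF admissible _ j(1)] i k jik that by blast
    consider "N dvd s k - z" | "N dvd t k - z" "\<not> N dvd s k - z" | "\<not> N dvd s k - z" "\<not> N dvd t k - z" by blast
    then show ?thesis
    proof cases
      case 1
      have "\<not> N dvd z" using dvd_cong[OF 1] nk(1) by simp
      moreover have "N dvd t i - z" using dvd_cong_diff[OF 1, of "t i"] c(1) by simp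
      moreover have "\<not> N dvd t k - z" using dvd_cong_diff[OF 1, of "t k"] not_dvd_k by simp
      moreover have "\<not> N dvd s i - z"
        using dvd_cong_diff[OF c(2), of z] \<open>\<not> N dvd t k - z\<close> by (simp add: dvd_sym_diff[of z])
      ultimately have "slot s t z 0 i" "\<not> slot s t z 1 i" "\<not> slot s t z 2 i"
        "\<not> slot s t z 0 k" "slot s t z 1 k" "\<not> slot s t z 2 k"
        using 1 pos by (auto simp: slot_def)
      then show ?thesis using u[of 0] u[of 1] by (simp add: cyc3_def)
    next
      case 2
      have "\<not> N dvd z" using dvd_cong[OF 2(1)] nk(2) by simp
      moreover have "N dvd s i - z" using dvd_cong_diff[OF 2(1), of "s i"] c(2) by simp
      moreover have "\<not> N dvd t i - z"
        using dvd_cong_diff[OF c(1), of z] 2(2) by (simp add: dvd_sym_diff[of z])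
      ultimately have "slot s t z 1 i" "\<not> slot s t z 0 i" "\<not> slot s t z 2 i"
        "\<not> slot s t z 1 k" "slot s t z 0 k" "\<not> slot s t z 2 k"
        using 2 lt by (auto simp: slot_def)
      then show ?thesis using u[of 0] u[of 1] by (simp add: cyc3_def)
    next
      case 3
      have "\<not> N dvd t i - z" "\<not> N dvd s i - z"
        using dvd_cong_diff[OF c(1), of z] dvd_cong_diff[OF c(2), of z] 3
        by (simp_all add: dvd_sym_diff[of z])
      then have "\<not> slot s t z p i" "\<not> slot s t z p k" for p
        using 3 by (auto simp: slot_def)
      then show ?thesis by (simp add: cyc3_def)
    qed
  qed
  ultimately show False by simp
qed


text \<open>Each new edge is compared with the rotated edge at its moved end. A source moved to an
  ordinary node has the target below its right child, hence to the right; a target moved to a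
  multiple of \<open>N\<close> has the source above its left parent, hence to the left. In the last
  two cases only the far end moves, and it stays on its side of the fixed one.\<close>

lemma signs:
  assumes i: "i \<le> n" "i \<noteq> k"
  shows "low i \<Longrightarrow> \<not> N dvd s k \<Longrightarrow> s' i < t' i"
    and "up i \<Longrightarrow> N dvd t k \<Longrightarrow> s' i < t' i"
    and "low i \<Longrightarrow> \<not> up i \<Longrightarrow> N dvd t i \<Longrightarrow> s' i < t' i \<longleftrightarrow> s i < t i"
    and "up i \<Longrightarrow> \<not> low i \<Longrightarrow> \<not> N dvd s i \<Longrightarrow> s' i < t' i \<longleftrightarrow> s i < t i"
proof -
  obtain H where "rotation N (edge s t) H (s k) (t k - s k)" by (rule rotation_exists)
  then interpret rotation N "edge s t" H "s k" "t k - s k" .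
  let ?d = "t k - s k"
  have e: "edge s t (s i) (t i)" using i unfolding edge_def by (intro exI[of _ i] conjI exI[of _ 0]) auto
  have rot: "edge s t u (u + ?d)" if "N dvd u - s k" for u using rot_edge that .
  have l: "edge s t (s' i) (s i) \<and> N dvd s' i - s k" if "low i"
    using rot[of "s i - ?d"] that i by (simp add: s'_def low_def)
  have u: "edge s t (t i) (t' i) \<and> N dvd t' i - t k" if "up i"
    using rot[of "t i"] that i by (simp add: t'_def up_def)
  have s's: "(edge s t)\<^sup>*\<^sup>* (s' i) (s i)" using l i by (cases "low i") (auto simp: s'_def)
  have tt': "(edge s t)\<^sup>*\<^sup>* (t i) (t' i)" using u i by (cases "up i") (auto simp: t'_def)
  show "s' i < t' i" if "low i" "\<not> N dvd s k"
  proof -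
    have "\<not> N dvd s' i" using dvd_cong l that by blast
    moreover have "s' i < s i" using that i pos by (simp add: s'_def)
    moreover have "(edge s t)\<^sup>*\<^sup>* (s i) (t' i)" using e tt' by auto
    ultimately show ?thesis using descendants_same_side[of "s' i" "s i" "t' i"] l that by blast
  qed
  show "s' i < t' i" if "up i" "N dvd t k"
  proof -
    have "N dvd t' i" using dvd_cong u that by blast
    moreover have "t i < t' i" using that i pos by (simp add: t'_def)
    moreover have "(edge s t)\<^sup>*\<^sup>* (s' i) (t i)" using e s's by auto
    ultimately show ?thesis using ancestors_same_side[of "t' i" "t i" "s' i"] u that by blast
  qed
  show "s' i < t' i \<longleftrightarrow> s i < t i" if "low i" "\<not> up i" "N dvd t i"
    using ancestors_same_side[OF that(3) e s's] that(2) i by (simp add: t'_def)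
  show "s' i < t' i \<longleftrightarrow> s i < t i" if "up i" "\<not> low i" "\<not> N dvd s i"
    using descendants_same_side[OF that(3) e tt'] that(2) i by (simp add: s'_def)
qed

lemma noloop': "i \<le> n \<Longrightarrow> \<not> N dvd t' i - s' i"
proof -
  assume i: "i \<le> n"
  have ni: "\<not> N dvd t i - s i" by (rule admissible_noloop[OF admissible i])
  consider "i = k" | "i \<noteq> k" "up i" "low i" | "i \<noteq> k" "\<not> up i" "\<not> low i"
    | "i \<noteq> k" "up i" "\<not> low i" | "i \<noteq> k" "\<not> up i" "low i" by blast
  then show ?thesis
  proof cases
    case 1
    then show ?thesis using not_dvd_k by (simp add: s'_def t'_def dvd_sym_diff[of "s k"])
  next
    case 2
    have "t' i - t k = t i - s k" "s' i - s k = s i - t k" using 2 by (simp_all add: s'_def t'_def)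
    then have d: "N dvd t' i - t k" "N dvd s' i - s k" using 2 by (simp_all add: up_def low_def)
    show ?thesis using dvd_cong_diff[OF d(2), of "t' i"] dvd_cong_diff[OF d(1), of "s k"] not_dvd_k
      by (metis dvd_sym_diff)
  next
    case 3
    then show ?thesis using ni by (simp add: s'_def t'_def)
  next
    case 4
    \<comment> \<open>Otherwise both new ends would be congruent to \<open>t k\<close>; when both
      ends of the rotated edge are ordinary, this takes \<open>excl\<close>.\<close>
    have "\<not> N dvd s i - t k"
    proof
      assume a: "N dvd s i - t k"
      then have n: "\<not> N dvd t k" "\<not> t i < s i" using 4 by (auto simp: low_def)
      then have "s i < t i" using ni by (cases "s i = t i") auto
      then have "\<not> N dvd s k" using 4 by (auto simp: up_def)
      then show False using excl[OF i _ a] 4 n \<open>s i < t i\<close> by (auto simp: up_def)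
    qed
    moreover have "t' i - t k = t i - s k" "s' i = s i" using 4 by (simp_all add: s'_def t'_def)
    then have "N dvd t' i - t k" "s' i = s i" using 4 by (simp_all add: up_def)
    ultimately show ?thesis using dvd_cong_diff[of "t' i" "t k" "s i"] by (simp add: dvd_sym_diff[of "s i"])
  next
    case 5
    have "\<not> N dvd t i - s k"
    proof
      assume a: "N dvd t i - s k"
      then have n: "N dvd s k" "\<not> t i < s i" using 5 by (auto simp: up_def)
      then have "N dvd t k" using 5 by (auto simp: low_def)
      then show False using n not_dvd_k by (simp add: dvd_diff)
    qed
    moreover have "s' i - s k = s i - t k" "t' i = t i" using 5 by (simp_all add: s'_def t'_def)
    then have "N dvd s' i - s k" "t' i = t i" using 5 by (simp_all add: low_def)
    ultimately show ?thesis using dvd_cong_diff[of "s' i" "s k" "t i"] by simp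
  qed
qed

lemma ends_mod:
  assumes "i \<le> n" "i \<noteq> k"
  shows "N dvd s' i - z \<longleftrightarrow> (if low i then N dvd s k - z else N dvd s i - z)"
    and "N dvd t' i - z \<longleftrightarrow> (if up i then N dvd t k - z else N dvd t i - z)"
proof -
  have "N dvd s' i - z \<longleftrightarrow> N dvd s k - z" if "low i"
  proof -
    have "s' i - s k = s i - t k" using assms that by (simp add: s'_def)
    then have "N dvd s' i - s k" using that by (simp add: low_def)
    then show ?thesis using dvd_cong_diff[of "s' i" "s k" z] by (metis dvd_sym_diff)
  qed
  then show "N dvd s' i - z \<longleftrightarrow> (if low i then N dvd s k - z else N dvd s i - z)"
    using assms by (simp add: s'_def)
  have "N dvd t' i - z \<longleftrightarrow> N dvd t k - z" if "up i"
  proof -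
    have "t' i - t k = t i - s k" using assms that by (simp add: t'_def)
    then have "N dvd t' i - t k" using that by (simp add: up_def)
    then show ?thesis using dvd_cong_diff[of "t' i" "t k" z] by (metis dvd_sym_diff)
  qed
  then show "N dvd t' i - z \<longleftrightarrow> (if up i then N dvd t k - z else N dvd t i - z)"
    using assms by (simp add: t'_def)
qed

lemma slot_source: 
  assumes z: "N dvd z - s k" and i: "i \<le> n"
  shows "N dvd s k \<Longrightarrow> slot s t z 0 i \<longleftrightarrow> i = k" "N dvd s k \<Longrightarrow> slot s t z 1 i \<longleftrightarrow> lft i" 
    "N dvd s k \<Longrightarrow> slot s t z 2 i \<longleftrightarrow> up i"
    "\<not> N dvd s k \<Longrightarrow> slot s t z 0 i \<longleftrightarrow> up i" "\<not> N dvd s k \<Longrightarrow> slot s t z 1 i \<longleftrightarrow> i = k" 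
    "\<not> N dvd s k \<Longrightarrow> slot s t z 2 i \<longleftrightarrow> lft i"
proof -
  have zz: "N dvd z \<longleftrightarrow> N dvd s k" using dvd_cong[OF z] .
  note sl = slot_def zz dvd_cong_diff[OF z]
  have "slot s t z 0 k" if "N dvd s k" using that by (simp add: sl)
  then show "slot s t z 0 i \<longleftrightarrow> i = k" if "N dvd s k" using admissible_slot[OF admissible i k] that by blast
  have "slot s t z 1 k" if "\<not> N dvd s k" using that pos by (simp add: sl)
  then show "slot s t z 1 i \<longleftrightarrow> i = k" if "\<not> N dvd s k" using admissible_slot[OF admissible i k] that by blast
  show "slot s t z 1 i \<longleftrightarrow> lft i" if "N dvd s k" using that by (simp add: sl lft_def)
  show "slot s t z 2 i \<longleftrightarrow> up i" if "N dvd s k" using that by (simp add: sl up_def)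
  show "slot s t z 0 i \<longleftrightarrow> up i" if "\<not> N dvd s k" using that by (simp add: sl up_def)
  show "slot s t z 2 i \<longleftrightarrow> lft i" if "\<not> N dvd s k" using that by (simp add: sl lft_def)
qed

lemma slot_target: 
  assumes z: "N dvd z - t k" and i: "i \<le> n"
  shows "N dvd t k \<Longrightarrow> slot s t z 0 i \<longleftrightarrow> low i" "N dvd t k \<Longrightarrow> slot s t z 1 i \<longleftrightarrow> i = k" 
    "N dvd t k \<Longrightarrow> slot s t z 2 i \<longleftrightarrow> rgt i"
    "\<not> N dvd t k \<Longrightarrow> slot s t z 0 i \<longleftrightarrow> i = k" "\<not> N dvd t k \<Longrightarrow> slot s t z 1 i \<longleftrightarrow> rgt i" 
    "\<not> N dvd t k \<Longrightarrow> slot s t z 2 i \<longleftrightarrow> low i"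
proof -
  have zz: "N dvd z \<longleftrightarrow> N dvd t k" using dvd_cong[OF z] .
  note sl = slot_def zz dvd_cong_diff[OF z]
  have "slot s t z 1 k" if "N dvd t k" using that pos by (simp add: sl)
  then show "slot s t z 1 i \<longleftrightarrow> i = k" if "N dvd t k" using admissible_slot[OF admissible i k] that by blast
  have "slot s t z 0 k" if "\<not> N dvd t k" using that by (simp add: sl)
  then show "slot s t z 0 i \<longleftrightarrow> i = k" if "\<not> N dvd t k" using admissible_slot[OF admissible i k] that by blast
  show "slot s t z 0 i \<longleftrightarrow> low i" if "N dvd t k" using that by (simp add: sl low_def)
  show "slot s t z 2 i \<longleftrightarrow> rgt i" if "N dvd t k" using that by (simp add: sl rgt_def)
  show "slot s t z 1 i \<longleftrightarrow> rgt i" if "\<not> N dvd t k" using that by (simp add: sl rgt_def)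
  show "slot s t z 2 i \<longleftrightarrow> low i" if "\<not> N dvd t k" using that by (simp add: sl low_def)
qed

lemma only_k: 
  assumes "i \<le> n" "i \<noteq> k"
  shows "N dvd s k \<Longrightarrow> \<not> N dvd s i - s k" "\<not> N dvd s k \<Longrightarrow> N dvd s i - s k \<Longrightarrow> t i < s i"
    "\<not> N dvd t k \<Longrightarrow> \<not> N dvd t i - t k" "N dvd t k \<Longrightarrow> N dvd t i - t k \<Longrightarrow> t i < s i"
proof -
  have ne: "s i \<noteq> t i" using admissible_noloop[OF admissible assms(1)] by auto
  show "N dvd s k \<Longrightarrow> \<not> N dvd s i - s k" using slot_source(1)[of "s k" i] assms by (simp add: slot_def)
  show "\<not> N dvd s k \<Longrightarrow> N dvd s i - s k \<Longrightarrow> t i < s i"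
    using slot_source(5)[of "s k" i] assms ne by (simp add: slot_def)
  show "\<not> N dvd t k \<Longrightarrow> \<not> N dvd t i - t k" using slot_target(4)[of "t k" i] assms by (simp add: slot_def)
  show "N dvd t k \<Longrightarrow> N dvd t i - t k \<Longrightarrow> t i < s i"
    using slot_target(2)[of "t k" i] assms ne by (simp add: slot_def)
qed

lemma not_both_rev: "\<not> (N dvd s k \<and> N dvd t k)"
  using not_dvd_k by auto

text \<open>No cancellation occurs between the arrows at the two ends of the rotated edge.\<close>

lemma exclusive:
  assumes "i \<le> n" "i \<noteq> k" "up i \<or> low i"
  shows "\<not> lft i" "\<not> rgt i"
proof -
  have ni: "\<not> N dvd t i - s i" by (rule admissible_noloop[OF admissible assms(1)])
  have ni1: "\<not> (N dvd t i - z \<and> N dvd s i - z)" for z using dvd_trans_diff[of "t i" z "s i"] ni by blast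
  have ni2: "\<not> (N dvd z - s k \<and> N dvd z - t k)" for z
    using dvd_trans_diff[of "t k" z "s k"] not_dvd_k by (auto simp: dvd_sym_diff[of z])
  show "\<not> lft i" using assms(3) ni1[of "s k"] ni2[of "s i"] not_both_rev
    by (auto simp: lft_def up_def low_def split: if_splits)
  show "\<not> rgt i" using assms(3) ni1[of "t k"] ni2[of "t i"] not_both_rev excl[OF assms(1)]
    by (auto simp: rgt_def up_def low_def split: if_splits)
qed

lemma slot'_source: 
  assumes z: "N dvd z - s k" and i: "i \<le> n"
  shows "N dvd s k \<Longrightarrow> slot s' t' z 0 i \<longleftrightarrow> low i" "N dvd s k \<Longrightarrow> slot s' t' z 1 i \<longleftrightarrow> lft i" 
    "N dvd s k \<Longrightarrow> slot s' t' z 2 i \<longleftrightarrow> i = k"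
    "\<not> N dvd s k \<Longrightarrow> slot s' t' z 0 i \<longleftrightarrow> i = k" "\<not> N dvd s k \<Longrightarrow> slot s' t' z 1 i \<longleftrightarrow> low i" 
    "\<not> N dvd s k \<Longrightarrow> slot s' t' z 2 i \<longleftrightarrow> lft i"
proof -
  have zz: "N dvd z \<longleftrightarrow> N dvd s k" using dvd_cong[OF z] .
  note sl = slot_def zz dvd_cong_diff[OF z]
  have kk: "s' k = t k" "t' k = s k" by (simp_all add: s'_def t'_def)
  have lk: "\<not> low k" "\<not> lft k" using pos not_dvd_k by (auto simp: low_def lft_def dvd_sym_diff[of "s k"])
  note em = ends_mod[OF i] and ok = only_k[OF i] and ex = exclusive[OF i] and sg = signs[OF i]
  have unmoved: "s' i = s i" if "\<not> low i" "i \<noteq> k" using that by (simp add: s'_def)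
  have unmoved': "t' i = t i" if "\<not> up i" "i \<noteq> k" using that by (simp add: t'_def)
  have ne: "s i \<noteq> t i" using admissible_noloop[OF admissible i] by auto
  show "slot s' t' z 0 i \<longleftrightarrow> low i" if r: "N dvd s k"
    using em ok(1) r lk kk not_dvd_k by (cases "i = k") (auto simp: sl)
  show "slot s' t' z 0 i \<longleftrightarrow> i = k" if r: "\<not> N dvd s k"
    using em r kk not_dvd_k by (cases "i = k") (auto simp: sl up_def)
  show "slot s' t' z 2 i \<longleftrightarrow> i = k" if r: "N dvd s k"
  proof (cases "i = k")
    case False
    have "\<not> t' i < s' i" if "N dvd t' i - s k"
    proof -
      have u: "\<not> up i" "N dvd t i - s k" using that em(2)[OF False, of "s k"] not_dvd_k by (auto split: if_splits)
      then have lt: "s i < t i" using r ne by (auto simp: up_def)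
      have "N dvd t i" using dvd_cong[OF u(2)] r by simp
      then show ?thesis using lt sg(3)[OF False _ u(1)] unmoved[OF _ False] unmoved'[OF u(1) False]
        by (cases "low i") auto
    qed
    then show ?thesis using r False by (auto simp: sl)
  qed (use r kk pos in \<open>simp add: sl\<close>)
  show "slot s' t' z 1 i \<longleftrightarrow> lft i" if r: "N dvd s k"
  proof (cases "i = k")
    case False
    show ?thesis
    proof
      assume "slot s' t' z 1 i"
      then have a: "N dvd t' i - s k" "s' i < t' i" using r by (auto simp: sl)
      then have u: "\<not> up i" "N dvd t i - s k" using em(2)[OF False, of "s k"] not_dvd_k by (auto split: if_splits)
      then show "lft i" using r ne by (auto simp: up_def lft_def)
    next
      assume l: "lft i"
      then have nn: "\<not> up i" "\<not> low i" using ex[OF False] by auto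
      then show "slot s' t' z 1 i" 
        using l r unmoved[OF nn(2) False] unmoved'[OF nn(1) False] by (simp add: sl lft_def)
    qed
  qed (use r kk pos lk not_dvd_k in \<open>simp add: sl\<close>)
  show "slot s' t' z 1 i \<longleftrightarrow> low i" if r: "\<not> N dvd s k"
  proof (cases "i = k")
    case False
    show ?thesis
    proof
      assume "slot s' t' z 1 i"
      then have a: "N dvd s' i - s k" "s' i < t' i" using r by (auto simp: sl)
      show "low i"
      proof (rule ccontr)
        assume nl: "\<not> low i"
        then have b: "N dvd s i - s k" using a(1) em(1)[OF False] by simp
        then have "t i < s i" using ok(2)[OF False] r by simp
        moreover have "lft i" using b r \<open>t i < s i\<close> by (simp add: lft_def)
        then have "\<not> up i" using ex[OF False] by auto
        ultimately show False using a(2) unmoved[OF nl False] unmoved'[OF _ False] by simp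
      qed
    next
      assume l: "low i"
      then show "slot s' t' z 1 i" 
        using r em(1)[OF False, of "s k"] sg(1)[OF False] by (simp add: sl)
    qed
  qed (use r kk pos lk not_dvd_k in \<open>simp add: sl\<close>)
  show "slot s' t' z 2 i \<longleftrightarrow> lft i" if r: "\<not> N dvd s k"
  proof (cases "i = k")
    case False
    show ?thesis
    proof
      assume "slot s' t' z 2 i"
      then have a: "N dvd s' i - s k" "t' i < s' i" using r by (auto simp: sl)
      have nl: "\<not> low i" using sg(1)[OF False] a(2) r by auto
      then have b: "N dvd s i - s k" using a(1) em(1)[OF False] by simp
      then show "lft i" using ok(2)[OF False] r by (simp add: lft_def)
    next
      assume l: "lft i"
      then have nn: "\<not> up i" "\<not> low i" using ex[OF False] by auto
      then show "slot s' t' z 2 i" 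
        using l r unmoved[OF nn(2) False] unmoved'[OF nn(1) False] by (simp add: sl lft_def)
    qed
  qed (use r kk pos lk not_dvd_k in \<open>simp add: sl\<close>)
qed

lemma slot'_target: 
  assumes z: "N dvd z - t k" and i: "i \<le> n"
  shows "N dvd t k \<Longrightarrow> slot s' t' z 0 i \<longleftrightarrow> i = k" "N dvd t k \<Longrightarrow> slot s' t' z 1 i \<longleftrightarrow> up i" 
    "N dvd t k \<Longrightarrow> slot s' t' z 2 i \<longleftrightarrow> rgt i"
    "\<not> N dvd t k \<Longrightarrow> slot s' t' z 0 i \<longleftrightarrow> up i" "\<not> N dvd t k \<Longrightarrow> slot s' t' z 1 i \<longleftrightarrow> rgt i" 
    "\<not> N dvd t k \<Longrightarrow> slot s' t' z 2 i \<longleftrightarrow> i = k"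
proof -
  have zz: "N dvd z \<longleftrightarrow> N dvd t k" using dvd_cong[OF z] .
  note sl = slot_def zz dvd_cong_diff[OF z]
  have kk: "s' k = t k" "t' k = s k" by (simp_all add: s'_def t'_def)
  have nk: "\<not> N dvd s k - t k" using not_dvd_k by (simp add: dvd_sym_diff[of "s k"])
  have lk: "\<not> up k" "\<not> rgt k" using pos not_dvd_k nk by (auto simp: up_def rgt_def)
  note em = ends_mod[OF i] and ok = only_k[OF i] and ex = exclusive[OF i] and sg = signs[OF i]
  have unmoved: "s' i = s i" if "\<not> low i" "i \<noteq> k" using that by (simp add: s'_def)
  have unmoved': "t' i = t i" if "\<not> up i" "i \<noteq> k" using that by (simp add: t'_def)
  have ne: "s i \<noteq> t i" using admissible_noloop[OF admissible i] by auto
  show "slot s' t' z 0 i \<longleftrightarrow> i = k" if r: "N dvd t k"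
    using em r kk nk by (cases "i = k") (auto simp: sl low_def)
  show "slot s' t' z 0 i \<longleftrightarrow> up i" if r: "\<not> N dvd t k"
    using em ok(3) r lk kk nk by (cases "i = k") (auto simp: sl)
  show "slot s' t' z 2 i \<longleftrightarrow> i = k" if r: "\<not> N dvd t k"
  proof (cases "i = k")
    case False
    have "\<not> t' i < s' i" if "N dvd s' i - t k"
    proof -
      have u: "\<not> low i" "N dvd s i - t k" using that em(1)[OF False, of "t k"] nk by (auto split: if_splits)
      then have lt: "s i < t i" using r ne by (auto simp: low_def)
      have "\<not> N dvd s i" using dvd_cong[OF u(2)] r by simp
      then show ?thesis using lt sg(4)[OF False _ u(1)] unmoved'[OF _ False] unmoved[OF u(1) False]
        by (cases "up i") auto
    qed
    then show ?thesis using r False by (auto simp: sl)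
  qed (use r kk pos in \<open>simp add: sl\<close>)
  show "slot s' t' z 1 i \<longleftrightarrow> rgt i" if r: "\<not> N dvd t k"
  proof (cases "i = k")
    case False
    show ?thesis
    proof
      assume "slot s' t' z 1 i"
      then have a: "N dvd s' i - t k" using r by (auto simp: sl)
      then have u: "\<not> low i" "N dvd s i - t k" using em(1)[OF False, of "t k"] nk by (auto split: if_splits)
      then show "rgt i" using r ne by (auto simp: low_def rgt_def)
    next
      assume l: "rgt i"
      then have nn: "\<not> up i" "\<not> low i" using ex[OF False] by auto
      then show "slot s' t' z 1 i" 
        using l r unmoved[OF nn(2) False] unmoved'[OF nn(1) False] by (simp add: sl rgt_def)
    qed
  qed (use r kk pos lk nk in \<open>simp add: sl\<close>)
  show "slot s' t' z 1 i \<longleftrightarrow> up i" if r: "N dvd t k"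
  proof (cases "i = k")
    case False
    show ?thesis
    proof
      assume "slot s' t' z 1 i"
      then have a: "N dvd t' i - t k" "s' i < t' i" using r by (auto simp: sl)
      show "up i"
      proof (rule ccontr)
        assume nl: "\<not> up i"
        then have b: "N dvd t i - t k" using a(1) em(2)[OF False] by simp
        then have "t i < s i" using ok(4)[OF False] r by simp
        moreover have "rgt i" using b r \<open>t i < s i\<close> by (simp add: rgt_def)
        then have "\<not> low i" using ex[OF False] by auto
        ultimately show False using a(2) unmoved'[OF nl False] unmoved[OF _ False] by simp
      qed
    next
      assume l: "up i"
      then show "slot s' t' z 1 i" 
        using r em(2)[OF False, of "t k"] sg(2)[OF False] by (simp add: sl)
    qed
  qed (use r kk pos lk nk in \<open>simp add: sl\<close>)
  show "slot s' t' z 2 i \<longleftrightarrow> rgt i" if r: "N dvd t k"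
  proof (cases "i = k")
    case False
    show ?thesis
    proof
      assume "slot s' t' z 2 i"
      then have a: "N dvd t' i - t k" "t' i < s' i" using r by (auto simp: sl)
      have nl: "\<not> up i" using sg(2)[OF False] a(2) r by auto
      then have b: "N dvd t i - t k" using a(1) em(2)[OF False] by simp
      then show "rgt i" using ok(4)[OF False] r by (simp add: rgt_def)
    next
      assume l: "rgt i"
      then have nn: "\<not> up i" "\<not> low i" using ex[OF False] by auto
      then show "slot s' t' z 2 i" 
        using l r unmoved[OF nn(2) False] unmoved'[OF nn(1) False] by (simp add: sl rgt_def)
    qed
  qed (use r kk pos lk nk in \<open>simp add: sl\<close>)
qed

lemma slot'_other: 
  assumes z: "\<not> N dvd z - s k" "\<not> N dvd z - t k" and i: "i \<le> n"
  shows "slot s' t' z p i \<longleftrightarrow> slot s t z p i"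
proof (cases "i = k")
  case True
  then show ?thesis using z by (auto simp: slot_def s'_def t'_def dvd_sym_diff[of z])
next
  case False
  have sz: "N dvd s' i - z \<longleftrightarrow> N dvd s i - z \<and> \<not> low i" "N dvd s i - z \<Longrightarrow> \<not> low i"
    using ends_mod(1)[OF i False, of z] z dvd_cong_diff[of "s i" "t k" z]
    by (auto simp: dvd_sym_diff[of z] low_def)
  have tz: "N dvd t' i - z \<longleftrightarrow> N dvd t i - z \<and> \<not> up i" "N dvd t i - z \<Longrightarrow> \<not> up i"
    using ends_mod(2)[OF i False, of z] z dvd_cong_diff[of "t i" "s k" z]
    by (auto simp: dvd_sym_diff[of z] up_def)
  have ne: "s i \<noteq> t i" "s' i \<noteq> t' i" using admissible_noloop[OF admissible i] noloop'[OF i] by auto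
  have 1: "s' i < t' i \<longleftrightarrow> s i < t i" if "\<not> N dvd z" "N dvd s i - z"
  proof -
    have "\<not> N dvd s i" using dvd_cong[OF that(2)] that(1) by simp
    then show ?thesis using signs(4)[OF i False] sz(2)[OF that(2)] False
      by (cases "up i") (auto simp: s'_def t'_def)
  qed
  have 2: "s' i < t' i \<longleftrightarrow> s i < t i" if "N dvd z" "N dvd t i - z"
  proof -
    have "N dvd t i" using dvd_cong[OF that(2)] that(1) by simp
    then show ?thesis using signs(3)[OF i False] tz(2)[OF that(2)] False
      by (cases "low i") (auto simp: s'_def t'_def)
  qed
  show ?thesis using sz tz 1 2 ne unfolding slot_def by (smt (verit))
qed

lemma slot'_unique: 
  assumes "i \<le> n" "j \<le> n" "slot s' t' z p i" "slot s' t' z p j"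
  shows "i = j"
proof -
  have p: "p = 0 \<or> p = 1 \<or> p = 2" using assms(3) by (auto simp: slot_def split: if_splits)
  have u: "i = j" if "\<And>i. i \<le> n \<Longrightarrow> slot s' t' z p i \<longleftrightarrow> slot s t z' p' i" for z' p'
    using admissible_slot[OF admissible assms(1,2)] that assms by blast
  have u': "i = j" if "\<And>i. i \<le> n \<Longrightarrow> slot s' t' z p i \<longleftrightarrow> i = k" 
    using that assms by blast
  consider "N dvd z - s k" | "N dvd z - t k" | "\<not> N dvd z - s k" "\<not> N dvd z - t k" by blast
  then show ?thesis
  proof cases
    case 1
    note a = slot'_source[OF 1] and b = slot_source[OF 1] and c = slot_target[of "t k"]
    show ?thesis
    proof (cases "N dvd s k")
      case True
      have nt: "\<not> N dvd t k" using True not_both_rev by blast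
      show ?thesis using p a b c True nt u[of "t k" 2] u[of z 1] u' by (metis dvd_0_right diff_self)
    next
      case False
      show ?thesis using p a b c False u[of "t k" 2] u[of "t k" 0] u[of z 2] u' by (metis dvd_0_right diff_self)
    qed
  next
    case 2
    note a = slot'_target[OF 2] and b = slot_target[OF 2] and c = slot_source[of "s k"]
    show ?thesis
    proof (cases "N dvd t k")
      case True
      have nt: "\<not> N dvd s k" using True not_both_rev by blast
      show ?thesis using p a b c True nt u[of "s k" 0] u[of z 2] u' by (metis dvd_0_right diff_self)
    next
      case False
      show ?thesis using p a b c False u[of "s k" 2] u[of "s k" 0] u[of z 1] u' by (metis dvd_0_right diff_self)
    qed
  next
    case 3
    show ?thesis using slot'_other[OF 3] u[of z p] by blast
  qed
qed

lemma cyc3_cong: 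
  assumes "A i \<longleftrightarrow> A' i" "A j \<longleftrightarrow> A' j" "B i \<longleftrightarrow> B' i" "B j \<longleftrightarrow> B' j" "C i \<longleftrightarrow> C' i" "C j \<longleftrightarrow> C' j"
  shows "cyc3 A B C i j = cyc3 A' B' C' i j"
  using assms by (simp add: cyc3_def)

text \<open>Read cyclically, the slots look the same whether or not the end is a multiple of
  \<open>N\<close>; the slot numbering at the multiples is chosen for this.\<close>

lemma wedge_source: 
  assumes "N dvd z - s k" "i \<le> n" "j \<le> n"
  shows "wedge s t z i j = cyc3 up (\<lambda>i. i = k) lft i j"
proof (cases "N dvd s k")
  case True
  have "wedge s t z i j = cyc3 (\<lambda>i. i = k) lft up i j"
    using slot_source[OF assms(1)] assms True by (intro cyc3_cong) auto
  then show ?thesis by (metis cyc3_rotate)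
next
  case False
  then show ?thesis using slot_source[OF assms(1)] assms by (intro cyc3_cong) auto
qed

lemma wedge_target: 
  assumes "N dvd z - t k" "i \<le> n" "j \<le> n"
  shows "wedge s t z i j = cyc3 (\<lambda>i. i = k) rgt low i j"
proof (cases "N dvd t k")
  case True
  have "wedge s t z i j = cyc3 low (\<lambda>i. i = k) rgt i j"
    using slot_target[OF assms(1)] assms True by (intro cyc3_cong) auto
  then show ?thesis by (metis cyc3_rotate)
next
  case False
  then show ?thesis using slot_target[OF assms(1)] assms by (intro cyc3_cong) auto
qed

lemma wedge'_source: 
  assumes "N dvd z - s k" "i \<le> n" "j \<le> n"
  shows "wedge s' t' z i j = cyc3 (\<lambda>i. i = k) low lft i j"
proof (cases "N dvd s k")
  case True
  have "wedge s' t' z i j = cyc3 low lft (\<lambda>i. i = k) i j"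
    using slot'_source[OF assms(1)] assms True by (intro cyc3_cong) auto
  then show ?thesis by (metis cyc3_rotate)
next
  case False
  then show ?thesis using slot'_source[OF assms(1)] assms by (intro cyc3_cong) auto
qed

lemma wedge'_target: 
  assumes "N dvd z - t k" "i \<le> n" "j \<le> n"
  shows "wedge s' t' z i j = cyc3 up rgt (\<lambda>i. i = k) i j"
proof (cases "N dvd t k")
  case True
  have "wedge s' t' z i j = cyc3 (\<lambda>i. i = k) up rgt i j"
    using slot'_target[OF assms(1)] assms True by (intro cyc3_cong) auto
  then show ?thesis by (metis cyc3_rotate)
next
  case False
  then show ?thesis using slot'_target[OF assms(1)] assms by (intro cyc3_cong) auto
qed

lemma wedge'_other: 
  assumes "\<not> N dvd z - s k" "\<not> N dvd z - t k" "i \<le> n" "j \<le> n"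
  shows "wedge s' t' z i j = wedge s t z i j"
  using slot'_other[OF assms(1,2)] assms by (intro cyc3_cong) auto

lemma mod_node: 
  shows "q mod N \<in> {0..<N}" "N dvd q mod N - q" "z \<in> {0..<N} \<Longrightarrow> N dvd z - q \<Longrightarrow> z = q mod N"
proof -
  show "q mod N \<in> {0..<N}" using N_pos by simp
  show "N dvd q mod N - q" by (metis dvd_minus_mod dvd_sym_diff)
  assume "z \<in> {0..<N}" "N dvd z - q"
  then show "z = q mod N" by (simp add: mod_eq_dvd_iff[symmetric] mod_pos_pos_trivial)
qed

lemma ends_distinct: "s k mod N \<noteq> t k mod N"
  using not_dvd_k by (metis mod_eq_dvd_iff)

definition moves :: "nat \<Rightarrow> int" where
  "moves i = of_bool (up i) + of_bool (low i)"

definition stays :: "nat \<Rightarrow> int" where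
  "stays i = of_bool (lft i) + of_bool (rgt i)"

lemma k_roles: "\<not> up k" "\<not> low k" "\<not> lft k" "\<not> rgt k"
  using pos not_dvd_k by (auto simp: up_def low_def lft_def rgt_def dvd_sym_diff[of "s k"])

text \<open>Only the two ends of the rotated edge contribute. In their cyclic orders
  \<open>up\<close> and \<open>low\<close> come just before \<open>k\<close>, while
  \<open>lft\<close> and \<open>rgt\<close> come just after it, so the edges with arrows to
  \<open>k\<close> are the ones that the rotation moves.\<close>

lemma om_k: 
  assumes i: "i \<le> n" "i \<noteq> k"
  shows "om n (cvec (s i) (t i)) (cvec (s k) (t k)) = moves i - stays i"
proof -
  let ?x = "s k mod N" and ?y = "t k mod N"
  have 0: "wedge s t z i k = 0" if "z \<in> {0..<N}" "z \<noteq> ?x" "z \<noteq> ?y" for z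
  proof -
    have "\<not> N dvd z - s k" "\<not> N dvd z - t k" using mod_node(3)[OF that(1)] that(2,3) by blast+
    then have "\<not> slot s t z p k" for p by (auto simp: slot_def dvd_sym_diff[of z])
    then show ?thesis by (simp add: cyc3_def)
  qed
  have "(\<Sum>z\<in>{0..<N}. wedge s t z i k) = (\<Sum>z\<in>{0..<N}. 0) + (wedge s t ?x i k - 0) + (wedge s t ?y i k - 0)"
    using 0 mod_node(1) ends_distinct by (intro sum_diff_two) auto
  also have "\<dots> = moves i - stays i"
    using wedge_source[OF mod_node(2) i(1) k] wedge_target[OF mod_node(2) i(1) k] k_roles i(2)
    by (simp add: cyc3_def moves_def stays_def)
  finally show ?thesis using admissible_om[OF admissible i(1) k] by simp
qed

lemma om_k_pos: 
  assumes "i \<le> n" "i \<noteq> k"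
  shows "max 0 (om n (cvec (s i) (t i)) (cvec (s k) (t k))) = moves i"
  using om_k[OF assms] exclusive[OF assms] by (auto simp: moves_def stays_def max_def)

lemma cvec': 
  assumes i: "i \<le> n" "i \<noteq> k"
  shows "cvec (s' i) (t' i) = (\<lambda>j. cvec (s i) (t i) j + moves i * cvec (s k) (t k) j)"
proof
  fix j
  have "steps j (t' i) = steps j (t i) + of_bool (up i) * cvec (s k) (t k) j"
  proof (cases "up i")
    case True
    then obtain m where m: "t i = s k + m * N" by (metis up_def diff_add_cancel dvdE mult.commute add.commute)
    then have "t' i = t k + m * N" using True i by (simp add: t'_def)
    then show ?thesis using True m by (simp add: steps_shift cvec_def)
  next
    case False
    then show ?thesis using i by (simp add: t'_def)
  qed
  moreover have "steps j (s' i) = steps j (s i) - of_bool (low i) * cvec (s k) (t k) j"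
  proof (cases "low i")
    case True
    then obtain m where m: "s i = t k + m * N" by (metis low_def diff_add_cancel dvdE mult.commute add.commute)
    then have "s' i = s k + m * N" using True i by (simp add: s'_def)
    then show ?thesis using True m by (simp add: steps_shift cvec_def)
  next
    case False
    then show ?thesis using i by (simp add: s'_def)
  qed
  ultimately show "cvec (s' i) (t' i) j = cvec (s i) (t i) j + moves i * cvec (s k) (t k) j"
    by (simp add: cvec_def moves_def algebra_simps)
qed

lemma cvec'_k: "cvec (s' k) (t' k) = (\<lambda>j. - cvec (s k) (t k) j)"
  by (auto simp: cvec_def s'_def t'_def)

text \<open>Only the wedges at the two ends change. For edges other than \<open>k\<close> the total
  change is \<open>moves i * stays j - stays i * moves j\<close>, which is also the correction that
  bilinearity yields for the new c-vectors.\<close>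

lemma om':
  assumes ij: "i \<le> n" "j \<le> n"
  shows "om n (cvec (s' i) (t' i)) (cvec (s' j) (t' j)) = (\<Sum>z\<in>{0..<N}. wedge s' t' z i j)"
proof -
  let ?x = "s k mod N" and ?y = "t k mod N"
  have S: "(\<Sum>z\<in>{0..<N}. wedge s' t' z i j) = (\<Sum>z\<in>{0..<N}. wedge s t z i j)
     + (wedge s' t' ?x i j - wedge s t ?x i j) + (wedge s' t' ?y i j - wedge s t ?y i j)"
  proof (intro sum_diff_two)
    fix z assume z: "z \<in> {0..<N}" "z \<noteq> ?x" "z \<noteq> ?y"
    have "\<not> N dvd z - s k" "\<not> N dvd z - t k" using mod_node(3)[OF z(1)] z(2,3) by blast+
    then show "wedge s' t' z i j = wedge s t z i j" using ij by (rule wedge'_other)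
  qed (use mod_node(1) ends_distinct in auto)
  have S': "(\<Sum>z\<in>{0..<N}. wedge s' t' z i j) = om n (cvec (s i) (t i)) (cvec (s j) (t j))
     + (cyc3 (\<lambda>i. i = k) low lft i j - cyc3 up (\<lambda>i. i = k) lft i j)
     + (cyc3 up rgt (\<lambda>i. i = k) i j - cyc3 (\<lambda>i. i = k) rgt low i j)"
    using S admissible_om[OF admissible ij] wedge_source[OF mod_node(2) ij] wedge_target[OF mod_node(2) ij]
      wedge'_source[OF mod_node(2) ij] wedge'_target[OF mod_node(2) ij] by simp
  show ?thesis
  proof (cases "i = k \<or> j = k")
    case True
    show ?thesis
    proof (cases "i = j")
      case True
      then show ?thesis using S' by (simp add: cyc3_def)
    next
      case False
      have "om n (cvec (s' i) (t' i)) (cvec (s' j) (t' j)) = - om n (cvec (s i) (t i)) (cvec (s j) (t j))"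
        using True False cvec'[OF ij(1)] cvec'[OF ij(2)] cvec'_k by (auto simp: om_linear)
      moreover have "om n (cvec (s i) (t i)) (cvec (s j) (t j)) = (if i = k then stays j - moves j else moves i - stays i)"
        using True False om_k ij om_swap[of n "cvec (s k) (t k)" "cvec (s j) (t j)"] by auto
      ultimately show ?thesis using S' True False k_roles 
        by (auto simp: cyc3_def moves_def stays_def)
    qed
  next
    case False
    then have ik: "i \<noteq> k" "j \<noteq> k" by auto
    let ?c = "\<lambda>i. cvec (s i) (t i)"
    have sw: "om n (?c k) (?c j) = stays j - moves j"
      using om_k[OF ij(2) ik(2)] om_swap[of n "?c k" "?c j"] by simp
    have "om n (cvec (s' i) (t' i)) (cvec (s' j) (t' j))
        = om n (?c i) (?c j) + moves i * (stays j - moves j) + moves j * (moves i - stays i)"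
      by (simp add: cvec'[OF ij(1) ik(1)] cvec'[OF ij(2) ik(2)] om_linear sw om_k[OF ij(1) ik(1)])
    then show ?thesis using S' ik by (simp add: cyc3_def moves_def stays_def algebra_simps)
  qed
qed

text \<open>An old potential is taken for the weights transformed like the c-vectors. Each new edge
  is a signed concatenation of old ones, so it receives its prescribed weight.\<close>

lemma height': "\<exists>H. \<forall>i\<le>n. \<forall>m. H (s' i + m * N) - H (t' i + m * N) = w i" for w :: "nat \<Rightarrow> int"
proof -
  obtain H where H: "\<And>i m. i \<le> n \<Longrightarrow> H (s i + m * N) - H (t i + m * N)
      = (if i = k then - w k else w i + moves i * w k)"
    using admissible_height[OF admissible, of "\<lambda>i. if i = k then - w k else w i + moves i * w k"] by blast
  have Hk: "H (s k + m * N) - H (t k + m * N) = - w k" for m using H[OF k] by simp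
  have "H (s' i + m * N) - H (t' i + m * N) = w i" if i: "i \<le> n" for i m
  proof (cases "i = k")
    case True
    then show ?thesis using Hk[of m] by (simp add: s'_def t'_def)
  next
    case False
    have "H (s' i + m * N) - H (s i + m * N) = - of_bool (low i) * w k"
    proof (cases "low i")
      case True
      then obtain m' where m: "s i = t k + m' * N" by (metis low_def diff_add_cancel dvdE mult.commute add.commute)
      then have "s' i = s k + m' * N" using True False by (simp add: s'_def)
      then show ?thesis using True m Hk[of "m' + m"] by (simp add: algebra_simps)
    qed (use False in \<open>simp add: s'_def\<close>)
    moreover have "H (t i + m * N) - H (t' i + m * N) = - of_bool (up i) * w k"
    proof (cases "up i")
      case True
      then obtain m' where m: "t i = s k + m' * N" by (metis up_def diff_add_cancel dvdE mult.commute add.commute)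
      then have "t' i = t k + m' * N" using True False by (simp add: t'_def)
      then show ?thesis using True m Hk[of "m' + m"] by (simp add: algebra_simps)
    qed (use False in \<open>simp add: t'_def\<close>)
    ultimately show ?thesis using H[OF i, of m] False by (simp add: moves_def algebra_simps)
  qed
  then show ?thesis by blast
qed

lemma edge': 
  assumes "rotation N (edge s t) H (s k) (t k - s k)"
  shows "edge s' t' = rotation.E' N (edge s t) (s k) (t k - s k)"
proof -
  interpret rotation N "edge s t" H "s k" "t k - s k" by (rule assms)
  have conv: "src' (s i + m * N) (t i + m * N) = s' i + m * N \<and> tgt' (s i + m * N) (t i + m * N) = t' i + m * N"
    if "i \<noteq> k" for i m
  proof -
    have "X (s i + m * N - (t k - s k)) \<longleftrightarrow> N dvd s i - t k"
    proof -
      have "s i + m * N - (t k - s k) - s k = (s i - t k) + m * N" by simp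
      then show ?thesis unfolding X_def by (simp only: dvd_add_times_triv_right_iff)
    qed
    then have l: "Low (s i + m * N) (t i + m * N) \<longleftrightarrow> low i" by (simp add: Low_def low_def) (metis dvd_cong)
    have "X (t i + m * N) \<longleftrightarrow> N dvd t i - s k"
    proof -
      have "t i + m * N - s k = (t i - s k) + m * N" by simp
      then show ?thesis unfolding X_def by (simp only: dvd_add_times_triv_right_iff)
    qed
    then have u: "Up (s i + m * N) (t i + m * N) \<longleftrightarrow> up i" by (simp add: Up_def up_def) (metis dvd_cong)
    show ?thesis using l u that by (simp add: src'_def tgt'_def s'_def t'_def)
  qed
  have not_k: "\<not> (X (s i + m * N) \<and> t i + m * N = s i + m * N + (t k - s k))" if "i \<le> n" "i \<noteq> k" for i m
  proof
    assume "X (s i + m * N) \<and> t i + m * N = s i + m * N + (t k - s k)"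
    then have "X (s i + m * N)" and lt: "s i < t i" using pos by auto
    moreover have "s i + m * N - s k = (s i - s k) + m * N" by simp
    ultimately have "N dvd s i - s k" unfolding X_def by (simp only: dvd_add_times_triv_right_iff)
    then show False using only_k(1,2)[OF that] lt by force
  qed
  show ?thesis
  proof (intro ext iffI)
    fix a b assume "edge s' t' a b"
    then obtain i m where i: "i \<le> n" "a = s' i + m * N" "b = t' i + m * N" by (auto simp: edge_def)
    show "E' a b"
    proof (cases "i = k")
      case True
      have "E' (s k + m * N + (t k - s k)) (s k + m * N)" by (rule flipped) (simp add: X_def)
      then show ?thesis using True i by (simp add: s'_def t'_def algebra_simps)
    next
      case False
      have "edge s t (s i + m * N) (t i + m * N)" using i unfolding edge_def by blast
      then have "E' (src' (s i + m * N) (t i + m * N)) (tgt' (s i + m * N) (t i + m * N))"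
        using not_k[OF i(1) False] by (rule moved)
      then show ?thesis using conv[OF False] i by simp
    qed
  next
    fix a b assume "E' a b"
    then show "edge s' t' a b"
    proof (cases rule: E'.cases)
      case flipped
      then obtain m where "b - s k = N * m" unfolding X_def by (auto elim: dvdE)
      then have "b = t' k + m * N" "a = s' k + m * N" using flipped by (simp_all add: s'_def t'_def algebra_simps)
      then show ?thesis using k unfolding edge_def by blast
    next
      case (moved a0 b0)
      then obtain i m where i: "i \<le> n" "a0 = s i + m * N" "b0 = t i + m * N" by (auto simp: edge_def)
      have "i \<noteq> k" using moved(4) i by (auto simp: X_def)
      then have "a = s' i + m * N" "b = t' i + m * N" using conv moved i by auto
      then show ?thesis using i(1) unfolding edge_def by blast
    qed
  qed
qed

lemma admissible': "admissible s' t'"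
proof -
  obtain H where rot: "rotation N (edge s t) H (s k) (t k - s k)" by (rule rotation_exists)
  interpret rotation N "edge s t" H "s k" "t k - s k" by (rule rot)
  have walls: "if N dvd z then (edge s' t')\<^sup>*\<^sup>* z b else (edge s' t')\<^sup>*\<^sup>* a z"
    if "edge s' t' a b" "strictly_between a z b" for a b z
    using that wall_below' wall_above' unfolding edge'[OF rot] by auto
  obtain i where i: "i \<le> n" "N dvd s i \<or> N dvd t i" using admissible unfolding admissible_def by blast
  have "\<exists>i\<le>n. N dvd s' i \<or> N dvd t' i"
  proof (cases "N dvd s k \<or> N dvd t k")
    case True
    then show ?thesis using k by (auto simp: s'_def t'_def)
  next
    case False
    have "\<not> (N dvd s i \<and> low i)" "\<not> (N dvd t i \<and> up i)" "i \<noteq> k"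
      using False dvd_cong[of "s i" "t k"] dvd_cong[of "t i" "s k"] i by (auto simp: low_def up_def)
    then have "N dvd s' i \<or> N dvd t' i" using i by (auto simp: s'_def t'_def)
    then show ?thesis using i by blast
  qed
  then show ?thesis using noloop' slot'_unique walls height' om' unfolding admissible_def by blast
qed

end

section \<open>The upper bound\<close>

locale rotation_sequence =
  fixes N :: int and l :: nat and Ed :: "nat \<Rightarrow> int \<Rightarrow> int \<Rightarrow> bool" and x d :: "nat \<Rightarrow> int"
  assumes N_gt: "1 < N"
    and initial: "Ed 0 a (a + 1)"
    and rot: "\<tau> < l \<Longrightarrow> \<exists>H. rotation N (Ed \<tau>) H (x \<tau>) (d \<tau>)"
    and next_edges: "\<tau> < l \<Longrightarrow> Ed (Suc \<tau>) = rotation.E' N (Ed \<tau>) (x \<tau>) (d \<tau>)"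
    and walls: "\<tau> \<le> l \<Longrightarrow> \<exists>H. walled N (Ed \<tau>) H"
    and final: "Ed l a b \<Longrightarrow> b < a"
begin

abbreviation R :: "nat \<Rightarrow> int \<Rightarrow> int \<Rightarrow> bool" where
  "R \<tau> \<equiv> (Ed \<tau>)\<^sup>*\<^sup>*"

lemma R_left_mono: 
  assumes "\<tau> \<le> \<tau>'" "\<tau>' \<le> l" "R \<tau> a b" "b < a"
  shows "R \<tau>' a b"
  using assms(1,2)
proof (induction \<tau>' rule: dec_induct)
  case base
  then show ?case using assms(3) by simp
next
  case (step m)
  then obtain H where H: "rotation N (Ed m) H (x m) (d m)" using rot by force
  show ?case using rotation.R_left_persists[OF H] step assms(4) next_edges[of m] by simp
qed

lemma R_right_antimono: 
  assumes "\<tau> \<le> \<tau>'" "\<tau>' \<le> l" "R \<tau>' a b" "a < b"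
  shows "R \<tau> a b"
  using assms(1,2,3)
proof (induction \<tau>' rule: dec_induct)
  case (step m)
  then obtain H where H: "rotation N (Ed m) H (x m) (d m)" using rot by force
  obtain H' where "walled N (Ed (Suc m)) H'" using walls step.prems(1) by blast
  then show ?case using rotation.R'_right_R[OF H, of H' a b] step assms(4) next_edges[of m] by simp
qed

lemma length_bound: "l < (\<Sum>j\<le>nat N. j)"
proof -
  have R0: "R 0 a (a + int k)" for a k
  proof (induction k)
    case (Suc k)
    have eq: "a + int (Suc k) = a + int k + 1" by simp
    show ?case unfolding eq by (rule rtranclp.rtrancl_into_rtrancl[OF Suc initial])
  qed simp
  have start: "R 0 0 N" using R0[of 0 "nat N"] N_gt by simp
  have "b \<le> a" if "R l a b" for a b
    using that by (induction rule: rtranclp_induct) (use final in force)+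
  then have "\<not> R l 0 N" using N_gt by force
  have "\<exists>\<theta><l. R \<theta> 0 N \<and> \<not> R (Suc \<theta>) 0 N"
  proof (rule ccontr)
    assume c: "\<not> ?thesis"
    have "\<tau> \<le> l \<longrightarrow> R \<tau> 0 N" for \<tau>
      using start c by (induction \<tau>) auto
    then show False using \<open>\<not> R l 0 N\<close> by blast
  qed
  then obtain \<theta> where \<theta>: "\<theta> < l" "R \<theta> 0 N" "\<not> R (Suc \<theta>) 0 N" by blast
  obtain H where H: "rotation N (Ed \<theta>) H (x \<theta>) (d \<theta>)" using rot \<theta>(1) by blast
  interpret r: rotation N "Ed \<theta>" H "x \<theta>" "d \<theta>" by (rule H)
  note r' = next_edges[OF \<theta>(1)]
  define v where "v = d \<theta>"
  have X0: "r.X 0" and v: "0 < v" "v < N"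
    using r.loss_between_rev[of 0 N] \<theta> N_gt r.d_pos unfolding r' v_def by auto
  have nv: "\<not> N dvd v" using v by (simp add: zdvd_not_zless)
  have e0v: "Ed \<theta> 0 v" using r.X_edge[OF X0] by (simp add: v_def)
  \<comment> \<open>Since \<open>0\<close> lies above \<open>N\<close>, every ancestor of
    \<open>0\<close> lies above a left parent of \<open>N\<close>, hence left of \<open>N\<close>.
    One strictly between \<open>0\<close> and \<open>N\<close> would reach \<open>0\<close> through
    a left child, whose descendants cannot include \<open>N\<close>.\<close>
  have anc0: "y \<le> 0" if y: "R \<theta> y 0" for y
  proof (rule ccontr)
    assume "\<not> y \<le> 0"
    then have y0: "0 < y" by simp
    obtain p where p: "R \<theta> 0 p" "Ed \<theta> p N" using \<theta>(2) N_gt by (metis rtranclp.cases less_irrefl zero_less_one order_less_trans)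
    have "p < N" using r.ancestors_same_side[OF _ p(2,1)] N_gt by simp
    then have "y < N" using r.ancestors_same_side[OF _ p(2) rtranclp_trans[OF y p(1)]] by simp
    then have ny: "\<not> N dvd y" using y0 by (simp add: zdvd_not_zless)
    obtain c where c: "Ed \<theta> y c" "R \<theta> c 0" using y y0 by (metis converse_rtranclpE less_irrefl)
    have "\<not> y < c" using r.descendants_same_side[OF ny c] y0 by simp
    moreover have "R \<theta> c N" using c(2) \<theta>(2) by auto
    ultimately show False using r.descendants_same_side[OF ny c(1), of N] \<open>y < N\<close> by simp
  qed
  have parent_v: "p = 0" if "Ed \<theta> p v" for p
    using r.parent_unique[OF that e0v] nv by simp
  have anc_v: "y \<le> v" if "R \<theta> y v" for y
    using that
  proof (cases rule: rtranclp.cases)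
    case (rtrancl_into_rtrancl p)
    then show ?thesis using parent_v anc0[of y] v by fastforce
  qed simp
  \<comment> \<open>The rotation could give \<open>v\<close> a new parent only by redirecting a
    right parent of \<open>0\<close>, which \<open>anc0\<close> excludes.\<close>
  have root_v: "\<not> Ed (Suc \<theta>) p v" for p
  proof
    assume "Ed (Suc \<theta>) p v"
    then have "r.E' p v" by (simp add: r')
    then show False
    proof (cases rule: r.E'.cases)
      case flipped
      then show False using r.X_diff[OF X0] nv by simp
    next
      case (moved a0 b0)
      show False
      proof (cases "r.Up a0 b0")
        case True
        then have "b0 = 0" using moved(2) by (simp add: r.tgt'_def v_def)
        then have "0 < a0" "Ed \<theta> a0 0" using True moved by (auto simp: r.Up_def)
        then show False using anc0[of a0] by auto
      next
        case False
        then have "b0 = v" using moved(2) by (simp add: r.tgt'_def)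
        then show False using parent_v[of a0] moved(3,4) X0 by (simp add: v_def)
      qed
    qed
  qed
  have no_anc_v: "\<not> (R (Suc \<theta>) y v \<and> y < v)" for y
    using root_v by (metis less_irrefl rtranclp.cases)
  have rotated: "Ed \<tau> u (u + d \<tau>)" "Ed (Suc \<tau>) (u + d \<tau>) u" "0 < d \<tau>"
    if \<tau>: "\<tau> < l" "N dvd u - x \<tau>" for \<tau> u
  proof -
    obtain H' where "rotation N (Ed \<tau>) H' (x \<tau>) (d \<tau>)" using rot \<tau>(1) by blast
    then interpret q: rotation N "Ed \<tau>" H' "x \<tau>" "d \<tau>" .
    show "Ed \<tau> u (u + d \<tau>)" "0 < d \<tau>" using q.rot_edge \<tau> q.d_pos by auto
    show "Ed (Suc \<tau>) (u + d \<tau>) u" unfolding next_edges[OF \<tau>(1)] using \<tau>(2) by (intro q.flipped) (simp add: q.X_def)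
  qed
  \<comment> \<open>After a rotation before \<open>\<theta>\<close>, the edge from
    \<open>u + d \<tau>\<close> to \<open>u\<close> goes left over \<open>v\<close> or ends there,
    so \<open>v\<close> lies below an integer to its right. This persists up to
    \<open>\<theta>\<close>, against \<open>anc_v\<close>.\<close>
  have early: "\<not> (u \<le> v \<and> v < u + d \<tau>)" if \<tau>: "\<tau> \<le> \<theta>" "N dvd u - x \<tau>" for \<tau> u
  proof
    assume u: "u \<le> v \<and> v < u + d \<tau>"
    have tl: "\<tau> < l" using \<tau>(1) \<theta>(1) by simp
    show False
    proof (cases "\<tau> = \<theta>")
      case True
      then have "N dvd u" using r.X_diff[OF X0, of u] \<tau>(2) by (simp add: r.X_def)
      moreover have "0 < u" "u < N" using u True v by (simp_all add: v_def)
      ultimately show False by (simp add: zdvd_not_zless)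
    next
      case False
      then have st: "Suc \<tau> \<le> \<theta>" using \<tau>(1) by simp
      have e: "Ed (Suc \<tau>) (u + d \<tau>) u" using rotated(2)[OF tl \<tau>(2)] .
      have "R (Suc \<tau>) (u + d \<tau>) v"
      proof (cases "u = v")
        case True
        then show ?thesis using e by auto
      next
        case False
        obtain H' where H': "walled N (Ed (Suc \<tau>)) H'" using walls[of "Suc \<tau>"] tl by auto
        then show ?thesis using walled.wall_below[OF H' e nv] u False by (simp add: strictly_between_def)
      qed
      then have "R \<theta> (u + d \<tau>) v" using R_left_mono[OF st] \<theta>(1) u by simp
      then show False using anc_v u by force
    qed
  qed
  \<comment> \<open>The edge would put \<open>v\<close> below an integer to its left, and this would
    hold already right after rotation \<open>\<theta>\<close>, when \<open>v\<close> has no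
    parent.\<close>
  have late: "\<not> (u < v \<and> v \<le> u + d \<tau>)" if \<tau>: "\<theta> < \<tau>" "\<tau> < l" "N dvd u - x \<tau>" for \<tau> u
  proof
    assume u: "u < v \<and> v \<le> u + d \<tau>"
    have e: "Ed \<tau> u (u + d \<tau>)" using rotated(1)[OF \<tau>(2,3)] .
    have "R \<tau> u v"
    proof (cases "u + d \<tau> = v")
      case True
      then show ?thesis using e by auto
    next
      case False
      obtain H' where H': "walled N (Ed \<tau>) H'" using walls[of "\<tau>"] \<tau> by auto
      then show ?thesis using walled.wall_below[OF H' e nv] u False by (simp add: strictly_between_def)
    qed
    then have "R (Suc \<theta>) u v" using R_right_antimono[of "Suc \<theta>" \<tau> u v] \<tau> u by simp
    then show False using no_anc_v u by blast
  qed
  text \<open>The interval of each rotated edge, translated to start at \<open>v + 1, \<dots>, v + N\<close> for the rotations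
    up to \<open>\<theta>\<close> and at \<open>v, \<dots>, v + N - 1\<close> for the later ones.\<close>
  define w where "w \<tau> = (if \<tau> \<le> \<theta> then v + 1 else v)" for \<tau>
  define u where "u \<tau> = w \<tau> + (x \<tau> - w \<tau>) mod N" for \<tau>
  define f where "f \<tau> = (nat (u \<tau> + d \<tau> - v), nat (u \<tau> - v))" for \<tau>
  have ux: "N dvd u \<tau> - x \<tau>" "N dvd (u \<tau> - N) - x \<tau>" for \<tau>
  proof -
    have "u \<tau> - x \<tau> = - ((x \<tau> - w \<tau>) - (x \<tau> - w \<tau>) mod N)" by (simp add: u_def)
    also have "N dvd \<dots>" by (simp only: dvd_minus_iff dvd_minus_mod)
    finally show 1: "N dvd u \<tau> - x \<tau>" .
    have eq: "(u \<tau> - N) - x \<tau> = (u \<tau> - x \<tau>) - N" by simp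
    show "N dvd (u \<tau> - N) - x \<tau>" unfolding eq by (rule dvd_diff[OF 1 dvd_refl])
  qed
  have ub: "w \<tau> \<le> u \<tau>" "u \<tau> < w \<tau> + N" for \<tau>
    using N_gt by (simp_all add: u_def)
  let ?P = "(SIGMA j:{..nat N}. {..<j}) :: (nat \<times> nat) set"
  have finP: "finite ?P" by (rule finite_SigmaI) simp_all
  have inj: "inj_on f {..<l}"
  proof (rule linorder_inj_onI)
    fix \<tau> \<tau>' assume \<tau>: "\<tau> < \<tau>'" "\<tau> \<in> {..<l}" "\<tau>' \<in> {..<l}"
    have vu: "v \<le> u \<tau>" for \<tau> using ub(1)[of \<tau>] by (simp add: w_def split: if_splits)
    have dp: "0 < d \<tau>" "0 < d \<tau>'" using rotated(3)[OF _ ux(1), of \<tau>] rotated(3)[OF _ ux(1), of \<tau>'] \<tau> by simp_all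
    show "f \<tau> \<noteq> f \<tau>'"
    proof
      assume "f \<tau> = f \<tau>'"
      then have eq: "u \<tau> = u \<tau>'" "d \<tau> = d \<tau>'" using vu[of \<tau>] vu[of \<tau>'] dp by (auto simp: f_def)
      have "R (Suc \<tau>) (u \<tau> + d \<tau>) (u \<tau>)" using rotated(2)[OF _ ux(1)] \<tau> by blast
      then have 1: "R \<tau>' (u \<tau> + d \<tau>) (u \<tau>)" using R_left_mono[of "Suc \<tau>" \<tau>'] \<tau> dp by simp
      have 2: "Ed \<tau>' (u \<tau>) (u \<tau> + d \<tau>)" using rotated(1)[OF _ ux(1)] \<tau> eq by simp
      obtain H' where H': "walled N (Ed \<tau>') H'" using walls[of \<tau>'] \<tau> by auto
      show False using walled.height[OF H' 2] walled.height_rtranclp[OF H' 1] by simp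
    qed
  qed auto
  have sub: "f ` {..<l} \<subseteq> ?P - {(nat N, 0)}"
  proof
    fix y assume "y \<in> f ` {..<l}"
    then obtain \<tau> where \<tau>: "\<tau> < l" "y = f \<tau>" by auto
    have dp: "0 < d \<tau>" using rotated(3)[OF \<tau>(1) ux(1)] .
    \<comment> \<open>\<open>early\<close> and \<open>late\<close>, applied to the translate
      starting at \<open>u \<tau> - N\<close>, bound the right end by \<open>v + N\<close>. The full
      turn is excluded by \<open>v < u \<tau>\<close> up to \<open>\<theta>\<close>, and by
      \<open>u \<tau> + d \<tau> < v + N\<close> afterwards.\<close>
    have "v \<le> u \<tau> \<and> u \<tau> + d \<tau> \<le> v + N \<and> \<not> (u \<tau> = v \<and> u \<tau> + d \<tau> = v + N)"
    proof (cases "\<tau> \<le> \<theta>")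
      case True
      have "v + 1 \<le> u \<tau>" "u \<tau> \<le> v + N" using ub[of \<tau>] True by (simp_all add: w_def)
      then show ?thesis using early[OF True ux(2)] by simp
    next
      case False
      then have "v \<le> u \<tau>" "u \<tau> < v + N" using ub[of \<tau>] by (simp_all add: w_def)
      then show ?thesis using late[OF _ \<tau>(1) ux(2)] False by simp
    qed
    then show "y \<in> ?P - {(nat N, 0)}"
      using dp N_gt by (auto simp: \<tau>(2) f_def)
  qed
  have "card {..<l} \<le> card (?P - {(nat N, 0)})"
    by (rule card_inj_on_le[OF inj sub]) (use finP in simp)
  also have "\<dots> < card ?P"
  proof (rule psubset_card_mono[OF finP])
    have "(nat N, 0) \<in> ?P" using N_gt by simp
    then show "?P - {(nat N, 0)} \<subset> ?P" by blast
  qed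
  also have "\<dots> = (\<Sum>j\<le>nat N. j)" by simp
  finally show ?thesis by simp
qed

end

section \<open>From green sequences to sequences of rotations\<close>

context annulus
begin

definition models :: "(nat \<Rightarrow> int) \<Rightarrow> (nat \<Rightarrow> int) \<Rightarrow> (nat \<Rightarrow> nat \<Rightarrow> int) \<Rightarrow> bool" where
  "models s t c \<longleftrightarrow> (\<forall>i\<le>n. \<forall>j\<le>n. c i j = cvec (s i) (t i) j)"

lemma models_nonneg: "models s t c \<Longrightarrow> i \<le> n \<Longrightarrow> nonneg n (c i) \<longleftrightarrow> s i \<le> t i"
  using nonneg_cvec_iff[of "s i" "t i"] by (simp add: models_def nonneg_def)

lemma flip_step: 
  assumes "admissible s t" "models s t c" "k \<le> n" "nonneg n (c k)"
  obtains s' t' H where "admissible s' t'" "models s' t' (cmut n k c)"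
    "rotation N (edge s t) H (s k) (t k - s k)"
    "edge s' t' = rotation.E' N (edge s t) (s k) (t k - s k)"
proof -
  have "s k \<le> t k" using models_nonneg[OF assms(2,3)] assms(4) by simp
  moreover have "s k \<noteq> t k" using admissible_noloop[OF assms(1,3)] by auto
  ultimately interpret annulus_flip n N s t k
    using assms(1,3) by unfold_locales auto
  obtain H where H: "rotation N (edge s t) H (s k) (t k - s k)" by (rule rotation_exists)
  have "models s' t' (cmut n k c)"
    unfolding models_def
  proof (intro allI impI)
    fix i j assume ij: "i \<le> n" "j \<le> n"
    have c: "c i j = cvec (s i) (t i) j" if "i \<le> n" "j \<le> n" for i j using assms(2) that by (simp add: models_def)
    show "cmut n k c i j = cvec (s' i) (t' i) j"
    proof (cases "i = k")
      case True
      then show ?thesis using c ij k by (simp add: cmut_def cvec'_k)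
    next
      case False
      have "om n (c i) (c k) = om n (cvec (s i) (t i)) (cvec (s k) (t k))"
        using c ij k by (intro om_cong) auto
      then show ?thesis using False c ij k om_k_pos[OF ij(1) False] cvec'[OF ij(1) False]
        by (simp add: cmut_def)
    qed
  qed
  then show ?thesis using that admissible' H edge'[OF H] by blast
qed

lemma rotation_sequence_exists:
  assumes "max_green n c ks" "admissible s t" "models s t c"
  shows "\<exists>Ed x d. Ed 0 = edge s t \<and>
    (\<forall>\<tau><length ks. (\<exists>H. rotation N (Ed \<tau>) H (x \<tau>) (d \<tau>)) \<and> Ed (Suc \<tau>) = rotation.E' N (Ed \<tau>) (x \<tau>) (d \<tau>)) \<and>
    (\<forall>\<tau>\<le>length ks. \<exists>H. walled N (Ed \<tau>) H) \<and> (\<forall>a b. Ed (length ks) a b \<longrightarrow> b < a)"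
  using assms
proof (induction ks arbitrary: c s t)
  case Nil
  have lt: "t i < s i" if "i \<le> n" for i 
    using Nil that models_nonneg[OF Nil(3)] by (force simp: max_green_Nil)
  have "b < a" if "edge s t a b" for a b using that lt by (force simp: edge_def)
  moreover obtain H where "walled N (edge s t) H" by (rule admissible_walled[OF Nil(2)])
  ultimately show ?case by (intro exI[of _ "\<lambda>_. edge s t"]) auto
next
  case (Cons k ks)
  then have k: "k \<le> n" "nonneg n (c k)" "max_green n (cmut n k c) ks" by (auto simp: max_green_Cons)
  obtain s' t' H where st: "admissible s' t'" "models s' t' (cmut n k c)"
    "rotation N (edge s t) H (s k) (t k - s k)"
    "edge s' t' = rotation.E' N (edge s t) (s k) (t k - s k)"
    by (rule flip_step[OF Cons.prems(2,3) k(1,2)])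
  obtain Ed x d where E: "Ed 0 = edge s' t'"
    "\<forall>\<tau><length ks. (\<exists>H. rotation N (Ed \<tau>) H (x \<tau>) (d \<tau>)) \<and> Ed (Suc \<tau>) = rotation.E' N (Ed \<tau>) (x \<tau>) (d \<tau>)"
    "\<forall>\<tau>\<le>length ks. \<exists>H. walled N (Ed \<tau>) H" "\<forall>a b. Ed (length ks) a b \<longrightarrow> b < a"
    using Cons.IH[OF k(3) st(1,2)] by blast
  obtain H0 where H0: "walled N (edge s t) H0" by (rule admissible_walled[OF Cons.prems(2)])
  let ?Ed = "case_nat (edge s t) Ed" and ?x = "case_nat (s k) x" and ?d = "case_nat (t k - s k) d"
  have "(\<exists>H. rotation N (?Ed \<tau>) H (?x \<tau>) (?d \<tau>)) \<and> ?Ed (Suc \<tau>) = rotation.E' N (?Ed \<tau>) (?x \<tau>) (?d \<tau>)"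
    if "\<tau> < length (k # ks)" for \<tau>
    using that E(1,2) st(3,4) by (cases \<tau>) auto
  moreover have "\<exists>H. walled N (?Ed \<tau>) H" if "\<tau> \<le> length (k # ks)" for \<tau>
    using that E(3) H0 by (cases \<tau>) auto
  ultimately show ?case using E(4)
    by (intro exI[of _ ?Ed] exI[of _ ?x] exI[of _ ?d]) auto
qed

section \<open>The initial graph\<close>

lemma small_dvd_diff: "i \<le> n \<Longrightarrow> j \<le> n \<Longrightarrow> N dvd int i - int j \<longleftrightarrow> i = j"
proof
  assume "i \<le> n" "j \<le> n" "N dvd int i - int j"
  moreover then have "\<bar>int i - int j\<bar> < N" by (auto simp: N_eq)
  ultimately show "i = j" using zdvd_imp_le[of N "\<bar>int i - int j\<bar>"] by force
qed simp

lemma models_initial: "models int (\<lambda>i. int i + 1) unit_vec"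
  using steps_Suc small_dvd_diff by (auto simp: models_def cvec_def)

lemma edge_initial: "edge int (\<lambda>i. int i + 1) a b \<longleftrightarrow> b = a + 1"
proof
  assume b: "b = a + 1"
  have "a = int (nat (a mod N)) + (a div N) * N" "nat (a mod N) \<le> n"
  proof -
    show "a = int (nat (a mod N)) + (a div N) * N" using N_pos by simp
    show "nat (a mod N) \<le> n" using pos_mod_bound[OF N_pos, of a] by (simp add: N_eq)
  qed
  then show "edge int (\<lambda>i. int i + 1) a b" using b unfolding edge_def by (metis add.commute add.left_commute)
qed (auto simp: edge_def)

lemma admissible_initial: "admissible int (\<lambda>i. int i + 1)"
proof -
  let ?s = "int" and ?t = "\<lambda>i. int i + 1"
  have N2: "2 \<le> N" using n_pos by (simp add: N_eq)
  have slot_iff: "slot ?s ?t z p i \<longleftrightarrow> (if N dvd z then p = 0 \<and> N dvd int i - z \<or> p = 1 \<and> N dvd int i + 1 - z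
      else p = 0 \<and> N dvd int i + 1 - z \<or> p = 1 \<and> N dvd int i - z)" for z p i
    by (auto simp: slot_def)
  have "i = j" if "i \<le> n" "j \<le> n" "slot ?s ?t z p i" "slot ?s ?t z p j" for z p i j
  proof -
    have "N dvd int i - z \<and> N dvd int j - z \<or> N dvd int i + 1 - z \<and> N dvd int j + 1 - z"
      using that(3,4) unfolding slot_iff by (auto split: if_splits)
    then have "N dvd (int i - z) - (int j - z) \<or> N dvd (int i + 1 - z) - (int j + 1 - z)"
      using dvd_diff by blast
    then show ?thesis using small_dvd_diff[OF that(1,2)] by simp
  qed
  moreover have "\<not> strictly_between a z b" if "edge ?s ?t a b" for a b z
    using that by (auto simp: edge_initial strictly_between_def)
  \<comment> \<open>The potential is minus the weighted count of residues passed: edge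
    \<open>i\<close> and its translates pass only the residue \<open>i\<close>.\<close>
  moreover have "\<exists>H. \<forall>i\<le>n. \<forall>m. H (?s i + m * N) - H (?t i + m * N) = w i" for w :: "nat \<Rightarrow> int"
  proof (intro exI allI impI)
    fix i m assume i: "i \<le> n"
    have "steps j (int i + 1) - steps j (int i) = of_bool (i = j)" if "j \<le> n" for j
      using steps_Suc small_dvd_diff[OF i that] by simp
    then have "(\<Sum>j\<le>n. w j * steps j (int i + 1 + m * N)) - (\<Sum>j\<le>n. w j * steps j (int i + m * N)) = (\<Sum>j\<le>n. if i = j then w j else 0)"
      unfolding sum_subtractf[symmetric] steps_shift 
      by (intro sum.cong) (auto simp: right_diff_distrib[symmetric])
    also have "\<dots> = w i" using i by simp
    finally show "- (\<Sum>j\<le>n. w j * steps j (int i + m * N)) - - (\<Sum>j\<le>n. w j * steps j (int i + 1 + m * N)) = w i"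
      by simp
  qed
  moreover have "om n (cvec (?s i) (?t i)) (cvec (?s j) (?t j)) = (\<Sum>z\<in>{0..<N}. wedge ?s ?t z i j)"
    if ij: "i \<le> n" "j \<le> n" for i j
  proof -
    have 1: "om n (cvec (?s i) (?t i)) (cvec (?s j) (?t j)) = om n (unit_vec i) (unit_vec j)"
      using models_initial ij by (intro om_cong) (auto simp: models_def)
    have sl: "N dvd int i - int m \<longleftrightarrow> i = m" "N dvd int i + 1 - int m \<longleftrightarrow> (if m = 0 then i = n else Suc i = m)"
      if "i \<le> n" "m \<le> n" for i m
    proof -
      show "N dvd int i - int m \<longleftrightarrow> i = m" using that by (rule small_dvd_diff)
      show "N dvd int i + 1 - int m \<longleftrightarrow> (if m = 0 then i = n else Suc i = m)"
      proof (cases m)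
        case 0
        have "N dvd int i + 1 \<longleftrightarrow> N dvd int i + 1 - N" using dvd_shift_iff[of "int i + 1" 0 1] by simp
        also have "int i + 1 - N = int i - int n" by (simp add: N_eq)
        finally show ?thesis using 0 small_dvd_diff[of i n] that by simp
      next
        case (Suc m')
        then show ?thesis using small_dvd_diff[of i m'] that by simp
      qed
    qed
    have dm: "N dvd int m \<longleftrightarrow> m = 0" if "m \<le> n" for m using small_dvd_diff[of m 0] that by simp
    \<comment> \<open>Node \<open>0\<close> carries the extra arrow from \<open>0\<close> to
      \<open>n\<close>, and node \<open>m > 0\<close> the arrow from \<open>m - 1\<close> to
      \<open>m\<close>.\<close>
    have w: "wedge ?s ?t (int m) i j = (if m = 0 then of_bool (i = 0 \<and> j = n) - of_bool (i = n \<and> j = 0)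
        else of_bool (Suc i = m \<and> j = m) - of_bool (i = m \<and> Suc j = m))" if "m \<le> n" for m
    proof (cases "m = 0")
      case True
      then show ?thesis using sl(2)[OF ij(1) that] sl(2)[OF ij(2) that] dm[OF ij(1)] dm[OF ij(2)]
        by (simp add: cyc3_def slot_iff of_bool_conj[symmetric])
    next
      case False
      have "wedge ?s ?t (int m) i j = of_bool (Suc i = m) * of_bool (j = m) - of_bool (i = m) * of_bool (Suc j = m)"
        unfolding cyc3_def slot_iff dm[OF that] sl[OF ij(1) that] sl[OF ij(2) that] using False by simp
      then show ?thesis using False by (simp add: of_bool_conj)
    qed
    have "{0..<N} = int ` {..n}"
    proof (intro subset_antisym subsetI)
      fix z assume "z \<in> {0..<N}"
      then have "z = int (nat z)" "nat z \<in> {..n}" by (auto simp: N_eq)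
      then show "z \<in> int ` {..n}" by blast
    qed (auto simp: N_eq)
    then have "(\<Sum>z\<in>{0..<N}. wedge ?s ?t z i j) = (\<Sum>m\<le>n. wedge ?s ?t (int m) i j)"
      by (simp add: sum.reindex)
    also have "\<dots> = (of_bool (i = 0 \<and> j = n) - of_bool (i = n \<and> j = 0))
        + (\<Sum>m\<in>{1..n}. of_bool (Suc i = m \<and> j = m) - of_bool (i = m \<and> Suc j = m))"
    proof -
      let ?f = "\<lambda>m. if m = 0 then of_bool (i = 0 \<and> j = n) - of_bool (i = n \<and> j = 0)
        else of_bool (Suc i = m \<and> j = m) - of_bool (i = m \<and> Suc j = m) :: int"
      have "(\<Sum>m\<le>n. wedge ?s ?t (int m) i j) = (\<Sum>m\<in>insert 0 {1..n}. ?f m)"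
      proof (rule sum.cong)
        show "{..n} = insert 0 {1..n}" by auto
        fix m assume "m \<in> insert 0 {1..n}"
        then have "m \<le> n" by auto
        then show "wedge ?s ?t (int m) i j = ?f m" by (rule w)
      qed
      also have "\<dots> = ?f 0 + (\<Sum>m\<in>{1..n}. ?f m)" by (rule sum.insert) auto
      also have "(\<Sum>m\<in>{1..n}. ?f m) = (\<Sum>m\<in>{1..n}. of_bool (Suc i = m \<and> j = m) - of_bool (i = m \<and> Suc j = m))"
        by (intro sum.cong) auto
      finally show ?thesis by simp
    qed
    also have "(\<Sum>m\<in>{1..n}. of_bool (Suc i = m \<and> j = m) - of_bool (i = m \<and> Suc j = m)) 
       = (\<Sum>m\<in>{1..n}. if m = j then of_bool (Suc i = j) else 0) - (\<Sum>m\<in>{1..n}. if m = i then of_bool (Suc j = i) else (0::int))"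
      unfolding sum_subtractf[symmetric] by (intro sum.cong) auto
    also have "\<dots> = of_bool (Suc i = j) - of_bool (Suc j = i)" using ij by (auto simp: sum.delta)
    finally show ?thesis unfolding 1 om_unit_vec[OF n_pos ij] by auto
  qed
  moreover have "\<not> N dvd ?t i - ?s i" for i using N2 by (auto dest: zdvd_imp_le)
  moreover have "\<exists>i\<le>n. N dvd ?s i \<or> N dvd ?t i" by (intro exI[of _ 0]) auto
  ultimately show ?thesis unfolding admissible_def by blast
qed

lemma max_green_length_le:
  assumes "max_green n unit_vec ks"
  shows "length ks \<le> n * (n + 3) div 2"
proof -
  obtain Ed x d where E: "Ed 0 = edge int (\<lambda>i. int i + 1)"
    "\<forall>\<tau><length ks. (\<exists>H. rotation N (Ed \<tau>) H (x \<tau>) (d \<tau>)) \<and> Ed (Suc \<tau>) = rotation.E' N (Ed \<tau>) (x \<tau>) (d \<tau>)"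
    "\<forall>\<tau>\<le>length ks. \<exists>H. walled N (Ed \<tau>) H" "\<forall>a b. Ed (length ks) a b \<longrightarrow> b < a"
    using rotation_sequence_exists[OF assms admissible_initial models_initial] by blast
  interpret rotation_sequence N "length ks" Ed x d
  proof
    show "1 < N" using n_pos by (simp add: N_eq)
    show "Ed 0 a (a + 1)" for a unfolding E(1) edge_initial ..
  qed (use E in blast)+
  have "length ks < (\<Sum>j\<le>nat N. j)" by (rule length_bound)
  also have "nat N = n + 1" by (simp add: N_eq)
  also have "(\<Sum>j\<le>n + 1. j) = (n + 1) * (n + 2) div 2" using Sum_Icc_nat[of 0 "n + 1"] by (simp add: atLeast0AtMost)
  also have "\<dots> = n * (n + 3) div 2 + 1" by (simp add: algebra_simps)
  finally show ?thesis by simp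
qed

end

theorem theorem5p3:
  fixes n :: nat
  assumes "n \<ge> 1"
  shows "{l. \<exists>ks. maximal_green_seq n (framed n (atilde n)) ks \<and> length ks = l}
           = {n + 1 .. n * (n + 3) div 2}"
proof -
  interpret annulus n "int n + 1" using assms by unfold_locales auto
  have "lengths n unit_vec \<subseteq> {n + 1 .. n * (n + 3) div 2}"
    using max_green_length_ge max_green_length_le by (auto simp: lengths_def)
  moreover have "{n + 1 .. n * (n + 3) div 2} \<subseteq> lengths n unit_vec"
    using lengths_interval[OF assms] by auto
  ultimately show ?thesis using lengths_eq[OF assms] by simp
qed

end
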